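(* There is a quantum algorithm which, given an integer $k\ge 1$, a parameter $\varepsilon>0$, and oracle access to an unknown $n$-qubit unitary $U\in\mathcal{U}_N$ and its inverse $U^\dagger$ (with $N=2^n$), outputs with probability at least $9/10$ "Yes" if $U$ is a quantum $k$-junta and "No" if $U$ is $\varepsilon$-far from every quantum $k$-junta (i.e. $\mathrm{dist}(U,V)\ge\varepsilon$ for every quantum $k$-junta $V$ on $n$ qubits). The algorithm has two-sided error and makes $O\!\left(\frac{\sqrt{k\log k}}{\varepsilon}\log k\right)$ calls to the unitary $U$; in particular the number of queries is independent of $n$.
   Context: $N=2^n$ and $\mathcal{U}_N$ denotes the set of $N\times N$ unitary matrices, viewed as acting on $n$ qubits. A unitary $U\in\mathcal{U}_N$ is a quantum $k$-junta if there is a set $S\subseteq[n]$ with $|S|=k$ and a $k$-qubit unitary $V_S\in\mathcal{U}_{2^k}$ such that $U=V_S\otimes I_{\overline{S}}$ (acting as $V_S$ on the qubits in $S$ and as the identity on the qubits in $\overline{S}=[n]\setminus S$). For $A,B\in\mathbb{C}^{N\times N}$, $\mathrm{dist}(A,B):=\min_{\theta\in[0,2\pi)}\frac{1}{\sqrt{2N}}\|e^{i\theta}A-B\|$, where $\|\cdot\|$ is the Frobenius (Hilbert–Schmidt) norm, $\|A\|^2=\mathrm{Tr}(A^\dagger A)$. An oracle for a unitary $U$ maps an input state $|\psi\rangle$ to $U|\psi\rangle$. *)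

theory Defs
  imports Complex_Main
begin

text \<open>Square complex matrices of size d are represented as functions nat => nat => complex;
  only entries with both indices below d are meaningful.  Vectors are nat => complex.\<close>

type_synonym cmat = "nat \<Rightarrow> nat \<Rightarrow> complex"
type_synonym cvec = "nat \<Rightarrow> complex"

definition mat_vec :: "nat \<Rightarrow> cmat \<Rightarrow> cvec \<Rightarrow> cvec" where
  "mat_vec d A v = (\<lambda>i. \<Sum>j<d. A i j * v j)"

definition adjoint :: "cmat \<Rightarrow> cmat" where
  "adjoint A = (\<lambda>i j. cnj (A j i))"

definition is_unitary :: "nat \<Rightarrow> cmat \<Rightarrow> bool" where
  "is_unitary d A \<longleftrightarrow>
     (\<forall>i<d. \<forall>j<d. (\<Sum>l<d. cnj (A l i) * A l j) = (if i = j then 1 else 0))"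

definition frob_norm :: "nat \<Rightarrow> cmat \<Rightarrow> real" where
  "frob_norm d A = sqrt (\<Sum>i<d. \<Sum>j<d. (cmod (A i j))\<^sup>2)"

definition qdist :: "nat \<Rightarrow> cmat \<Rightarrow> cmat \<Rightarrow> real" where
  "qdist n A B = (INF \<theta>\<in>{0..<2*pi}.
      frob_norm (2^n) (\<lambda>i j. cis \<theta> * A i j - B i j) / sqrt (2 * 2^n))"

text \<open>Computational basis state x < 2^n; qubit j carries bit j of x.\<close>
definition qbit :: "nat \<Rightarrow> nat \<Rightarrow> bool" where
  "qbit x j \<longleftrightarrow> odd (x div 2^j)"

definition restrict_idx :: "nat set \<Rightarrow> nat \<Rightarrow> nat" where
  "restrict_idx S x = (\<Sum>i<card S. if qbit x (sorted_list_of_set S ! i) then 2^i else 0)"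

text \<open>U (on n qubits) is a quantum k-junta: U = V_S (x) I_{complement of S}
  with S a k-subset of the n qubits and V_S a k-qubit unitary.\<close>
definition is_qjunta :: "nat \<Rightarrow> nat \<Rightarrow> cmat \<Rightarrow> bool" where
  "is_qjunta n k U \<longleftrightarrow>
     (\<exists>S V. S \<subseteq> {..<n} \<and> card S = k \<and> is_unitary (2^k) V \<and>
        (\<forall>x<2^n. \<forall>y<2^n.
           U x y = (if (\<forall>j<n. j \<notin> S \<longrightarrow> (qbit x j \<longleftrightarrow> qbit y j))
                    then V (restrict_idx S x) (restrict_idx S y) else 0)))"

text \<open>Quantum query algorithms.  The workspace consists of the n oracle qubits and m
  ancilla qubits; a basis index of the workspace is x + 2^n * a with x < 2^n, a < 2^m.
  The oracle O acting on the system qubits is extended as O (x) I_ancilla.\<close>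
definition extend_oracle :: "nat \<Rightarrow> cmat \<Rightarrow> cmat" where
  "extend_oracle n Orc = (\<lambda>z w. if z div 2^n = w div 2^n then Orc (z mod 2^n) (w mod 2^n) else 0)"

text \<open>An algorithm with T queries is given by: the number m of ancilla qubits,
  unitaries W 0, ..., W T on the workspace, a choice (qinv t) of whether query t
  (t < T) is to U^dagger (True) or to U (False), and an accepting set Acc of
  computational basis states measured at the end (output "Yes" iff the outcome lies in Acc).
  The state is W_T O_{T-1} W_{T-1} ... W_1 O_0 W_0 |0>.\<close>
fun alg_state :: "nat \<Rightarrow> nat \<Rightarrow> (nat \<Rightarrow> cmat) \<Rightarrow> (nat \<Rightarrow> bool) \<Rightarrow> cmat \<Rightarrow> nat \<Rightarrow> cvec" where
  "alg_state n m W qinv U 0 = mat_vec (2^n * 2^m) (W 0) (\<lambda>z. if z = 0 then 1 else 0)"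
| "alg_state n m W qinv U (Suc t) =
     mat_vec (2^n * 2^m) (W (Suc t))
       (mat_vec (2^n * 2^m) (extend_oracle n (if qinv t then adjoint U else U))
          (alg_state n m W qinv U t))"

definition valid_alg :: "nat \<Rightarrow> nat \<Rightarrow> nat \<Rightarrow> (nat \<Rightarrow> cmat) \<Rightarrow> nat set \<Rightarrow> bool" where
  "valid_alg n m T W Acc \<longleftrightarrow> (\<forall>t\<le>T. is_unitary (2^n * 2^m) (W t)) \<and> Acc \<subseteq> {..<2^n * 2^m}"

definition accept_prob :: "nat \<Rightarrow> nat \<Rightarrow> nat \<Rightarrow> (nat \<Rightarrow> cmat) \<Rightarrow> (nat \<Rightarrow> bool) \<Rightarrow> nat set \<Rightarrow> cmat \<Rightarrow> real" where
  "accept_prob n m T W qinv Acc U = (\<Sum>z\<in>Acc. (cmod (alg_state n m W qinv U T z))\<^sup>2)"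

end

theory Submission
  imports "HOL-Analysis.Analysis" "HOL-Library.Nat_Bijection" Defs
begin

text \<open>Expand \<open>U\<close> in the Pauli basis and let \<open>Inf T\<close> be the squared weight on the Paulis acting nontrivially on
  the set \<open>T\<close> of qubits.  For a junta on \<open>A\<close>, \<open>Inf T = 0\<close> whenever \<open>T\<close> misses \<open>A\<close>; for a \<open>U\<close> that is \<open>\<epsilon>\<close>-far from all
  \<open>k\<close>-juntas, \<open>Inf (- A) \<ge> \<epsilon>\<^sup>2\<close> for every \<open>k\<close>-set \<open>A\<close>.  The tester is a quantum group test: positive instances are
  witnessed by a superposition of random sets \<open>T\<close> missing \<open>A\<close>, negative ones by a set \<open>B\<close> of \<open>k + d\<close> influential
  qubits (or a random such set), with weight on those \<open>T\<close> that hit \<open>B\<close> exactly once.  Adding the elements outside \<open>A\<close>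
  to \<open>T\<close> in random order, the first hit of \<open>B\<close> occurs at some time with probability one; this makes the inner product
  of any two such witnesses exactly one, whatever \<open>A\<close> and \<open>B\<close> are.  Hence each witness is an exact
  catalyst for a single reflection step, which acts as \<open>+1\<close> or \<open>-1\<close> on a public state, and the product of the witness norms
  bounds the number of queries.\<close>

section \<open>Linear algebra\<close>

text \<open>The catalyst enters with squared amplitude of order \<open>1 / K\<close>, so the number
  \<open>K\<close> of rounds has to dominate the squared norms of both witnesses. A free scale
  \<open>r\<close> moves norm from one to the other, and balancing leaves the geometric mean of
  \<open>ln k\<close> and \<open>k * ln k / \<epsilon>\<^sup>2\<close>, that is
  \<open>sqrt k * ln k / \<epsilon>\<close>. The two logarithms have different origins. The positive
  one is the total weight of all sizes of \<open>T\<close>: the tester does not know at which size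
  \<open>B\<close> is first hit. The negative one is a harmonic sum: joint influence is only
  subadditive, and passing from "every complement of a \<open>k\<close>-set is influential" to a
  single set or distribution \<open>B\<close> loses \<open>harm k\<close>.

  The inner products must be exactly one because one fixed algorithm has to serve every pair, and a
  defect in each round would add up over \<open>K\<close> rounds. A first hit outside
  \<open>A\<close> is certain because \<open>B\<close> has more than \<open>k\<close> elements; how
  many more, \<open>d\<close>, enters the norm through \<open>(k + d) / d\<close>. Both the oracle
  and its inverse occur in each round: whether a Pauli acts on \<open>T\<close> is tested in the
  Bell basis after \<open>U\<close>, and \<open>U\<close> is then undone.\<close>

definition ip :: "nat \<Rightarrow> cvec \<Rightarrow> cvec \<Rightarrow> complex" where
  "ip d v w = (\<Sum>i<d. cnj (v i) * w i)"

definition nsq :: "nat \<Rightarrow> cvec \<Rightarrow> real" where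
  "nsq d v = (\<Sum>i<d. (cmod (v i))\<^sup>2)"

lemma nsq_nonneg [simp]: "0 \<le> nsq d v"
  by (simp add: nsq_def sum_nonneg)

lemma ip_self: "ip d v v = of_real (nsq d v)"
  unfolding ip_def nsq_def of_real_sum complex_norm_square by (simp add: mult.commute)

lemma ip_cong: "(\<And>i. i < d \<Longrightarrow> v i = v' i) \<Longrightarrow> (\<And>i. i < d \<Longrightarrow> w i = w' i) \<Longrightarrow> ip d v w = ip d v' w'"
  by (simp add: ip_def)

lemma nsq_cong: "(\<And>i. i < d \<Longrightarrow> v i = v' i) \<Longrightarrow> nsq d v = nsq d v'"
  by (simp add: nsq_def)

lemma mat_vec_cong: "(\<And>i. i < d \<Longrightarrow> v i = v' i) \<Longrightarrow> mat_vec d A v = mat_vec d A v'"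
  by (simp add: mat_vec_def)

lemma ip_add: "ip d v (\<lambda>i. w i + w' i) = ip d v w + ip d v w'"
  by (simp add: ip_def algebra_simps sum.distrib)

lemma ip_diff: "ip d v (\<lambda>i. w i - w' i) = ip d v w - ip d v w'"
  by (simp add: ip_def algebra_simps sum_subtractf)

lemma ip_scale: "ip d v (\<lambda>i. c * w i) = c * ip d v w"
  by (simp add: ip_def sum_distrib_left mult_ac)

lemma ip_add_left: "ip d (\<lambda>i. v i + c * w i) z = ip d v z + cnj c * ip d w z"
  by (simp add: ip_def algebra_simps sum.distrib sum_distrib_left)

lemma ip_sum: "ip d v (\<lambda>i. \<Sum>a\<in>A. w a i) = (\<Sum>a\<in>A. ip d v (w a))"
  unfolding ip_def by (simp add: sum_distrib_left) (rule sum.swap)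

lemma ip_commute: "ip d w v = cnj (ip d v w)"
  by (simp add: ip_def mult.commute)

lemma mat_vec_add: "mat_vec d A (\<lambda>i. v i + w i) = (\<lambda>i. mat_vec d A v i + mat_vec d A w i)"
  by (simp add: mat_vec_def algebra_simps sum.distrib)

lemma mat_vec_diff: "mat_vec d A (\<lambda>i. v i - w i) = (\<lambda>i. mat_vec d A v i - mat_vec d A w i)"
  by (simp add: mat_vec_def algebra_simps sum_subtractf)

lemma mat_vec_scale: "mat_vec d A (\<lambda>i. c * v i) = (\<lambda>i. c * mat_vec d A v i)"
  by (simp add: mat_vec_def sum_distrib_left mult_ac)

lemma mat_vec_uminus: "mat_vec d A (\<lambda>i. - v i) = (\<lambda>i. - mat_vec d A v i)"
  by (simp add: mat_vec_def sum_negf)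

lemma mat_vec_sum: "mat_vec d A (\<lambda>i. \<Sum>a\<in>B. w a i) = (\<lambda>i. \<Sum>a\<in>B. mat_vec d A (w a) i)"
  unfolding mat_vec_def by (simp add: sum_distrib_left) (rule ext, rule sum.swap)

lemma sum_delta_lt:
  fixes f :: "nat \<Rightarrow> complex"
  assumes "i < d"
  shows "(\<Sum>j<d. (if i = j then 1 else 0) * f j) = f i"
proof -
  have "(\<Sum>j<d. (if i = j then 1 else 0) * f j) = (\<Sum>j<d. if j = i then f j else 0)"
    by (intro sum.cong) auto
  then show ?thesis using assms by simp
qed

lemma ip_mat_vec_adjoint: "ip d (mat_vec d A v) w = ip d v (mat_vec d (adjoint A) w)"
  unfolding ip_def mat_vec_def adjoint_def
  by (simp add: sum_distrib_left sum_distrib_right mult_ac) (rule sum.swap)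

lemma unitary_left_inverse:
  assumes "is_unitary d A" "i < d"
  shows "mat_vec d (adjoint A) (mat_vec d A v) i = v i"
proof -
  have "mat_vec d (adjoint A) (mat_vec d A v) i = (\<Sum>l<d. \<Sum>j<d. cnj (A l i) * A l j * v j)"
    by (simp add: mat_vec_def adjoint_def sum_distrib_left mult_ac)
  also have "\<dots> = (\<Sum>j<d. (\<Sum>l<d. cnj (A l i) * A l j) * v j)"
    by (subst sum.swap) (simp add: sum_distrib_right)
  also have "\<dots> = (\<Sum>j<d. (if i = j then 1 else 0) * v j)"
    using assms by (intro sum.cong) (auto simp: is_unitary_def)
  finally show ?thesis using sum_delta_lt[OF assms(2)] by simp
qed

lemma unitary_ip:
  assumes "is_unitary d A"
  shows "ip d (mat_vec d A v) (mat_vec d A w) = ip d v w"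
  unfolding ip_mat_vec_adjoint
  by (rule ip_cong) (simp_all add: unitary_left_inverse[OF assms])

lemma unitary_nsq:
  assumes "is_unitary d A"
  shows "nsq d (mat_vec d A v) = nsq d v"
  using unitary_ip[OF assms, of v v] by (simp add: ip_self)

text \<open>\<open>A\<close> is an isometry, so \<open>A A\<^sup>*\<close> is a projection of trace \<open>d\<close>, and its distance from the
  identity in Frobenius norm is \<open>d - 2 d + d = 0\<close>.\<close>

lemma unitary_adjoint:
  assumes U: "is_unitary d A"
  shows "is_unitary d (adjoint A)"
proof -
  define P where "P i j = (\<Sum>l<d. A i l * cnj (A j l))" for i j
  define e where "e i j = (if i = j then 1 else 0 :: complex)" for i j :: nat
  have col: "(\<Sum>l<d. cnj (A l i) * A l j) = e i j" if "i < d" "j < d" for i j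
    using U that by (simp add: is_unitary_def e_def)
  have trP: "(\<Sum>i<d. P i i) = of_nat d"
  proof -
    have "(\<Sum>i<d. P i i) = (\<Sum>l<d. \<Sum>i<d. cnj (A i l) * A i l)"
      unfolding P_def by (subst sum.swap) (simp add: mult.commute)
    also have "\<dots> = (\<Sum>l<d. 1)" using col by (intro sum.cong) (auto simp: e_def)
    finally show ?thesis by simp
  qed
  have herm: "cnj (P i j) = P j i" for i j
    by (simp add: P_def mult.commute)
  have PA: "(\<Sum>j<d. P i j * A j m) = A i m" if "m < d" for i m
  proof -
    have "(\<Sum>j<d. P i j * A j m) = (\<Sum>l<d. A i l * (\<Sum>j<d. cnj (A j l) * A j m))"
      unfolding P_def sum_distrib_left sum_distrib_right
      by (subst sum.swap) (simp add: mult_ac)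
    also have "\<dots> = (\<Sum>l<d. (if m = l then 1 else 0) * A i l)"
      using that col by (intro sum.cong) (auto simp: e_def)
    also have "\<dots> = A i m" using sum_delta_lt[OF that] by simp
    finally show ?thesis .
  qed
  have idem: "(\<Sum>j<d. P i j * P j i) = P i i" for i
  proof -
    have "(\<Sum>j<d. P i j * P j i) = (\<Sum>m<d. (\<Sum>j<d. P i j * A j m) * cnj (A i m))"
      unfolding P_def[of _ i] sum_distrib_left sum_distrib_right
      by (subst sum.swap) (simp add: mult_ac)
    also have "\<dots> = (\<Sum>m<d. A i m * cnj (A i m))" using PA by (intro sum.cong) auto
    finally show ?thesis by (simp add: P_def)
  qed
  have "(\<Sum>i<d. \<Sum>j<d. complex_of_real ((cmod (e i j - P i j))\<^sup>2)) = 0"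
  proof -
    have "complex_of_real ((cmod (e i j - P i j))\<^sup>2) = (if i = j then 1 else 0) * (1 - P i j - P j i) + P i j * P j i" for i j
      unfolding complex_norm_square by (simp add: herm e_def algebra_simps)
    then have "(\<Sum>i<d. \<Sum>j<d. complex_of_real ((cmod (e i j - P i j))\<^sup>2))
        = (\<Sum>i<d. (1 - P i i - P i i) + P i i)"
      by (simp add: sum.distrib idem sum_delta_lt)
    also have "\<dots> = 0" using trP by (simp add: sum_subtractf)
    finally show ?thesis .
  qed
  then have "(\<Sum>i<d. \<Sum>j<d. (cmod (e i j - P i j))\<^sup>2) = 0"
    by (simp only: of_real_sum[symmetric] of_real_eq_0_iff)
  then have "cmod (e i j - P i j) = 0" if "i < d" "j < d" for i j
    using that by (simp add: sum_nonneg_eq_0_iff sum_nonneg)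
  then have "P i j = e i j" if "i < d" "j < d" for i j using that by simp
  then show ?thesis
    unfolding is_unitary_def adjoint_def complex_cnj_cnj P_def[symmetric] e_def by blast
qed

lemma adjoint_adjoint [simp]: "adjoint (adjoint A) = A"
  by (simp add: adjoint_def)

lemma unitary_right_inverse:
  assumes "is_unitary d A" "i < d"
  shows "mat_vec d A (mat_vec d (adjoint A) v) i = v i"
  using unitary_left_inverse[OF unitary_adjoint[OF assms(1)] assms(2)] by simp

lemma unitary_cong:
  "(\<And>i j. i < d \<Longrightarrow> j < d \<Longrightarrow> A i j = B i j) \<Longrightarrow> is_unitary d A = is_unitary d B"
  by (simp add: is_unitary_def)

section \<open>Orthogonal projections and reflections about a span\<close>

lemma projection_exists:
  assumes "finite Vs"
  shows "\<exists>P. (\<forall>i j. cnj (P i j) = P j i) \<and>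
     (\<forall>i<d. \<forall>j<d. (\<Sum>l<d. P i l * P l j) = P i j) \<and>
     (\<forall>v\<in>Vs. \<forall>i<d. mat_vec d P v i = v i) \<and>
     (\<forall>z. (\<forall>v\<in>Vs. ip d v z = 0) \<longrightarrow> (\<forall>i<d. mat_vec d P z i = 0))"
  using assms
proof (induction Vs)
  case empty
  show ?case by (rule exI[of _ "\<lambda>_ _. 0"]) (simp add: mat_vec_def)
next
  case (insert v Vs)
  obtain P where herm': "\<forall>i j. cnj (P i j) = P j i"
    and idem': "\<forall>i<d. \<forall>j<d. (\<Sum>l<d. P i l * P l j) = P i j"
    and fixes': "\<forall>v\<in>Vs. \<forall>i<d. mat_vec d P v i = v i"
    and kills': "\<forall>z. (\<forall>v\<in>Vs. ip d v z = 0) \<longrightarrow> (\<forall>i<d. mat_vec d P z i = 0)"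
    using insert.IH by (elim exE conjE) (rule that)
  note herm = herm'[rule_format] and idem = idem'[rule_format]
    and fixes_ = fixes'[rule_format] and kills = kills'[rule_format]
  define r where "r i = v i - mat_vec d P v i" for i
  have Padj: "adjoint P = P" unfolding adjoint_def using herm by simp
  have PP: "mat_vec d P (mat_vec d P z) i = mat_vec d P z i" if "i < d" for z i
  proof -
    have "mat_vec d P (mat_vec d P z) i = (\<Sum>j<d. (\<Sum>l<d. P i l * P l j) * z j)"
      unfolding mat_vec_def sum_distrib_left sum_distrib_right
      by (subst sum.swap) (simp add: mult_ac)
    also have "\<dots> = mat_vec d P z i" using idem that by (simp add: mat_vec_def)
    finally show ?thesis .
  qed
  have Pr: "mat_vec d P r i = 0" if "i < d" for i
    unfolding r_def mat_vec_diff using PP[OF that] by simp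
  show ?case
  proof (cases "nsq d r = 0")
    case True
    then have "mat_vec d P v i = v i" if "i < d" for i
      using that by (simp add: nsq_def sum_nonneg_eq_0_iff r_def)
    then show ?thesis
      by (intro exI[of _ P] conjI) (use herm idem fixes_ kills in auto)
  next
    case False
    define N where "N = complex_of_real (nsq d r)"
    have N0: "N \<noteq> 0" using False by (simp add: N_def)
    \<comment> \<open>Gram-Schmidt: \<open>P\<close> kills the residual \<open>r\<close> of
      \<open>v\<close>, so adding the rank-one projection onto \<open>r\<close> keeps the matrix
      hermitian and idempotent and adds just \<open>v\<close> to its range.\<close>
    define Q where "Q i j = P i j + r i * cnj (r j) / N" for i j
    have Qv: "mat_vec d Q z i = mat_vec d P z i + r i * ip d r z / N" for z i
      unfolding Q_def mat_vec_def ip_def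
      by (simp add: algebra_simps sum.distrib sum_distrib_left sum_divide_distrib)
    have qherm: "cnj (Q i j) = Q j i" for i j
      using herm[of i j] by (simp add: Q_def N_def mult.commute)
    have rP: "(\<Sum>l<d. cnj (r l) * P l j) = 0" if "j < d" for j
    proof -
      have "(\<Sum>l<d. cnj (r l) * P l j) = cnj (mat_vec d P r j)"
        unfolding mat_vec_def by (simp add: herm mult.commute)
      then show ?thesis using Pr[OF that] by simp
    qed
    have rr: "(\<Sum>l<d. cnj (r l) * r l) = N"
      using ip_self[of d r] by (simp add: ip_def N_def)
    have qidem: "(\<Sum>l<d. Q i l * Q l j) = Q i j" if "i < d" "j < d" for i j
    proof -
      have "(\<Sum>l<d. Q i l * Q l j) = (\<Sum>l<d. P i l * P l j) + (\<Sum>l<d. P i l * r l) * cnj (r j) / N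
        + r i / N * (\<Sum>l<d. cnj (r l) * P l j) + r i / N * (\<Sum>l<d. cnj (r l) * r l) * cnj (r j) / N"
        unfolding Q_def by (simp add: algebra_simps sum.distrib sum_distrib_left sum_distrib_right sum_divide_distrib)
      also have "\<dots> = P i j + r i * cnj (r j) / N"
        using idem[OF that] Pr[OF that(1)] rP[OF that(2)] rr N0 by (simp add: mat_vec_def)
      finally show ?thesis by (simp add: Q_def)
    qed
    have ipr: "ip d r z = ip d v z - ip d v (mat_vec d P z)" for z
    proof -
      have "ip d r z = cnj (ip d z (\<lambda>i. v i - mat_vec d P v i))"
        using ip_commute[of d r z] by (simp add: r_def[abs_def])
      also have "\<dots> = ip d v z - ip d (mat_vec d P v) z"
        unfolding ip_diff by (simp add: ip_commute[of d z])
      finally show ?thesis by (simp add: ip_mat_vec_adjoint Padj)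
    qed
    have r_orth: "ip d r x = 0" if "x \<in> Vs" for x
      unfolding ipr using ip_cong[of d v v "mat_vec d P x" x] fixes_[OF that] by simp
    have rv: "ip d r v = N"
    proof -
      have "ip d r v = ip d r (\<lambda>i. r i + mat_vec d P v i)" by (simp add: r_def)
      also have "\<dots> = ip d r r + ip d (mat_vec d P r) v"
        by (simp add: ip_add ip_mat_vec_adjoint Padj)
      also have "ip d (mat_vec d P r) v = ip d (\<lambda>_. 0) v" by (rule ip_cong) (simp_all add: Pr)
      finally show ?thesis by (simp add: ip_self N_def ip_def[of d "\<lambda>_. 0"])
    qed
    have "mat_vec d Q x i = x i" if "x \<in> insert v Vs" "i < d" for x i
    proof (cases "x \<in> Vs")
      case True then show ?thesis using that by (simp add: Qv r_orth fixes_)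
    next
      case False
      then have "x = v" using that by simp
      then show ?thesis using N0 by (simp add: Qv rv) (simp add: r_def)
    qed
    moreover have "mat_vec d Q z i = 0" if z: "\<And>x. x \<in> insert v Vs \<Longrightarrow> ip d x z = 0" and "i < d" for z i
    proof -
      have Pz: "mat_vec d P z i = 0" if "i < d" for i using kills z that by auto
      have "ip d v (mat_vec d P z) = ip d v (\<lambda>_. 0)" by (rule ip_cong) (simp_all add: Pz)
      then have "ip d r z = 0" using z by (simp add: ipr ip_def[of _ _ "\<lambda>_. 0"])
      then show ?thesis using Pz that by (simp add: Qv)
    qed
    ultimately show ?thesis
      using qherm qidem by (intro exI[of _ Q] conjI allI ballI impI) blast+
  qed
qed

text \<open>The conditions determine the action of \<open>G\<close> as the reflection about the span
  of \<open>Vs\<close>, without naming the span.\<close>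

definition reflects :: "nat \<Rightarrow> cvec set \<Rightarrow> cmat \<Rightarrow> bool" where
  "reflects d Vs G \<longleftrightarrow> is_unitary d G \<and> (\<forall>v\<in>Vs. \<forall>i<d. mat_vec d G v i = v i) \<and>
     (\<forall>z. (\<forall>v\<in>Vs. ip d v z = 0) \<longrightarrow> (\<forall>i<d. mat_vec d G z i = - z i))"

lemma reflectsD:
  assumes "reflects d Vs G"
  shows "is_unitary d G" "v \<in> Vs \<Longrightarrow> i < d \<Longrightarrow> mat_vec d G v i = v i"
    "(\<And>v. v \<in> Vs \<Longrightarrow> ip d v z = 0) \<Longrightarrow> i < d \<Longrightarrow> mat_vec d G z i = - z i"
  using assms by (auto simp: reflects_def)

lemma reflection_exists:
  assumes "finite Vs"
  shows "\<exists>G. reflects d Vs G"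
proof -
  obtain P where herm': "\<forall>i j. cnj (P i j) = P j i"
    and idem': "\<forall>i<d. \<forall>j<d. (\<Sum>l<d. P i l * P l j) = P i j"
    and fixes': "\<forall>v\<in>Vs. \<forall>i<d. mat_vec d P v i = v i"
    and kills': "\<forall>z. (\<forall>v\<in>Vs. ip d v z = 0) \<longrightarrow> (\<forall>i<d. mat_vec d P z i = 0)"
    using projection_exists[OF assms, of d] by (elim exE conjE) (rule that)
  note herm = herm'[rule_format] and idem = idem'[rule_format]
    and fixes_ = fixes'[rule_format] and kills = kills'[rule_format]
  define G where "G i j = 2 * P i j - (if i = j then 1 else 0)" for i j
  have Gv: "mat_vec d G z i = 2 * mat_vec d P z i - z i" if "i < d" for z i
    unfolding G_def mat_vec_def left_diff_distrib sum_subtractf sum_delta_lt[OF that]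
    by (simp add: sum_distrib_left mult_ac)
  have "(\<Sum>l<d. cnj (G l i) * G l j) = (if i = j then 1 else 0)" if "i < d" "j < d" for i j
  proof -
    have "(\<Sum>l<d. cnj (G l i) * G l j) = mat_vec d G (\<lambda>l. G l j) i"
      unfolding mat_vec_def using herm by (intro sum.cong) (auto simp: G_def)
    also have "\<dots> = 2 * (2 * (\<Sum>l<d. P i l * P l j) - (\<Sum>l<d. (if j = l then 1 else 0) * P i l)) - G i j"
      unfolding Gv[OF that(1)]
      unfolding mat_vec_def G_def by (simp add: right_diff_distrib sum_subtractf sum_distrib_left mult_ac eq_commute)
    also have "\<dots> = (if i = j then 1 else 0)"
      unfolding idem[OF that] sum_delta_lt[OF that(2)] by (simp add: G_def)
    finally show ?thesis .
  qed
  then have "is_unitary d G" by (simp add: is_unitary_def)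
  then show ?thesis
    unfolding reflects_def by (intro exI[of _ G] conjI) (use Gv fixes_ kills in auto)
qed

section \<open>Unitaries close to a contraction\<close>

text \<open>Matrices are functions on all pairs of naturals. Once the meaningless entries are pinned
  to zero, the unitaries form a closed subset of a product of unit discs, which is compact by
  Tychonoff.\<close>

lemma compact_unitary:
  "compact {V :: cmat. is_unitary d V \<and> (\<forall>i j. \<not> (i < d \<and> j < d) \<longrightarrow> V i j = 0)}" (is "compact ?S")
proof -
  let ?B = "PiE UNIV (\<lambda>_::nat. PiE UNIV (\<lambda>_::nat. cball 0 1 :: complex set))"
  have "compactin (product_topology (\<lambda>_::nat. product_topology (\<lambda>_::nat. euclidean :: complex topology) UNIV) UNIV) ?B"
    by (simp add: compactin_PiE)
  then have B: "compact ?B" by (simp add: euclidean_product_topology)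
  have coord: "continuous_on UNIV (\<lambda>V::cmat. V i j)" for i j
    by (rule continuous_on_product_then_coordinatewise, rule continuous_on_product_then_coordinatewise, rule continuous_on_id)
  have "closed {V :: cmat. (\<Sum>l<d. cnj (V l i) * V l j) = c}" for i j c
    by (intro closed_Collect_eq continuous_intros coord)
  moreover have "closed {V :: cmat. V i j = 0}" for i j
    by (intro closed_Collect_eq continuous_intros coord)
  ultimately have cl: "closed ?S"
    unfolding is_unitary_def
    by (intro closed_Collect_conj closed_Collect_all closed_Collect_imp open_Collect_const) auto
  have "?S \<subseteq> ?B"
  proof clarify
    fix V :: cmat
    assume U: "is_unitary d V" and 0: "\<forall>i j. \<not> (i < d \<and> j < d) \<longrightarrow> V i j = 0"
    have "norm (V i j) \<le> 1" for i j
    proof (cases "i < d \<and> j < d")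
      case True
      have "complex_of_real (\<Sum>l<d. (cmod (V l j))\<^sup>2) = 1"
        using U True unfolding of_real_sum complex_norm_square is_unitary_def
        by (simp add: mult.commute)
      then have "(\<Sum>l<d. (cmod (V l j))\<^sup>2) = 1"
        by (simp only: of_real_eq_1_iff)
      moreover have "(cmod (V i j))\<^sup>2 \<le> (\<Sum>l<d. (cmod (V l j))\<^sup>2)"
        using True by (intro member_le_sum) auto
      ultimately show ?thesis by (simp add: power_le_one_iff)
    qed (use 0 in simp)
    then show "V \<in> ?B" by (simp add: PiE_def)
  qed
  then show ?thesis using compact_Int_closed[OF B cl] by (simp add: Int_absorb1)
qed

lemma unitary_id: "is_unitary d (\<lambda>i j. if i = j then 1 else 0)"
  by (simp add: is_unitary_def if_distrib[of cnj] if_distrib[of "\<lambda>x. x * _"] cong: if_cong)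

lemma ip_re_le: "2 * Re (ip d v w) \<le> nsq d v + nsq d w"
proof -
  have "2 * Re (cnj (v i) * w i) \<le> (cmod (v i))\<^sup>2 + (cmod (w i))\<^sup>2" for i
    using sum_squares_ge_zero[of "Re (v i) - Re (w i)" "Im (v i) - Im (w i)"]
    unfolding cmod_power2 by (simp add: power2_eq_square algebra_simps)
  then show ?thesis
    unfolding ip_def nsq_def Re_sum sum_distrib_left sum.distrib[symmetric] by (intro sum_mono)
qed

text \<open>A unitary \<open>V\<close> maximising \<open>Re (tr (V\<^sup>* M))\<close> makes \<open>X = V\<^sup>* M\<close> positive semidefinite, as
  testing with the rank-one modifications \<open>V (I - \<beta> v v\<^sup>*)\<close>, \<open>\<bar>1 - \<beta>\<bar> = 1\<close>, shows.  Then
  \<open>0 \<le> X \<le> I\<close> and \<open>tr X \<ge> tr (X\<^sup>2)\<close>.\<close>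

lemma contraction_near_unitary:
  assumes contr: "\<And>v. nsq d (mat_vec d M v) \<le> nsq d v"
  shows "\<exists>V. is_unitary d V \<and>
    (\<Sum>i<d. \<Sum>j<d. (cmod (M i j))\<^sup>2) \<le> Re (\<Sum>i<d. \<Sum>j<d. cnj (V i j) * M i j)"
proof -
  define S where "S = {V :: cmat. is_unitary d V \<and> (\<forall>i j. \<not> (i < d \<and> j < d) \<longrightarrow> V i j = 0)}"
  define f where "f V = Re (\<Sum>i<d. \<Sum>j<d. cnj (V i j) * M i j)" for V
  define trunc :: "cmat \<Rightarrow> cmat" where "trunc V i j = (if i < d \<and> j < d then V i j else 0)" for V i j
  have trunc: "trunc V \<in> S" if "is_unitary d V" for V
    using that unitary_cong[of d "trunc V" V] by (simp add: S_def trunc_def)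
  have f_trunc: "f (trunc V) = f V" for V by (simp add: f_def trunc_def)
  have "S \<noteq> {}" using trunc[OF unitary_id] by auto
  moreover have "compact S" unfolding S_def by (rule compact_unitary)
  moreover have coord: "continuous_on S (\<lambda>V::cmat. V i j)" for i j
    by (rule continuous_on_product_then_coordinatewise, rule continuous_on_product_then_coordinatewise, rule continuous_on_id)
  have "continuous_on S f"
    unfolding f_def[abs_def] by (intro continuous_intros coord)
  ultimately obtain V where "V \<in> S" and max: "\<And>W. W \<in> S \<Longrightarrow> f W \<le> f V"
    using continuous_attains_sup[of S f] by blast
  then have U: "is_unitary d V" by (simp add: S_def)
  have opt: "f W \<le> f V" if "is_unitary d W" for W
    using max[OF trunc[OF that]] by (simp add: f_trunc)
  define X where "X w = mat_vec d (adjoint V) (mat_vec d M w)" for w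
  define q where "q v w = ip d v (X w)" for v w
  have q_eq: "q v w = ip d (mat_vec d V v) (mat_vec d M w)" for v w
    by (simp add: q_def X_def ip_mat_vec_adjoint)
  \<comment> \<open>The chosen \<open>\<beta>\<close> runs over the circle around \<open>1\<close>
    except for \<open>0\<close>, and \<open>cnj \<beta>\<close> is a positive multiple of
    \<open>1 + \<i> * s\<close>. Letting \<open>s\<close> vary then forces \<open>q v v\<close> to
    be real, not only of nonnegative real part.\<close>
  have re: "Re ((1 + \<i> * of_real s) * q v v) \<ge> 0" for v and s :: real
  proof (cases "nsq d v = 0")
    case True
    then have "v i = 0" if "i < d" for i using that by (simp add: nsq_def sum_nonneg_eq_0_iff)
    then have "q v v = 0" by (simp add: q_def ip_def)
    then show ?thesis by simp
  next
    case False
    define N where "N = complex_of_real (nsq d v)"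
    have N0: "N \<noteq> 0" using False by (simp add: N_def)
    have cN: "cnj N = N" by (simp add: N_def)
    define \<beta> where "\<beta> = 2 / (1 + \<i> * of_real s)"
    have s0: "1 + \<i> * complex_of_real s \<noteq> 0" "1 - \<i> * complex_of_real s \<noteq> 0"
      by (simp_all add: complex_eq_iff)
    have \<beta>: "\<beta> * cnj \<beta> = \<beta> + cnj \<beta>"
      using s0 by (simp add: \<beta>_def field_simps)
    define W where "W i j = V i j - \<beta> / N * mat_vec d V v i * cnj (v j)" for i j
    have Vv: "(\<Sum>l<d. cnj (V l i) * mat_vec d V v l) = v i" if "i < d" for i
      using unitary_left_inverse[OF U that, of v]
      unfolding mat_vec_def[of d "adjoint V"] by (simp add: adjoint_def)
    have Vv': "(\<Sum>l<d. cnj (mat_vec d V v l) * V l j) = cnj (v j)" if "j < d" for j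
      using arg_cong[OF Vv[OF that], of cnj] by (simp add: mult.commute)
    have VV: "(\<Sum>l<d. cnj (mat_vec d V v l) * mat_vec d V v l) = N"
      using unitary_ip[OF U, of v v] unfolding ip_self[of d v] unfolding ip_def N_def .
    have "(\<Sum>l<d. cnj (W l i) * W l j) = (if i = j then 1 else 0)" if "i < d" "j < d" for i j
    proof -
      have "(\<Sum>l<d. cnj (W l i) * W l j) = (\<Sum>l<d. cnj (V l i) * V l j)
        - \<beta> / N * cnj (v j) * (\<Sum>l<d. cnj (V l i) * mat_vec d V v l)
        - cnj \<beta> / N * v i * (\<Sum>l<d. cnj (mat_vec d V v l) * V l j)
        + (\<beta> * cnj \<beta>) / (N * N) * v i * cnj (v j) * (\<Sum>l<d. cnj (mat_vec d V v l) * mat_vec d V v l)"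
        unfolding W_def sum_distrib_left sum_subtractf[symmetric] sum.distrib[symmetric]
        by (intro sum.cong refl) (simp add: algebra_simps cN)
      also have "\<dots> = (if i = j then 1 else 0)"
        unfolding Vv[OF that(1)] Vv'[OF that(2)] VV \<beta>
        using U that N0 by (simp add: is_unitary_def field_simps)
      finally show ?thesis .
    qed
    then have "is_unitary d W" by (simp add: is_unitary_def)
    then have "f W \<le> f V" by (rule opt)
    moreover have "f W = f V - Re (cnj \<beta> / N * q v v)"
    proof -
      have "cnj (W i j) * M i j = cnj (V i j) * M i j - cnj \<beta> / N * (cnj (mat_vec d V v i) * (M i j * v j))" for i j
        by (simp add: W_def cN algebra_simps)
      then have "(\<Sum>i<d. \<Sum>j<d. cnj (W i j) * M i j) = (\<Sum>i<d. \<Sum>j<d. cnj (V i j) * M i j)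
          - cnj \<beta> / N * (\<Sum>i<d. \<Sum>j<d. cnj (mat_vec d V v i) * (M i j * v j))"
        by (simp only: sum_subtractf sum_distrib_left)
      also have "(\<Sum>i<d. \<Sum>j<d. cnj (mat_vec d V v i) * (M i j * v j)) = q v v"
        unfolding q_eq ip_def mat_vec_def[of d M] by (simp add: sum_distrib_left)
      finally show ?thesis by (simp add: f_def)
    qed
    ultimately have "Re (cnj \<beta> / N * q v v) \<ge> 0" by simp
    moreover have "cnj \<beta> / N * q v v = of_real (2 / ((1 + s\<^sup>2) * nsq d v)) * ((1 + \<i> * of_real s) * q v v)"
    proof -
      have "cnj \<beta> = of_real (2 / (1 + s\<^sup>2)) * (1 + \<i> * of_real s)"
      proof -
        have "(1 - \<i> * complex_of_real s) * (1 + \<i> * of_real s) = of_real (1 + s\<^sup>2)"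
          by (simp add: algebra_simps power2_eq_square)
        moreover have "complex_of_real (1 + s\<^sup>2) \<noteq> 0" by (simp only: of_real_eq_0_iff) (smt (verit) zero_le_power2)
        ultimately show ?thesis using s0 by (simp add: \<beta>_def field_simps)
      qed
      then show ?thesis by (simp add: N_def)
    qed
    moreover have "0 < 2 / ((1 + s\<^sup>2) * nsq d v)"
    proof -
      have "0 < 1 + s\<^sup>2" by (simp add: add_pos_nonneg)
      moreover have "0 < nsq d v" using False nsq_nonneg[of d v] by linarith
      ultimately show ?thesis by simp
    qed
    ultimately show ?thesis
      by (metis Re_complex_of_real times_complex.sel(1) zero_le_mult_iff Im_complex_of_real diff_zero mult_zero_left not_less)
  qed
  have rq: "0 \<le> Re (q v v)" and iq: "Im (q v v) = 0" for v
  proof -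
    show R: "0 \<le> Re (q v v)" using re[of 0 v] by simp
    have *: "0 \<le> Re (q v v) - s * Im (q v v)" for s using re[of s v] by simp
    show "Im (q v v) = 0"
    proof (rule ccontr)
      assume "Im (q v v) \<noteq> 0"
      then show False using *[of "(Re (q v v) + 1) / Im (q v v)"] by simp
    qed
  qed
  have Xn: "nsq d (X v) \<le> nsq d v" for v
    unfolding X_def using contr[of v] by (simp add: unitary_nsq[OF unitary_adjoint[OF U]])
  have qadd: "q (\<lambda>i. v i + c * w i) (\<lambda>i. v i + c * w i) = q v v + c * q v w + cnj c * q w v + c * cnj c * q w w" for v w c
    by (simp add: q_def X_def mat_vec_add mat_vec_scale ip_add ip_scale ip_add_left algebra_simps)
  \<comment> \<open>This is \<open>X\<^sup>2 \<le> X\<close> without square roots of matrices: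
    positivity is tested at \<open>v - X v\<close>, and \<open>q w w\<close> is bounded by
    \<open>nsq d w\<close>. The vectors \<open>v + w\<close> and \<open>v + \<i> * w\<close> serve
    to show \<open>q v w = q w v\<close>.\<close>
  have key: "nsq d (X v) \<le> Re (q v v)" for v
  proof -
    define w where "w = X v"
    have p: "q w v = of_real (nsq d w)" by (simp add: q_def w_def ip_self)
    have "Im (q v w) = 0" using iq[of "\<lambda>i. v i + 1 * w i"] iq[of v] iq[of w] by (simp only: qadd) (simp add: p)
    moreover have "Re (q v w) = nsq d w"
      using iq[of "\<lambda>i. v i + \<i> * w i"] iq[of v] iq[of w] by (simp only: qadd) (simp add: p)
    moreover have "2 * Re (q w w) \<le> 2 * nsq d w"
      using ip_re_le[of d w "X w"] Xn[of w] by (simp add: q_def)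
    moreover have "0 \<le> Re (q v v) - Re (q v w) - nsq d w + Re (q w w)"
      using rq[of "\<lambda>i. v i + (-1) * w i"] by (simp only: qadd) (simp add: p)
    ultimately show ?thesis by (simp add: w_def)
  qed
  define e :: "nat \<Rightarrow> cvec" where "e j i = (if j = i then 1 else 0)" for i j
  have ev: "mat_vec d A (e j) i = A i j" if "j < d" for A i j
    using sum_delta_lt[OF that, of "A i"] by (simp add: mat_vec_def e_def mult.commute)
  have "(\<Sum>i<d. \<Sum>j<d. (cmod (M i j))\<^sup>2) = (\<Sum>j<d. nsq d (mat_vec d M (e j)))"
    unfolding nsq_def by (subst sum.swap) (simp add: ev)
  also have "\<dots> = (\<Sum>j<d. nsq d (X (e j)))"
    by (simp add: X_def unitary_nsq[OF unitary_adjoint[OF U]])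
  also have "\<dots> \<le> (\<Sum>j<d. Re (q (e j) (e j)))" by (intro sum_mono key)
  also have "\<dots> = f V"
    unfolding f_def q_eq ip_def Re_sum[symmetric] by (subst sum.swap) (simp add: ev)
  finally show ?thesis using U unfolding f_def by blast
qed

section \<open>Weighted coverage\<close>

definition subset_distribution :: "'a set \<Rightarrow> nat \<Rightarrow> ('a set \<Rightarrow> real) \<Rightarrow> bool" where
  "subset_distribution I r p \<longleftrightarrow>
     (\<forall>B. 0 \<le> p B) \<and> (\<forall>B. p B \<noteq> 0 \<longrightarrow> B \<subseteq> I \<and> card B = r) \<and> sum p (Pow I) = 1"

definition hit_prob :: "'a set \<Rightarrow> ('a set \<Rightarrow> real) \<Rightarrow> 'a set \<Rightarrow> real" where
  "hit_prob I p T = (\<Sum>B\<in>{B\<in>Pow I. B \<inter> T \<noteq> {}}. p B)"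

lemma subset_distributionD:
  assumes "subset_distribution I r p"
  shows "0 \<le> p B" "p B \<noteq> 0 \<Longrightarrow> B \<subseteq> I \<and> card B = r" "sum p (Pow I) = 1"
  using assms by (auto simp: subset_distribution_def)

lemma subset_distribution_point:
  "finite I \<Longrightarrow> B0 \<subseteq> I \<Longrightarrow> card B0 = r \<Longrightarrow> subset_distribution I r (\<lambda>B. if B = B0 then 1 else 0)"
  by (auto simp: subset_distribution_def sum.delta)

text \<open>A point \<open>y\<close> of the hypersimplex is the vector of marginals of a distribution on \<open>r\<close>-subsets.
  Pipage rounding: moving mass between two fractional coordinates in either direction
  until one of them becomes integral writes \<open>y\<close> as a convex combination of points with fewer fractional
  coordinates.\<close>

lemma hypersimplex_distribution:
  fixes y :: "'a \<Rightarrow> real"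
  assumes "finite I" "\<And>i. i \<in> I \<Longrightarrow> 0 \<le> y i \<and> y i \<le> 1" "sum y I = real r"
  shows "\<exists>p. subset_distribution I r p \<and> (\<forall>i\<in>I. hit_prob I p {i} = y i)"
  using assms(2,3)
proof (induction "card {i\<in>I. y i \<noteq> 0 \<and> y i \<noteq> 1}" arbitrary: y rule: less_induct)
  case less
  let ?F = "\<lambda>y. {i\<in>I. y i \<noteq> 0 \<and> y i \<noteq> (1::real)}"
  show ?case
  proof (cases "?F y = {}")
    case True
    define B0 where "B0 = {i\<in>I. y i = 1}"
    have y: "y i = (if i \<in> B0 then 1 else 0)" if "i \<in> I" for i
      using True that by (auto simp: B0_def)
    have B0: "B0 \<subseteq> I" by (auto simp: B0_def)
    have "sum y I = (\<Sum>i\<in>I. if i \<in> B0 then 1 else 0)" by (intro sum.cong) (use y in auto)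
    also have "\<dots> = real (card B0)"
      using \<open>finite I\<close> B0 by (simp add: sum.If_cases Int_absorb1)
    finally have card: "card B0 = r" using less.prems by simp
    have "hit_prob I (\<lambda>B. if B = B0 then 1 else 0) {i} = y i" if "i \<in> I" for i
      using \<open>finite I\<close> B0 y[OF that] by (simp add: hit_prob_def sum.delta)
    then show ?thesis using subset_distribution_point[OF \<open>finite I\<close> B0 card] by blast
  next
    case False
    then obtain i where i: "i \<in> I" "y i \<noteq> 0" "y i \<noteq> 1" by auto
    \<comment> \<open>An integral sum cannot have exactly one fractional summand.\<close>
    have "\<exists>j. j \<in> I \<and> j \<noteq> i \<and> y j \<noteq> 0 \<and> y j \<noteq> 1"
    proof (rule ccontr)
      assume "\<not> ?thesis"
      then have "sum y (I - {i}) = real (card {j\<in>I - {i}. y j = 1})"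
        using \<open>finite I\<close> by (subst sum.cong[OF refl, of _ _ "\<lambda>j. if y j = 1 then 1 else 0"])
          (auto simp: sum.If_cases Int_def)
      moreover have "sum y I = y i + sum y (I - {i})" using \<open>finite I\<close> i by (simp add: sum.remove)
      ultimately obtain m :: int where "y i = real_of_int m"
        using less.prems that[of "int r - int (card {j\<in>I - {i}. y j = 1})"] by simp
      moreover have "0 < y i" "y i < 1" using less.prems(1)[of i] i by auto
      ultimately show False by simp
    qed
    then obtain j where j: "j \<in> I" "j \<noteq> i" "y j \<noteq> 0" "y j \<noteq> 1" by blast
    have pos: "0 < y i" "y i < 1" "0 < y j" "y j < 1"
      using less.prems(1)[of i] less.prems(1)[of j] i j by auto
    define z where "z t = y(i := y i + t, j := y j - t)" for t
    have sub: "\<exists>p. subset_distribution I r p \<and> (\<forall>l\<in>I. hit_prob I p {l} = z t l)"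
      if t: "0 \<le> y i + t" "y i + t \<le> 1" "0 \<le> y j - t" "y j - t \<le> 1"
        and int: "y i + t \<in> {0, 1} \<or> y j - t \<in> {0, 1}" for t
    proof (rule less.hyps)
      have "?F (z t) \<subseteq> ?F y" using i j by (auto simp: z_def split: if_splits)
      moreover have "(i \<notin> ?F (z t) \<or> j \<notin> ?F (z t)) \<and> i \<in> ?F y \<and> j \<in> ?F y"
        using int i j by (auto simp: z_def)
      ultimately have "?F (z t) \<subset> ?F y" by blast
      then show "card (?F (z t)) < card (?F y)" using \<open>finite I\<close> by (intro psubset_card_mono) auto
      show "\<And>l. l \<in> I \<Longrightarrow> 0 \<le> z t l \<and> z t l \<le> 1" using t less.prems(1) by (auto simp: z_def)
      have *: "sum f I = f i + (f j + sum f (I - {i} - {j}))" for f :: "'a \<Rightarrow> real"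
        using \<open>finite I\<close> i j by (simp add: sum.remove)
      have "sum (z t) (I - {i} - {j}) = sum y (I - {i} - {j})" by (intro sum.cong) (auto simp: z_def)
      then show "sum (z t) I = real r" using less.prems(2) j(2) *[of y] *[of "z t"] by (simp add: z_def)
    qed
    \<comment> \<open>\<open>a\<close> and \<open>b\<close> are the largest shifts in the two
      directions that stay inside the unit interval, so each makes a coordinate integral;
      \<open>y\<close> lies between the two end points, with weight \<open>b / (a + b)\<close> on
      the first.\<close>
    define a where "a = min (1 - y i) (y j)"
    define b where "b = min (y i) (1 - y j)"
    have ab: "a > 0" "b > 0" using pos by (auto simp: a_def b_def)
    have "\<exists>p. subset_distribution I r p \<and> (\<forall>l\<in>I. hit_prob I p {l} = z a l)"
      by (rule sub) (use pos in \<open>auto simp: a_def min_def\<close>)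
    then obtain p where p: "subset_distribution I r p" "\<And>l. l \<in> I \<Longrightarrow> hit_prob I p {l} = z a l" by blast
    have "\<exists>p. subset_distribution I r p \<and> (\<forall>l\<in>I. hit_prob I p {l} = z (-b) l)"
      by (rule sub) (use pos in \<open>auto simp: b_def min_def\<close>)
    then obtain q where q: "subset_distribution I r q" "\<And>l. l \<in> I \<Longrightarrow> hit_prob I q {l} = z (-b) l" by blast
    note pD = subset_distributionD[OF p(1)] and qD = subset_distributionD[OF q(1)]
    define w where "w = b / (a + b)"
    have w: "0 \<le> w" "0 \<le> 1 - w" using ab by (auto simp: w_def field_simps)
    have mix: "w * z a l + (1 - w) * z (-b) l = y l" for l
    proof -
      have "w * a = (1 - w) * b" using ab by (simp add: w_def field_simps)
      then show ?thesis by (auto simp: z_def algebra_simps)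
    qed
    show ?thesis
    proof (intro exI[of _ "\<lambda>B. w * p B + (1 - w) * q B"] conjI ballI)
      show "subset_distribution I r (\<lambda>B. w * p B + (1 - w) * q B)"
        unfolding subset_distribution_def
      proof (intro conjI allI impI)
        fix B
        show "0 \<le> w * p B + (1 - w) * q B" using w pD(1) qD(1) by (intro add_nonneg_nonneg mult_nonneg_nonneg) auto
        assume "w * p B + (1 - w) * q B \<noteq> 0"
        then have "p B \<noteq> 0 \<or> q B \<noteq> 0" by auto
        then show "B \<subseteq> I" "card B = r" using pD(2) qD(2) by blast+
      qed (simp add: sum.distrib pD(3) qD(3) flip: sum_distrib_left)
      fix l assume l: "l \<in> I"
      show "hit_prob I (\<lambda>B. w * p B + (1 - w) * q B) {l} = y l"
        unfolding hit_prob_def sum.distrib sum_distrib_left[symmetric]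
        unfolding hit_prob_def[symmetric] p(2)[OF l] q(2)[OF l] by (rule mix)
    qed
  qed
qed

section \<open>Coverage functions and sets of influential elements\<close>

definition coverage :: "'w set \<Rightarrow> ('w \<Rightarrow> real) \<Rightarrow> ('w \<Rightarrow> 'a set) \<Rightarrow> 'a set \<Rightarrow> real" where
  "coverage \<Omega> D S T = (\<Sum>\<omega>\<in>{\<omega>\<in>\<Omega>. S \<omega> \<inter> T \<noteq> {}}. D \<omega>)"

lemma coverage_nonneg: "(\<And>\<omega>. 0 \<le> D \<omega>) \<Longrightarrow> 0 \<le> coverage \<Omega> D S T"
  by (simp add: coverage_def sum_nonneg)

lemma coverage_mono:
  assumes "finite \<Omega>" "\<And>\<omega>. 0 \<le> D \<omega>" "T \<subseteq> T'"
  shows "coverage \<Omega> D S T \<le> coverage \<Omega> D S T'"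
  unfolding coverage_def using assms by (intro sum_mono2) auto

lemma coverage_Un:
  assumes "finite \<Omega>" "\<And>\<omega>. 0 \<le> D \<omega>"
  shows "coverage \<Omega> D S (T \<union> T') \<le> coverage \<Omega> D S T + coverage \<Omega> D S T'"
proof -
  have "{\<omega>\<in>\<Omega>. S \<omega> \<inter> (T \<union> T') \<noteq> {}} = {\<omega>\<in>\<Omega>. S \<omega> \<inter> T \<noteq> {}} \<union> {\<omega>\<in>\<Omega>. S \<omega> \<inter> T' \<noteq> {}}" by auto
  then show ?thesis
    unfolding coverage_def using assms by (simp add: sum_Un sum_nonneg)
qed

lemma coverage_image:
  assumes "finite \<Omega>" "\<And>\<omega>. 0 \<le> D \<omega>" "finite J"
  shows "coverage \<Omega> D S (e ` J) \<le> (\<Sum>j\<in>J. coverage \<Omega> D S {e j})"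
  using assms(3)
proof (induction J)
  case empty
  then show ?case by (simp add: coverage_def)
next
  case (insert j J)
  then show ?case
    using coverage_Un[where D = D and T = "{e j}" and T' = "e ` J" and S = S, OF assms(1,2)] by simp
qed

lemma decreasing_enumeration:
  fixes v :: "nat \<Rightarrow> real"
  obtains e where "bij_betw e {..<n} {..<n}" "\<And>i j. i \<le> j \<Longrightarrow> j < n \<Longrightarrow> v (e j) \<le> v (e i)"
proof -
  define l where "l = sort_key (\<lambda>i. - v i) [0..<n]"
  have l: "length l = n" "distinct l" "set l = {..<n}" by (auto simp: l_def)
  have "sorted (map (\<lambda>i. - v i) l)" by (simp add: l_def)
  then have "v (l ! j) \<le> v (l ! i)" if "i \<le> j" "j < n" for i j
    using that l(1) by (auto simp: sorted_iff_nth_mono)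
  moreover have "bij_betw ((!) l) {..<n} {..<n}"
    using bij_betw_nth[OF l(2)] l by simp
  ultimately show ?thesis using that by blast
qed

text \<open>If one of the elements ranked \<open>k + s\<close>, \<open>s \<le> k\<close>, has large coverage, the top \<open>k + s\<close> elements serve as \<open>B\<close>.
  Otherwise the elements beyond the top \<open>2k\<close> still have joint coverage at least \<open>\<delta>/2\<close>, each of them contributing
  little; charging every \<open>\<omega>\<close> to one element of \<open>S \<omega>\<close> turns coverage into an additive measure there,
  and a random \<open>2k\<close>-set with proportional marginals serves as \<open>B\<close>.\<close>

lemma coverage_witness:
  fixes D :: "'w \<Rightarrow> real" and S :: "'w \<Rightarrow> nat set"
  assumes fin: "finite \<Omega>" and D: "\<And>\<omega>. 0 \<le> D \<omega>" and k: "1 \<le> k" and kn: "k < n" and \<delta>: "0 < \<delta>"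
    and far: "\<And>A. A \<subseteq> {..<n} \<Longrightarrow> card A = k \<Longrightarrow> \<delta> \<le> coverage \<Omega> D S ({..<n} - A)"
  shows "\<exists>\<tau> d p. 0 < \<tau> \<and> 1 \<le> d \<and> d \<le> k \<and> k + d \<le> n \<and> \<delta> / (4 * harm k) \<le> real d * \<tau> \<and>
    subset_distribution {..<n} (k + d) p \<and> (\<forall>T\<subseteq>{..<n}. \<tau> * hit_prob {..<n} p T \<le> coverage \<Omega> D S T)"
proof -
  let ?c = "coverage \<Omega> D S"
  define v where "v i = ?c {i}" for i
  define H where "H = (harm k :: real)"
  have H1: "1 \<le> H"
    using k harm_mono[of 1 k] by (simp add: H_def harm_def)
  have mono: "?c T \<le> ?c T'" if "T \<subseteq> T'" for T T' by (rule coverage_mono[OF fin D that])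
  obtain e where e: "bij_betw e {..<n} {..<n}" and dec: "\<And>i j. i \<le> j \<Longrightarrow> j < n \<Longrightarrow> v (e j) \<le> v (e i)"
    using decreasing_enumeration[of n v] by blast
  have inj: "inj_on e {..<n}" and im: "e ` {..<n} = {..<n}" using e by (auto simp: bij_betw_def)
  have sub: "e ` {..<m} \<subseteq> {..<n}" and card_e: "card (e ` {..<m}) = m" if "m \<le> n" for m
  proof -
    show "e ` {..<m} \<subseteq> {..<n}" using im that by (metis image_mono lessThan_subset_iff)
    show "card (e ` {..<m}) = m"
      using card_image[OF inj_on_subset[OF inj, of "{..<m}"]] that by simp
  qed
  show ?thesis
  proof (cases "\<exists>s. 1 \<le> s \<and> s \<le> k \<and> k + s \<le> n \<and> \<delta> / (4 * H * s) \<le> v (e (k + s - 1))")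
    \<comment> \<open>Positions start at \<open>0\<close>, so \<open>e (k + s - 1)\<close> has rank
      \<open>k + s\<close> and every element of \<open>B0\<close> has coverage at least
      \<open>\<tau>\<close>. A set \<open>T\<close> meeting \<open>B0\<close> anywhere inherits this
      bound.\<close>
    case True
    then obtain s where s: "1 \<le> s" "s \<le> k" "k + s \<le> n" "\<delta> / (4 * H * s) \<le> v (e (k + s - 1))" by blast
    define \<tau> where "\<tau> = v (e (k + s - 1))"
    define B0 where "B0 = e ` {..<k + s}"
    let ?hit = "hit_prob {..<n} (\<lambda>B. if B = B0 then 1 else 0)"
    have "0 < \<delta> / (4 * H * s)" using \<delta> H1 s by simp
    then have \<tau>0: "0 < \<tau>" using s(4) by (simp add: \<tau>_def)
    have "\<delta> / (4 * H) \<le> real s * \<tau>"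
      using s(1,4) H1 by (simp add: \<tau>_def field_simps)
    moreover have "\<tau> * ?hit T \<le> ?c T" if "T \<subseteq> {..<n}" for T
    proof (cases "B0 \<inter> T = {}")
      case True
      then have "?hit T = 0"
        unfolding hit_prob_def by (intro sum.neutral) auto
      then show ?thesis using coverage_nonneg[where D = D, OF D] by simp
    next
      case False
      then obtain j where j: "j < k + s" "e j \<in> T" by (auto simp: B0_def)
      have "?hit T \<le> (\<Sum>B\<in>Pow {..<n}. if B = B0 then 1 else 0)"
        unfolding hit_prob_def by (intro sum_mono2) auto
      also have "\<dots> \<le> 1" by (simp add: sum.delta)
      finally have "\<tau> * ?hit T \<le> \<tau> * 1"
        using \<tau>0 by (intro mult_left_mono) auto
      also have "\<dots> \<le> v (e j)" using dec[of j "k + s - 1"] j s by (simp add: \<tau>_def)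
      also have "\<dots> \<le> ?c T" unfolding v_def using j by (intro mono) auto
      finally show ?thesis .
    qed
    ultimately show ?thesis
      using s \<tau>0 subset_distribution_point[OF finite_lessThan sub[OF s(3)] card_e[OF s(3)]]
      by (intro exI[of _ \<tau>] exI[of _ s]) (auto simp: B0_def H_def)
  next
    case False
    then have small: "v (e (k + s - 1)) < \<delta> / (4 * H * s)" if "1 \<le> s" "s \<le> k" "k + s \<le> n" for s
      using that by (meson not_le)
    \<comment> \<open>The minimum makes the estimates meaningful for \<open>n < 2 * k\<close> too.
      That this cannot happen here emerges later, from a \<open>2 * k\<close>-subset of
      \<open>G\<close>.\<close>
    define m where "m = min (2 * k) n"
    define G where "G = {..<n} - e ` {..<m}"
    \<comment> \<open>Removing the top \<open>k\<close> leaves coverage \<open>\<delta>\<close>. The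
      element of rank \<open>k + s\<close> accounts for at most
      \<open>\<delta> / (4 * H * s)\<close>, hence all ranks up to \<open>2 * k\<close> for at most
      \<open>\<delta> / 4\<close>: this harmonic sum is the source of \<open>harm k\<close>.\<close>
    have "\<delta> \<le> ?c ({..<n} - e ` {..<k})" using sub[of k] card_e[of k] kn by (intro far) auto
    also have "\<dots> \<le> ?c (e ` {k..<m} \<union> G)"
      by (intro mono) (auto simp: G_def, metis atLeastLessThan_iff image_eqI lessThan_iff not_le)
    also have "\<dots> \<le> ?c (e ` {k..<m}) + ?c G" by (rule coverage_Un[OF fin D])
    also have "?c (e ` {k..<m}) \<le> (\<Sum>j\<in>{k..<m}. v (e j))"
      unfolding v_def by (rule coverage_image[OF fin D]) simp
    also have "\<dots> \<le> (\<Sum>j\<in>{k..<m}. \<delta> / (4 * H) * inverse (real (j + 1 - k)))"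
    proof (intro sum_mono)
      fix j assume j: "j \<in> {k..<m}"
      have "1 \<le> j + 1 - k" "j + 1 - k \<le> k" "k + (j + 1 - k) \<le> n" and jj: "k + (j + 1 - k) - 1 = j"
        using j by (auto simp: m_def)
      then have "v (e j) < \<delta> / (4 * H * real (j + 1 - k))"
        using small[of "j + 1 - k"] unfolding jj by blast
      also have "\<dots> = \<delta> / (4 * H) * inverse (real (j + 1 - k))"
        unfolding divide_inverse inverse_mult_distrib by (simp only: mult.assoc)
      finally show "v (e j) \<le> \<delta> / (4 * H) * inverse (real (j + 1 - k))" by (rule less_imp_le)
    qed
    also have "\<dots> = \<delta> / (4 * H) * (\<Sum>j\<in>{k..<m}. inverse (real (j + 1 - k)))"
      by (simp add: sum_distrib_left)
    also have "(\<Sum>j\<in>{k..<m}. inverse (real (j + 1 - k))) = (\<Sum>s\<in>{1..m-k}. inverse (real s))"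
      by (intro sum.reindex_bij_witness[of _ "\<lambda>s. s + k - 1" "\<lambda>j. j + 1 - k"]) auto
    also have "\<delta> / (4 * H) * (\<Sum>s\<in>{1..m-k}. inverse (real s)) \<le> \<delta> / (4 * H) * H"
    proof (rule mult_left_mono)
      show "(\<Sum>s\<in>{1..m-k}. inverse (real s)) \<le> H"
        unfolding H_def harm_def by (intro sum_mono2) (auto simp: m_def)
    qed (use \<delta> H1 in simp)
    finally have "\<delta> \<le> \<delta> / (4 * H) * H + ?c G" by simp
    then have cG: "\<delta> / 2 \<le> ?c G" using H1 \<delta> by simp
    define \<tau> where "\<tau> = \<delta> / (4 * k)"
    have \<tau>0: "0 < \<tau>" using \<delta> k by (simp add: \<tau>_def)
    have v_small: "v i \<le> \<tau>" if "i \<in> G" for i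
    proof -
      have "i \<in> e ` {..<n}" using that im by (auto simp: G_def)
      then obtain j where j: "i = e j" "j < n" by auto
      have "\<not> j < m" using that j by (auto simp: G_def)
      then have jk: "2 * k \<le> j" using j(2) by (auto simp: m_def)
      have "v i \<le> v (e (k + k - 1))" unfolding j(1) using dec[of "k + k - 1" j] jk j by simp
      also have "\<dots> \<le> \<delta> / (4 * H * k)" using small[of k] k jk j by simp
      also have "\<dots> \<le> \<delta> / (4 * k)" using H1 k \<delta> by (simp add: field_simps)
      finally show ?thesis by (simp add: \<tau>_def)
    qed
    let ?rep = "\<lambda>J. {\<omega>\<in>\<Omega>. S \<omega> \<inter> G \<noteq> {} \<and> Min (S \<omega> \<inter> G) \<in> J}"
    define \<mu> where "\<mu> i = (\<Sum>\<omega>\<in>{\<omega>\<in>\<Omega>. S \<omega> \<inter> G \<noteq> {} \<and> Min (S \<omega> \<inter> G) = i}. D \<omega>)" for i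
    have finG: "finite G" by (simp add: G_def)
    have rep: "Min (S \<omega> \<inter> G) \<in> S \<omega> \<inter> G" if "S \<omega> \<inter> G \<noteq> {}" for \<omega>
      using that finG by (intro Min_in) auto
    have \<mu>_sum: "(\<Sum>i\<in>J. \<mu> i) = (\<Sum>\<omega>\<in>?rep J. D \<omega>)" if "finite J" for J
    proof -
      have eq: "{\<omega> \<in> ?rep J. Min (S \<omega> \<inter> G) = i} =
          {\<omega>\<in>\<Omega>. S \<omega> \<inter> G \<noteq> {} \<and> Min (S \<omega> \<inter> G) = i}" if "i \<in> J" for i
        using that by auto
      have "(\<Sum>i\<in>J. \<mu> i) = (\<Sum>i\<in>J. \<Sum>\<omega>\<in>{\<omega> \<in> ?rep J. Min (S \<omega> \<inter> G) = i}. D \<omega>)"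
        unfolding \<mu>_def by (intro sum.cong refl) (simp only: eq)
      also have "\<dots> = (\<Sum>\<omega>\<in>?rep J. D \<omega>)"
        by (rule sum.group) (use fin that in auto)
      finally show ?thesis .
    qed
    have \<mu>_G: "(\<Sum>i\<in>G. \<mu> i) = ?c G"
      unfolding \<mu>_sum[OF finG] coverage_def by (intro sum.cong) (use rep in auto)
    have \<mu>_le: "(\<Sum>i\<in>J. \<mu> i) \<le> ?c J" if "finite J" for J
      unfolding \<mu>_sum[OF that] coverage_def by (intro sum_mono2) (use fin D rep in auto)
    have \<mu>0: "0 \<le> \<mu> i" for i by (simp add: \<mu>_def sum_nonneg D)
    \<comment> \<open>Proportional marginals scaled to sum \<open>2 * k\<close>. They stay below
      \<open>1\<close> since \<open>\<mu> i \<le> \<tau> = \<delta> / (4 * k)\<close>, which is at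
      most \<open>?c G / (2 * k)\<close>.\<close>
    define y where "y i = \<mu> i * (2 * k / ?c G)" for i
    have cG0: "0 < ?c G" using cG \<delta> by linarith
    have "2 * k / ?c G \<le> 2 * k / (\<delta> / 2)" using cG \<delta> by (intro divide_left_mono) auto
    then have ratio: "2 * k / ?c G \<le> 1 / \<tau>" by (simp add: \<tau>_def)
    have y_le: "\<tau> * y i \<le> \<mu> i" for i
    proof -
      have "\<tau> * y i \<le> \<tau> * (\<mu> i * (1 / \<tau>))"
        unfolding y_def using ratio \<mu>0 \<tau>0 by (intro mult_left_mono) auto
      then show ?thesis using \<tau>0 by simp
    qed
    have "\<exists>p. subset_distribution G (2 * k) p \<and> (\<forall>i\<in>G. hit_prob G p {i} = y i)"
    proof (rule hypersimplex_distribution[OF finG])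
      fix i assume "i \<in> G"
      have "\<tau> * y i \<le> ?c {i}" using y_le[of i] \<mu>_le[of "{i}"] by simp
      also have "\<dots> \<le> \<tau> * 1" using v_small[OF \<open>i \<in> G\<close>] by (simp add: v_def)
      finally have "y i \<le> 1" using \<tau>0 by simp
      then show "0 \<le> y i \<and> y i \<le> 1" using \<mu>0 cG0 by (simp add: y_def)
    next
      show "sum y G = real (2 * k)"
        unfolding y_def sum_distrib_right[symmetric] \<mu>_G using cG0 by simp
    qed
    then obtain p where p: "subset_distribution G (2 * k) p" "\<And>i. i \<in> G \<Longrightarrow> hit_prob G p {i} = y i" by blast
    note pD = subset_distributionD[OF p(1)]
    have Gn: "G \<subseteq> {..<n}" by (auto simp: G_def)
    have "\<exists>B. p B \<noteq> 0" using pD(3) by (metis sum.neutral zero_neq_one)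
    then obtain B1 where "p B1 \<noteq> 0" by (rule exE)
    then have B1: "B1 \<subseteq> G" "card B1 = 2 * k" using pD(2)[of B1] by auto
    have "2 * k \<le> n" using card_mono[of "{..<n}" B1] B1 Gn by auto
    moreover have "sum p (Pow {..<n}) = 1"
      unfolding pD(3)[symmetric] using Gn pD(2) by (intro sum.mono_neutral_right) auto
    then have "subset_distribution {..<n} (k + k) p"
      using pD(1,2) Gn unfolding subset_distribution_def mult_2 by blast
    moreover have "\<tau> * hit_prob {..<n} p T \<le> ?c T" if "T \<subseteq> {..<n}" for T
    proof -
      \<comment> \<open>A union bound over the elements of \<open>T \<inter> G\<close>: only the
        marginals \<open>y\<close> matter, and these are controlled by the additive
        \<open>\<mu>\<close>.\<close>
      let ?inc = "\<lambda>B. \<Sum>i\<in>T \<inter> G. if i \<in> B then p B else 0"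
      have fT: "finite (T \<inter> G)" using finG by simp
      have "hit_prob {..<n} p T = (\<Sum>B\<in>{B\<in>Pow G. B \<inter> T \<noteq> {}}. p B)"
        unfolding hit_prob_def using Gn pD(2) by (intro sum.mono_neutral_right) auto
      also have "\<dots> \<le> (\<Sum>B\<in>Pow G. ?inc B)"
      proof -
        have "(\<Sum>B\<in>{B\<in>Pow G. B \<inter> T \<noteq> {}}. p B) \<le> (\<Sum>B\<in>{B\<in>Pow G. B \<inter> T \<noteq> {}}. ?inc B)"
        proof (intro sum_mono)
          fix B assume "B \<in> {B\<in>Pow G. B \<inter> T \<noteq> {}}"
          then obtain i where i: "i \<in> T \<inter> G" "i \<in> B" by auto
          then show "p B \<le> ?inc B"
            using member_le_sum[of i "T \<inter> G" "\<lambda>i. if i \<in> B then p B else 0"] fT pD(1) by auto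
        qed
        also have "\<dots> \<le> (\<Sum>B\<in>Pow G. ?inc B)"
          using finG pD(1) by (intro sum_mono2 sum_nonneg) auto
        finally show ?thesis .
      qed
      also have "\<dots> = (\<Sum>i\<in>T \<inter> G. \<Sum>B\<in>Pow G. if i \<in> B then p B else 0)" by (rule sum.swap)
      also have "\<dots> = (\<Sum>i\<in>T \<inter> G. y i)"
      proof (intro sum.cong refl)
        fix i assume "i \<in> T \<inter> G"
        have "(\<Sum>B\<in>Pow G. if i \<in> B then p B else 0) = (\<Sum>B\<in>{B\<in>Pow G. i \<in> B}. p B)"
          by (rule sum.inter_filter[symmetric]) (simp add: finG)
        then show "(\<Sum>B\<in>Pow G. if i \<in> B then p B else 0) = y i"
          using p(2)[of i] \<open>i \<in> T \<inter> G\<close> by (simp add: hit_prob_def)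
      qed
      finally have "\<tau> * hit_prob {..<n} p T \<le> (\<Sum>i\<in>T \<inter> G. \<tau> * y i)"
        using \<tau>0 by (simp add: mult_left_mono flip: sum_distrib_left)
      also have "\<dots> \<le> (\<Sum>i\<in>T \<inter> G. \<mu> i)" by (intro sum_mono y_le)
      also have "\<dots> \<le> ?c (T \<inter> G)" by (rule \<mu>_le[OF fT])
      also have "\<dots> \<le> ?c T" by (intro mono) auto
      finally show ?thesis .
    qed
    moreover have "\<delta> / (4 * H) \<le> real k * \<tau>"
      using H1 k \<delta> by (simp add: \<tau>_def field_simps)
    ultimately show ?thesis
      using k \<tau>0 by (intro exI[of _ \<tau>] exI[of _ k] exI[of _ p]) (auto simp: H_def)
  qed
qed

section \<open>First hits in a random order\<close>

text \<open>\<open>first_hit N b s\<close> is the probability that, in a random order of \<open>N\<close> elements of which \<open>b\<close> are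
  marked, the first marked element is the \<open>s\<close>-th.\<close>

definition first_hit :: "nat \<Rightarrow> nat \<Rightarrow> nat \<Rightarrow> real" where
  "first_hit N b s = real b * real ((N - b) choose (s - 1)) / (real s * real (N choose s))"

lemma first_hit_nonneg: "0 \<le> first_hit N b s"
  by (simp add: first_hit_def)

text \<open>The quotient \<open>((N - b) choose s) / (N choose s)\<close> is the probability that
  the first \<open>s\<close> elements are unmarked, and a first hit at \<open>Suc s\<close> is its
  drop in one step. Hence the sum over all positions telescopes.\<close>

lemma first_hit_diff:
  assumes "s < N" "b \<le> N"
  shows "first_hit N b (Suc s) =
    real ((N - b) choose s) / real (N choose s) - real ((N - b) choose Suc s) / real (N choose Suc s)"
proof -
  have absorb: "real (Suc s) * real (M choose Suc s) = (real M - real s) * real (M choose s)" for M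
  proof (cases "s \<le> M")
    case True
    then have "Suc s * (M choose Suc s) = (M - s) * (M choose s)"
      by (simp only: binomial_absorb_comp binomial_absorption)
    then have "real (Suc s * (M choose Suc s)) = real ((M - s) * (M choose s))" by simp
    then show ?thesis using True unfolding of_nat_mult by (simp only: of_nat_diff)
  qed (simp add: binomial_eq_0)
  have pos: "0 < real (N choose s)" "0 < real (N choose Suc s)" "0 < real N - real s"
    using assms by (simp_all add: zero_less_binomial_iff)
  define r where "r = real (Suc s)"
  have r: "0 < r" by (simp add: r_def)
  have "real ((N - b) choose s) / real (N choose s) =
      (real N - real s) * real ((N - b) choose s) / ((real N - real s) * real (N choose s))"
    using pos by simp
  also have "\<dots> = (real N - real s) * real ((N - b) choose s) / (r * real (N choose Suc s))"
    unfolding absorb[symmetric] r_def ..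
  finally have 1: "real ((N - b) choose s) / real (N choose s) = \<dots>" .
  have "real ((N - b) choose Suc s) / real (N choose Suc s) = r * real ((N - b) choose Suc s) / (r * real (N choose Suc s))"
    using r by simp
  also have "\<dots> = (real N - real b - real s) * real ((N - b) choose s) / (r * real (N choose Suc s))"
    unfolding r_def absorb using assms(2) by (simp add: of_nat_diff)
  finally have 2: "real ((N - b) choose Suc s) / real (N choose Suc s) = \<dots>" .
  show ?thesis
    unfolding first_hit_def 1 2 r_def[symmetric] diff_divide_distrib[symmetric] diff_Suc_1
    by (simp add: algebra_simps)
qed

lemma first_hit_sum:
  assumes "1 \<le> b" "b \<le> N"
  shows "(\<Sum>s\<in>{1..N}. first_hit N b s) = 1"
proof -
  let ?g = "\<lambda>s. real ((N - b) choose s) / real (N choose s)"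
  have "(\<Sum>s\<in>{1..N}. first_hit N b s) = (\<Sum>s<N. first_hit N b (Suc s))"
    by (intro sum.reindex_bij_witness[of _ Suc "\<lambda>s. s - 1"]) auto
  also have "\<dots> = (\<Sum>s<N. ?g s - ?g (Suc s))"
    using assms by (intro sum.cong refl first_hit_diff) auto
  also have "\<dots> = ?g 0 - ?g N" by (rule sum_lessThan_telescope')
  finally show ?thesis using assms by (simp add: binomial_eq_0)
qed

text \<open>A first hit at position \<open>s\<close> needs a marked element there, an event of
  probability \<open>b / N\<close>.\<close>

lemma first_hit_le:
  assumes "1 \<le> b" "1 \<le> s" "s \<le> N"
  shows "first_hit N b s \<le> real b / real N"
proof -
  have "(N - b) choose (s - 1) \<le> (N - 1) choose (s - 1)"
    using assms by (intro binomial_right_mono) auto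
  moreover have "s * (N choose s) = N * ((N - 1) choose (s - 1))"
    using times_binomial_minus1_eq[of s N] assms by simp
  then have "real s * real (N choose s) = real N * real ((N - 1) choose (s - 1))"
    by (metis of_nat_mult)
  moreover have "0 < real ((N - 1) choose (s - 1))" using assms by (simp add: zero_less_binomial_iff)
  ultimately show ?thesis
    unfolding first_hit_def using assms by (simp add: divide_simps mult_left_mono)
qed

lemma card_one_hit:
  assumes "finite X" "B \<subseteq> X" "1 \<le> s"
  shows "card {T. T \<subseteq> X \<and> card T = s \<and> card (T \<inter> B) = 1} = card B * ((card X - card B) choose (s - 1))"
proof -
  have fB: "finite B" using assms finite_subset by blast
  let ?R = "B \<times> {T'. T' \<subseteq> X - B \<and> card T' = s - 1}"
  let ?L = "{T. T \<subseteq> X \<and> card T = s \<and> card (T \<inter> B) = 1}"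
  have "bij_betw (\<lambda>(i, T'). insert i T') ?R ?L"
  proof (rule bij_betw_imageI)
    show "inj_on (\<lambda>(i, T'). insert i T') ?R"
    proof (rule inj_onI, clarify)
      fix i T i' T' assume *: "i \<in> B" "i' \<in> B" "T \<subseteq> X - B" "T' \<subseteq> X - B" "insert i T = insert i' T'"
      then have "i = i'" by blast
      moreover have "i \<notin> T" "i' \<notin> T'" using * by auto
      ultimately show "i = i' \<and> T = T'" using *(5) by (simp add: insert_ident)
    qed
    show "(\<lambda>(i, T'). insert i T') ` ?R = ?L"
    proof (intro equalityI subsetI)
      fix T assume "T \<in> (\<lambda>(i, T'). insert i T') ` ?R"
      then obtain i T' where T: "T = insert i T'" "i \<in> B" "T' \<subseteq> X - B" "card T' = s - 1" by auto
      have "finite T'" using T(3) assms(1) finite_subset by blast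
      moreover have "i \<notin> T'" using T by auto
      moreover have "T \<inter> B = {i}" using T by auto
      ultimately show "T \<in> ?L" using T assms by auto
    next
      fix T assume T: "T \<in> ?L"
      then obtain i where i: "T \<inter> B = {i}" by (auto simp: card_1_singleton_iff)
      have "finite T" using T assms(1) finite_subset by blast
      moreover have "i \<in> T" using i by auto
      ultimately have "(i, T - {i}) \<in> ?R" using T i by (auto simp: card_Diff_singleton)
      moreover have "insert i (T - {i}) = T" using i by auto
      ultimately show "T \<in> (\<lambda>(i, T'). insert i T') ` ?R" by (metis (no_types, lifting) case_prod_conv image_eqI)
    qed
  qed
  then have "card ?L = card ?R" by (simp add: bij_betw_same_card)
  also have "\<dots> = card B * ((card X - card B) choose (s - 1))"
    using assms fB by (simp add: card_cartesian_product n_subsets card_Diff_subset)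
  finally show ?thesis .
qed

text \<open>Weights \<open>1/s\<close> for all \<open>s\<close> would add up to \<open>ln N\<close>; flattened below \<open>N/k\<close> they only give \<open>ln k\<close>.\<close>

definition level_weight :: "nat \<Rightarrow> nat \<Rightarrow> nat \<Rightarrow> real" where
  "level_weight N k s = (if k * s \<le> N then sqrt (real k / (real N * real s)) else 1 / real s)"

lemma level_weight_pos: "1 \<le> k \<Longrightarrow> 1 \<le> s \<Longrightarrow> s \<le> N \<Longrightarrow> 0 < level_weight N k s"
  by (simp add: level_weight_def)

lemma sum_inverse_sqrt: "(\<Sum>s\<in>{1..f::nat}. 1 / sqrt (real s)) \<le> 2 * sqrt (real f)"
proof (induction f)
  case 0 then show ?case by simp
next
  case (Suc f)
  have "1 / sqrt (real (Suc f)) \<le> 2 * (sqrt (real (Suc f)) - sqrt (real f))"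
  proof -
    have "(sqrt (real (Suc f)) - sqrt (real f)) * (sqrt (real (Suc f)) + sqrt (real f)) = 1"
      by (simp add: algebra_simps)
    then have "sqrt (real (Suc f)) - sqrt (real f) = 1 / (sqrt (real (Suc f)) + sqrt (real f))"
      by (simp add: eq_divide_eq add_nonneg_eq_0_iff)
    also have "\<dots> \<ge> 1 / (2 * sqrt (real (Suc f)))"
      by (intro divide_left_mono) (auto intro!: mult_pos_pos add_pos_nonneg)
    finally show ?thesis by simp
  qed
  then show ?case using Suc by simp
qed

lemma harm_diff_le_ln: "f \<le> m \<Longrightarrow> 1 \<le> f \<Longrightarrow> (harm m :: real) - harm f \<le> ln (real m / real f)"
proof (induction m rule: dec_induct)
  case (step m)
  have "ln (real m / real f) - ln (real (Suc m) / real f) = ln (real m / real (Suc m))"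
    using step by (simp add: ln_div)
  also have "\<dots> \<le> real m / real (Suc m) - 1"
    using ln_le_minus_one[of "real m / real (Suc m)"] step by simp
  also have "\<dots> = - inverse (real (Suc m))" by (simp add: field_simps)
  finally show ?case using step by (simp add: harm_Suc)
qed simp

lemma harm_le_ln: "1 \<le> m \<Longrightarrow> (harm m :: real) \<le> 1 + ln (real m)"
  using harm_diff_le_ln[of 1 m] by (simp add: harm_def)

lemma level_weight_small_sum:
  assumes "1 \<le> k" "1 \<le> N"
  shows "(\<Sum>s\<in>{1..N div k}. sqrt (real N / real k) * (1 / sqrt (real s))) \<le> 2 * (real N / real k)"
proof -
  let ?q = "\<lambda>s. sqrt (real N / real k) * (1 / sqrt (real s))"
  have "(\<Sum>s\<in>{1..N div k}. ?q s)
      \<le> sqrt (real N / real k) * (2 * sqrt (real (N div k)))"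
    unfolding sum_distrib_left[symmetric] by (intro mult_left_mono sum_inverse_sqrt) simp
  also have "\<dots> \<le> sqrt (real N / real k) * (2 * sqrt (real N / real k))"
    by (intro mult_left_mono real_sqrt_le_mono of_nat_div_le_of_nat) auto
  also have "\<dots> = 2 * (sqrt (real N / real k) * sqrt (real N / real k))" by (simp only: mult_ac)
  also have "\<dots> = 2 * (real N / real k)" by (subst real_sqrt_mult_self) simp
  finally show ?thesis .
qed

lemma level_split:
  fixes N :: nat
  assumes "1 \<le> k"
  shows "{1..N} = {1..N div k} \<union> {N div k<..N}" "{1..N div k} \<inter> {N div k<..N} = {}"
    "s \<le> N div k \<longleftrightarrow> k * s \<le> N"
proof -
  show "{1..N} = {1..N div k} \<union> {N div k<..N}"
    using div_le_dividend[of N k] by (auto simp del: div_le_dividend intro: order_trans)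
  show "{1..N div k} \<inter> {N div k<..N} = {}" by auto
  show "s \<le> N div k \<longleftrightarrow> k * s \<le> N"
    using less_eq_div_iff_mult_less_eq[of k s N] assms by (simp add: mult.commute)
qed

text \<open>The flattened levels add up to at most \<open>2\<close>. The others run from about
  \<open>N / k\<close> to \<open>N\<close>, a range whose end points have a ratio of order
  \<open>k\<close>, so their harmonic sum is logarithmic in \<open>k\<close> and not in
  \<open>N\<close>.\<close>

lemma level_weight_sum:
  assumes k: "1 \<le> k" and N: "1 \<le> N"
  shows "(\<Sum>s\<in>{1..N}. level_weight N k s) \<le> 8 * ln (real k + 1)"
proof -
  let ?q = "\<lambda>s. sqrt (real N / real k) * (1 / sqrt (real s))"
  define f where "f = N div k"
  have "(\<Sum>s\<in>{1..f}. level_weight N k s) = real k / real N * (\<Sum>s\<in>{1..f}. ?q s)"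
    unfolding sum_distrib_left
  proof (intro sum.cong refl)
    fix s assume s: "s \<in> {1..f}"
    have "sqrt (real k / (real N * real s)) = real k / real N * sqrt (real N / real k) * (1 / sqrt (real s))"
    proof -
      have "real k / real N * sqrt (real N / real k) = sqrt ((real k / real N)\<^sup>2 * (real N / real k))"
        by (simp only: real_sqrt_mult real_sqrt_abs) simp
      also have "(real k / real N)\<^sup>2 * (real N / real k) = real k / real N"
        using k N by (simp add: power2_eq_square)
      finally show ?thesis by (simp add: real_sqrt_divide real_sqrt_mult)
    qed
    then show "level_weight N k s = real k / real N * ?q s"
      using s level_split(3)[OF k] by (simp add: level_weight_def f_def)
  qed
  also have "\<dots> \<le> real k / real N * (2 * (real N / real k))"
    unfolding f_def by (intro mult_left_mono level_weight_small_sum k N) simp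
  finally have 1: "(\<Sum>s\<in>{1..f}. level_weight N k s) \<le> 2" using k N by simp
  have "(\<Sum>s\<in>{f<..N}. level_weight N k s) = (\<Sum>s\<in>{f<..N}. inverse (real s))"
  proof (intro sum.cong refl)
    fix s assume "s \<in> {f<..N}"
    then have "\<not> k * s \<le> N" using level_split(3)[OF k, of s N] by (simp add: f_def)
    then show "level_weight N k s = inverse (real s)" by (simp add: level_weight_def inverse_eq_divide)
  qed
  also have "\<dots> = harm N - harm f"
  proof -
    have "(harm N :: real) = harm f + (\<Sum>s\<in>{f<..N}. inverse (real s))"
      unfolding harm_def using level_split(1,2)[OF k, of N] by (simp add: f_def sum.union_disjoint)
    then show ?thesis by simp
  qed
  \<comment> \<open>The summand \<open>1\<close> is for \<open>f = 0\<close>, where all of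
    \<open>harm N\<close> with \<open>N < k\<close> remains; the factor \<open>2\<close> is lost to
    rounding in \<open>N div k\<close>.\<close>
  also have "\<dots> \<le> 1 + ln (2 * real k)"
  proof (cases "f = 0")
    case True
    then have "N < k" using k by (simp add: f_def div_eq_0_iff)
    have "(harm N :: real) \<le> 1 + ln (real N)" by (rule harm_le_ln[OF N])
    also have "ln (real N) \<le> ln (2 * real k)" using \<open>N < k\<close> N by simp
    finally show ?thesis using True by (simp add: harm_def)
  next
    case False
    have "N < k * (f + 1)" unfolding f_def using k dividend_less_times_div[of k N] by (simp add: algebra_simps)
    also have "\<dots> \<le> k * (2 * f)" using False by simp
    finally have "real N < real (k * (2 * f))" by (simp only: of_nat_less_iff)
    then have "real N < 2 * real k * real f" by simp
    then have "real N / real f \<le> 2 * real k" using False by (simp add: field_simps)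
    moreover have "f \<le> N" by (simp add: f_def)
    moreover have "0 < real N / real f" using False N by simp
    ultimately have "ln (real N / real f) \<le> ln (2 * real k)" by (subst ln_le_cancel_iff) auto
    then have "(harm N :: real) - harm f \<le> ln (2 * real k)"
      using harm_diff_le_ln[of f N] \<open>f \<le> N\<close> False by simp
    then show ?thesis by simp
  qed
  finally have 2: "(\<Sum>s\<in>{f<..N}. level_weight N k s) \<le> 1 + ln (2 * real k)" .
  have "(\<Sum>s\<in>{1..N}. level_weight N k s) \<le> 3 + ln (2 * real k)"
    using 1 2 level_split(1,2)[OF k, of N] by (simp add: f_def sum.union_disjoint)
  moreover have "ln (2 * real k) = ln 2 + ln (real k)" using k by (simp add: ln_mult)
  moreover have "ln (real k) \<le> ln (real k + 1)" "ln 2 \<le> ln (real k + 1)" using k by auto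
  moreover have "1/2 \<le> ln (2::real)" using ln_le_minus_one[of "1/2::real"] by (simp add: ln_div)
  ultimately show ?thesis by linarith
qed

text \<open>Flattening must not spoil the negative witness. Where the weight is
  \<open>1 / s\<close>, the summand is \<open>first_hit\<close> itself, of total at most
  \<open>1\<close>. On the flattened levels the weight is smaller, but \<open>first_hit\<close> is
  at most \<open>d / N\<close>, and \<open>d \<le> k\<close> keeps the contribution below
  \<open>2\<close>.\<close>

lemma level_weight_hit_sum:
  assumes k: "1 \<le> k" and d: "1 \<le> d" "d \<le> k" "d \<le> N"
  shows "(\<Sum>s\<in>{1..N}. first_hit N d s / (level_weight N k s * real s)) \<le> 3"
proof -
  let ?q = "\<lambda>s. sqrt (real N / real k) * (1 / sqrt (real s))"
  define f where "f = N div k"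
  have N: "1 \<le> N" using d by simp
  have "(\<Sum>s\<in>{1..N}. first_hit N d s / (level_weight N k s * real s))
      \<le> (\<Sum>s\<in>{1..N}. first_hit N d s + (if s \<le> f then real d / real N * ?q s else 0))"
  proof (intro sum_mono)
    fix s assume s: "s \<in> {1..N}"
    show "first_hit N d s / (level_weight N k s * real s) \<le>
      first_hit N d s + (if s \<le> f then real d / real N * ?q s else 0)"
    proof (cases "s \<le> f")
      case True
      then have "k * s \<le> N" using level_split(3)[OF k] by (simp add: f_def)
      have "1 / (sqrt (real k / (real N * real s)) * real s) = ?q s"
      proof -
        have "real s = sqrt (real s) * sqrt (real s)" by simp
        then have "sqrt (real k / (real N * real s)) * real s = sqrt (real k / real N) * sqrt (real s)"
          using s by (simp add: real_sqrt_divide real_sqrt_mult field_simps)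
        then show ?thesis by (simp add: real_sqrt_divide)
      qed
      then have "first_hit N d s / (level_weight N k s * real s) = first_hit N d s * ?q s"
        using \<open>k * s \<le> N\<close> by (simp only: level_weight_def if_True divide_inverse mult_1_left)
      also have "\<dots> \<le> real d / real N * ?q s"
        using first_hit_le[of d s N] d s by (intro mult_right_mono) auto
      finally show ?thesis using True first_hit_nonneg[of N d s] by simp
    next
      case False
      then have "\<not> k * s \<le> N" using level_split(3)[OF k] by (simp add: f_def)
      then show ?thesis using False s by (simp add: level_weight_def)
    qed
  qed
  also have "\<dots> = 1 + (\<Sum>s\<in>{1..N}. if s \<le> f then real d / real N * ?q s else 0)"
    using first_hit_sum[of d N] d by (simp add: sum.distrib)
  also have "(\<Sum>s\<in>{1..N}. if s \<le> f then real d / real N * ?q s else 0)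
      = (\<Sum>s\<in>{1..f}. real d / real N * ?q s)"
    unfolding f_def by (rule sum.mono_neutral_cong_right) (auto intro: order_trans[OF _ div_le_dividend])
  also have "\<dots> = real d / real N * (\<Sum>s\<in>{1..f}. ?q s)"
    by (simp only: sum_distrib_left)
  also have "1 + \<dots> \<le> 1 + real d / real N * (2 * (real N / real k))"
    unfolding f_def by (intro add_left_mono mult_left_mono level_weight_small_sum k N) simp
  also have "\<dots> \<le> 3" using d N by (simp add: field_simps)
  finally show ?thesis by simp
qed

section \<open>The Pauli expansion\<close>

definition walsh :: "'a set \<Rightarrow> 'a set \<Rightarrow> complex" where
  "walsh b y = (-1) ^ card (b \<inter> y)"

lemma walsh_commute: "walsh b y = walsh y b"
  by (simp add: walsh_def Int_commute)

lemma cnj_walsh [simp]: "cnj (walsh b y) = walsh b y"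
  by (simp add: walsh_def)

lemma walsh_prod: "finite b \<Longrightarrow> walsh b y = (\<Prod>i\<in>b. if i \<in> y then -1 else 1)"
  by (simp add: walsh_def prod.If_cases)

text \<open>The sum over subsets expands a product of factors \<open>g i + 1\<close>; a coordinate
  on which \<open>y\<close> and \<open>y'\<close> differ contributes the factor
  \<open>0\<close>.\<close>

lemma walsh_orthogonal:
  assumes "finite I" "y \<subseteq> I" "y' \<subseteq> I"
  shows "(\<Sum>b\<in>Pow I. walsh b y * walsh b y') = (if y = y' then 2 ^ card I else 0)"
proof -
  define g :: "'a \<Rightarrow> complex" where "g i = (if i \<in> y then -1 else 1) * (if i \<in> y' then -1 else 1)" for i
  have "(\<Sum>b\<in>Pow I. walsh b y * walsh b y') = (\<Sum>b\<in>Pow I. (\<Prod>i\<in>b. g i) * (\<Prod>i\<in>I - b. 1))"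
    using assms finite_subset[OF _ assms(1)]
    by (intro sum.cong refl) (auto simp: walsh_prod g_def prod.distrib)
  also have "\<dots> = (\<Prod>i\<in>I. g i + 1)" by (rule prod_add[OF assms(1), symmetric])
  also have "\<dots> = (if y = y' then 2 ^ card I else 0)"
  proof (cases "y = y'")
    case True
    then have "g i + 1 = 2" for i by (simp add: g_def)
    then show ?thesis using True by simp
  next
    case False
    then obtain i where "i \<in> I" "(i \<in> y) \<noteq> (i \<in> y')" using assms by blast
    then have "g i + 1 = 0" by (auto simp: g_def)
    then show ?thesis using False \<open>i \<in> I\<close> assms(1) by auto
  qed
  finally show ?thesis .
qed

text \<open>\<open>bell I (a, b)\<close> is the normalised vectorisation of \<open>X\<^sup>a Z\<^sup>b\<close>, with rows and columns indexed by the sets of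
  qubits that are \<open>1\<close>.\<close>

definition bell :: "'a set \<Rightarrow> 'a set \<times> 'a set \<Rightarrow> 'a set \<times> 'a set \<Rightarrow> complex" where
  "bell I = (\<lambda>(a, b) (x, y). if x = sym_diff a y then walsh b y / sqrt (2 ^ card I) else 0)"

text \<open>The normalised Hilbert-Schmidt product of \<open>X\<^sup>a Z\<^sup>b\<close> with
  \<open>M\<close>. The phases that would make \<open>X Z\<close> into \<open>Y\<close> are left
  out: only moduli of coefficients enter the weights.\<close>

definition pauli_coeff :: "'a set \<Rightarrow> ('a set \<Rightarrow> 'a set \<Rightarrow> complex) \<Rightarrow> 'a set \<times> 'a set \<Rightarrow> complex" where
  "pauli_coeff I M = (\<lambda>(a, b). (\<Sum>y\<in>Pow I. walsh b y * M (sym_diff a y) y) / 2 ^ card I)"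

abbreviation pairs :: "'a set \<Rightarrow> ('a set \<times> 'a set) set" where
  "pairs I \<equiv> Pow I \<times> Pow I"

lemma sum_pairs_swap: "(\<Sum>p\<in>A \<times> B. f p) = (\<Sum>y\<in>B. \<Sum>x\<in>A. f (x, y))"
  by (subst sum.swap) (simp add: sum.cartesian_product case_prod_unfold)

lemma sqrt_power2_square: "complex_of_real (sqrt (2 ^ m)) * complex_of_real (sqrt (2 ^ m)) = 2 ^ m"
  by (simp flip: of_real_mult)

lemma bell_orthonormal:
  assumes fin: "finite I" and "g \<in> pairs I" "g' \<in> pairs I"
  shows "(\<Sum>p\<in>pairs I. cnj (bell I g p) * bell I g' p) = (if g = g' then 1 else 0)"
proof -
  obtain a b a' b' where g: "g = (a, b)" "g' = (a', b')" by fastforce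
  with assms have sub: "a \<subseteq> I" "b \<subseteq> I" "a' \<subseteq> I" "b' \<subseteq> I" by auto
  let ?S = "\<lambda>y. \<Sum>x\<in>Pow I. cnj (bell I g (x, y)) * bell I g' (x, y)"
  let ?V = "\<lambda>y. if a = a' then walsh b y * walsh b' y / 2 ^ card I else 0"
  have "(\<Sum>p\<in>pairs I. cnj (bell I g p) * bell I g' p)
      = (\<Sum>y\<in>Pow I. \<Sum>x\<in>Pow I. cnj (bell I g (x, y)) * bell I g' (x, y))"
    by (rule sum_pairs_swap)
  also have "\<dots> = (\<Sum>y\<in>Pow I. ?V y)"
  proof (intro sum.cong refl)
    fix y assume y: "y \<in> Pow I"
    have "?S y
        = (\<Sum>x\<in>Pow I. if x = sym_diff a y then cnj (bell I g (x, y)) * bell I g' (x, y) else 0)"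
      by (intro sum.cong) (auto simp: bell_def g)
    also have "\<dots> = cnj (bell I g (sym_diff a y, y)) * bell I g' (sym_diff a y, y)"
    proof -
      have "sym_diff a y \<in> Pow I" using sub y by auto
      then show ?thesis using fin by (simp only: sum.delta finite_Pow_iff if_True)
    qed
    also have "\<dots> = ?V y"
    proof (cases "a = a'")
      case True
      then show ?thesis by (simp add: bell_def g sqrt_power2_square flip: of_real_mult)
    next
      case False
      then have "sym_diff a y \<noteq> sym_diff a' y" by blast
      then show ?thesis using False by (simp add: bell_def g)
    qed
    finally show "?S y = ?V y" .
  qed
  also have "\<dots> = (if g = g' then 1 else 0)"
  proof -
    have "(\<Sum>y\<in>Pow I. walsh b y * walsh b' y) = (\<Sum>y\<in>Pow I. walsh y b * walsh y b')"
      by (intro sum.cong refl) (metis walsh_commute)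
    then show ?thesis
      using walsh_orthogonal[OF fin sub(2,4)]
      by (cases "a = a'") (simp_all add: g flip: sum_divide_distrib)
  qed
  finally show ?thesis .
qed

lemma orthonormal_expansion_ip:
  assumes "finite \<Omega>" "finite P"
    and "\<And>g g'. g \<in> \<Omega> \<Longrightarrow> g' \<in> \<Omega> \<Longrightarrow> (\<Sum>p\<in>P. cnj (\<beta> g p) * \<beta> g' p) = (if g = g' then 1 else 0 :: complex)"
  shows "(\<Sum>p\<in>P. cnj (\<Sum>g\<in>\<Omega>. c g * \<beta> g p) * (\<Sum>g\<in>\<Omega>. e g * \<beta> g p)) = (\<Sum>g\<in>\<Omega>. cnj (c g) * e g)"
proof -
  have "(\<Sum>p\<in>P. cnj (\<Sum>g\<in>\<Omega>. c g * \<beta> g p) * (\<Sum>g\<in>\<Omega>. e g * \<beta> g p))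
     = (\<Sum>p\<in>P. \<Sum>g\<in>\<Omega>. \<Sum>g'\<in>\<Omega>. cnj (c g) * e g' * (cnj (\<beta> g p) * \<beta> g' p))"
    unfolding cnj_sum sum_product by (intro sum.cong refl) (simp add: mult_ac)
  also have "\<dots> = (\<Sum>g\<in>\<Omega>. \<Sum>g'\<in>\<Omega>. \<Sum>p\<in>P. cnj (c g) * e g' * (cnj (\<beta> g p) * \<beta> g' p))"
    by (subst sum.swap) (intro sum.cong refl sum.swap)
  also have "\<dots> = (\<Sum>g\<in>\<Omega>. \<Sum>g'\<in>\<Omega>. if g' = g then cnj (c g) * e g' else 0)"
    using assms(3) by (intro sum.cong refl) (auto simp flip: sum_distrib_left)
  also have "\<dots> = (\<Sum>g\<in>\<Omega>. cnj (c g) * e g)" using assms(1) by simp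
  finally show ?thesis .
qed

lemmas bell_expansion_ip =
  orthonormal_expansion_ip[of "pairs I" "pairs I" "bell I" for I, OF _ _ bell_orthonormal]

lemma pauli_expansion:
  assumes fin: "finite I" and "x \<subseteq> I" "y \<subseteq> I"
  shows "(\<Sum>g\<in>pairs I. pauli_coeff I M g * bell I g (x, y)) = M x y / sqrt (2 ^ card I)"
proof -
  let ?a = "sym_diff x y"
  have a: "?a \<in> Pow I" using assms by auto
  have eq: "x = sym_diff a y \<longleftrightarrow> a = ?a" for a by blast
  have "(\<Sum>g\<in>pairs I. pauli_coeff I M g * bell I g (x, y))
     = (\<Sum>b\<in>Pow I. \<Sum>a\<in>Pow I. if a = ?a then pauli_coeff I M (a, b) * (walsh b y / sqrt (2 ^ card I)) else 0)"
    unfolding sum_pairs_swap by (intro sum.cong refl) (auto simp: bell_def eq)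
  also have "\<dots> = (\<Sum>b\<in>Pow I. pauli_coeff I M (?a, b) * (walsh b y / sqrt (2 ^ card I)))"
    using fin a by (simp only: sum.delta finite_Pow_iff if_True)
  also have "\<dots> = (\<Sum>b\<in>Pow I. \<Sum>y'\<in>Pow I. M (sym_diff ?a y') y' / (2 ^ card I * sqrt (2 ^ card I)) * (walsh b y' * walsh b y))"
    unfolding pauli_coeff_def prod.case sum_divide_distrib sum_distrib_right
    by (intro sum.cong refl) (simp add: mult_ac)
  also have "\<dots> = (\<Sum>y'\<in>Pow I. M (sym_diff ?a y') y' / (2 ^ card I * sqrt (2 ^ card I)) * (\<Sum>b\<in>Pow I. walsh b y' * walsh b y))"
    by (subst sum.swap) (simp add: sum_distrib_left)
  also have "\<dots> = (\<Sum>y'\<in>Pow I. if y' = y then M (sym_diff ?a y') y' / sqrt (2 ^ card I) else 0)"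
    using walsh_orthogonal[OF fin _ assms(3)] by (intro sum.cong refl) auto
  also have "\<dots> = M (sym_diff ?a y) y / sqrt (2 ^ card I)"
    using fin assms(3) by (subst sum.delta) auto
  also have "sym_diff ?a y = x" by blast
  finally show ?thesis .
qed

lemma pauli_parseval:
  assumes "finite I"
  shows "(\<Sum>g\<in>pairs I. (cmod (pauli_coeff I M g))\<^sup>2) = (\<Sum>x\<in>Pow I. \<Sum>y\<in>Pow I. (cmod (M x y))\<^sup>2) / 2 ^ card I"
proof -
  let ?e = "\<lambda>p. \<Sum>g\<in>pairs I. pauli_coeff I M g * bell I g p"
  have "complex_of_real (\<Sum>g\<in>pairs I. (cmod (pauli_coeff I M g))\<^sup>2) = (\<Sum>p\<in>pairs I. cnj (?e p) * ?e p)"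
    unfolding of_real_sum complex_norm_square
    using bell_expansion_ip[of I "pauli_coeff I M" "pauli_coeff I M"] assms by (simp add: mult.commute)
  also have "\<dots> = (\<Sum>(x, y)\<in>pairs I. cnj (M x y / sqrt (2 ^ card I)) * (M x y / sqrt (2 ^ card I)))"
  proof (intro sum.cong refl, clarify)
    fix x y assume "x \<subseteq> I" "y \<subseteq> I"
    then show "cnj (?e (x, y)) * ?e (x, y) = cnj (M x y / sqrt (2 ^ card I)) * (M x y / sqrt (2 ^ card I))"
      by (simp only: pauli_expansion[OF assms])
  qed
  also have "\<dots> = (\<Sum>(x, y)\<in>pairs I. complex_of_real ((cmod (M x y))\<^sup>2 / 2 ^ card I))"
  proof (intro sum.cong refl, clarify)
    fix x y
    have "cnj (M x y / sqrt (2 ^ card I)) * (M x y / sqrt (2 ^ card I)) = M x y * cnj (M x y) / 2 ^ card I"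
      by (simp add: sqrt_power2_square mult.commute flip: of_real_mult)
    then show "cnj (M x y / sqrt (2 ^ card I)) * (M x y / sqrt (2 ^ card I)) = complex_of_real ((cmod (M x y))\<^sup>2 / 2 ^ card I)"
      unfolding of_real_divide complex_norm_square by simp
  qed
  also have "\<dots> = complex_of_real ((\<Sum>x\<in>Pow I. \<Sum>y\<in>Pow I. (cmod (M x y))\<^sup>2) / 2 ^ card I)"
    by (simp add: sum.cartesian_product sum_divide_distrib case_prod_unfold)
  finally show ?thesis unfolding of_real_eq_iff .
qed

section \<open>The part of a matrix supported on a set of qubits\<close>

lemma sum_Pow_split:
  assumes "finite I" "A \<subseteq> I"
  shows "(\<Sum>y\<in>Pow I. f y) = (\<Sum>s\<in>Pow A. \<Sum>z\<in>Pow (I - A). f (s \<union> z))"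
  unfolding sum.cartesian_product
  by (rule sum.reindex_bij_witness[of _ "\<lambda>(s, z). s \<union> z" "\<lambda>y. (y \<inter> A, y - A)"]) (use assms in \<open>auto intro!: arg_cong[of _ _ f]\<close>)

definition partial_trace :: "'a set \<Rightarrow> 'a set \<Rightarrow> ('a set \<Rightarrow> 'a set \<Rightarrow> complex) \<Rightarrow> 'a set \<Rightarrow> 'a set \<Rightarrow> complex" where
  "partial_trace I A M r s = (\<Sum>z\<in>Pow (I - A). M (r \<union> z) (s \<union> z)) / 2 ^ card (I - A)"

text \<open>A Pauli supported on \<open>A\<close> is the identity elsewhere, so it sees
  \<open>M\<close> only through the normalised partial trace. By Parseval the weight inside
  \<open>A\<close> thus becomes the Frobenius norm of a matrix on \<open>A\<close> alone.\<close>

lemma pauli_coeff_partial_trace: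
  assumes "finite I" "A \<subseteq> I" "g \<in> pairs A"
  shows "pauli_coeff I M g = pauli_coeff A (partial_trace I A M) g"
proof -
  obtain a b where g: "g = (a, b)" "a \<subseteq> A" "b \<subseteq> A" using assms(3) by auto
  have card: "card I = card A + card (I - A)"
    using assms(1,2) by (simp add: card_Diff_subset finite_subset card_mono)
  have "(\<Sum>y\<in>Pow I. walsh b y * M (sym_diff a y) y)
      = (\<Sum>s\<in>Pow A. \<Sum>z\<in>Pow (I - A). walsh b (s \<union> z) * M (sym_diff a (s \<union> z)) (s \<union> z))"
    by (rule sum_Pow_split[OF assms(1,2)])
  also have "\<dots> = (\<Sum>s\<in>Pow A. \<Sum>z\<in>Pow (I - A). walsh b s * M (sym_diff a s \<union> z) (s \<union> z))"
  proof (intro sum.cong refl)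
    fix s z assume sz: "s \<in> Pow A" "z \<in> Pow (I - A)"
    then have "b \<inter> (s \<union> z) = b \<inter> s" "sym_diff a (s \<union> z) = sym_diff a s \<union> z" using g by auto
    then show "walsh b (s \<union> z) * M (sym_diff a (s \<union> z)) (s \<union> z) = walsh b s * M (sym_diff a s \<union> z) (s \<union> z)"
      by (simp only: walsh_def)
  qed
  also have "\<dots> = 2 ^ card (I - A) * (\<Sum>s\<in>Pow A. walsh b s * partial_trace I A M (sym_diff a s) s)"
    unfolding sum_distrib_left
    by (intro sum.cong refl) (simp add: partial_trace_def flip: sum_distrib_left)
  finally show ?thesis
    by (simp add: pauli_coeff_def g(1) card power_add)
qed

section \<open>Catalytic rounds\<close>

lemma nsq_add_le: "nsq d (\<lambda>i. v i + w i) \<le> 2 * nsq d v + 2 * nsq d w"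
proof -
  have "(cmod (v i + w i))\<^sup>2 \<le> 2 * (cmod (v i))\<^sup>2 + 2 * (cmod (w i))\<^sup>2" for i
  proof -
    have "(cmod (v i + w i))\<^sup>2 \<le> (cmod (v i) + cmod (w i))\<^sup>2"
      by (intro power_mono norm_triangle_ineq) simp
    also have "\<dots> \<le> 2 * (cmod (v i))\<^sup>2 + 2 * (cmod (w i))\<^sup>2"
      using sum_squares_bound[of "cmod (v i)" "cmod (w i)"] by (simp add: power2_sum)
    finally show ?thesis .
  qed
  then show ?thesis
    unfolding nsq_def sum_distrib_left sum.distrib[symmetric] by (intro sum_mono)
qed

lemma nsq_scale: "nsq d (\<lambda>i. c * v i) = (cmod c)\<^sup>2 * nsq d v"
  by (simp add: nsq_def norm_mult power_mult_distrib sum_distrib_left)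

lemma nsq_component_le: "i < d \<Longrightarrow> (cmod (v i))\<^sup>2 \<le> nsq d v"
  unfolding nsq_def by (intro member_le_sum) auto

definition basis :: "nat \<Rightarrow> cvec" where
  "basis j = (\<lambda>i. if i = j then 1 else 0)"

lemma ip_basis: "j < d \<Longrightarrow> ip d (basis j) v = v j"
  using sum_delta_lt[of j d v] by (simp add: ip_def basis_def if_distrib[of cnj] eq_commute cong: if_cong)

lemma mat_vec_fixed_span:
  assumes "\<And>a i. a \<in> A \<Longrightarrow> i < d \<Longrightarrow> mat_vec d G (v a) i = v a i" "i < d"
  shows "mat_vec d G (\<lambda>i. \<Sum>a\<in>A. c a * v a i) i = (\<Sum>a\<in>A. c a * v a i)"
  using assms by (simp add: mat_vec_sum mat_vec_scale)

lemma basis_expansion: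
  assumes "\<And>i. i < L \<Longrightarrow> v i = 0" "i < d"
  shows "v i = (\<Sum>j\<in>{L..<d}. v j * basis j i)"
proof -
  have "(\<Sum>j\<in>{L..<d}. v j * basis j i) = (\<Sum>j\<in>{L..<d}. if j = i then v j else 0)"
    by (intro sum.cong) (auto simp: basis_def)
  then show ?thesis using assms by (cases "L \<le> i") auto
qed

fun run :: "nat \<Rightarrow> (nat \<Rightarrow> cmat) \<Rightarrow> cmat \<Rightarrow> cmat \<Rightarrow> nat \<Rightarrow> cvec" where
  "run d W P P' 0 = mat_vec d (W 0) (basis 0)"
| "run d W P P' (Suc t) = mat_vec d (W (Suc t)) (mat_vec d (if odd t then P' else P) (run d W P P' t))"

text \<open>One round applies \<open>G\<^sub>t R\<close> with the query reflection \<open>R = P' Q P\<close>, \<open>P' = P\<^sup>*\<close>, to a public state \<open>h t\<close> and a private space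
  (the coordinates below \<open>L\<close>) shared by all rounds.  A vector \<open>u \<in> Us\<close> fixed by \<open>R\<close> serves as a catalyst: \<open>h t + u\<close>
  is preserved.  A vector \<open>w = P' \<eta>\<close> with \<open>R w = -w\<close> and \<open>\<langle>u, w\<rangle> = 1\<close> for all \<open>u \<in> Us\<close> is a catalyst that turns \<open>h t + w\<close> into
  \<open>- h t + w\<close>.  As the input is spread evenly over \<open>K\<close> public states, the catalyst enters with
  squared norm \<open>\<parallel>u\<parallel>\<^sup>2 / K\<close> only, so that starting without it is harmless.  The idle state \<open>h K\<close> makes the sign observable.\<close>

locale transducer =
  fixes d L K :: nat and h :: "nat \<Rightarrow> nat" and Us :: "cvec set"
  assumes L: "0 < L" "L \<le> d" and K: "1 \<le> K"
    and inj: "inj_on h {..K}" and h: "\<And>t. t \<le> K \<Longrightarrow> L \<le> h t \<and> h t < d"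
    and supp_Us: "\<And>u i. u \<in> Us \<Longrightarrow> L \<le> i \<Longrightarrow> u i = 0"
begin

text \<open>Half of the squared norm idles at \<open>h K\<close>; the other half is spread over
  \<open>K\<close> states, of which those already visited carry a minus sign. After \<open>K\<close>
  sign flips the halves cancel in the product with the initial state, so \<open>public K\<close> is
  orthogonal to \<open>public 0\<close>.\<close>

definition weight :: "nat \<Rightarrow> nat \<Rightarrow> real" where
  "weight s t = (if t = K then 1 else if t < s then - (1 / sqrt K) else 1 / sqrt K) / sqrt 2"

definition public :: "nat \<Rightarrow> cvec" where
  "public s = (\<lambda>i. \<Sum>t\<in>{..K}. of_real (weight s t) * basis (h t) i)"

text \<open>The vectors fixed in round \<open>t\<close>. If \<open>u\<close> and \<open>w\<close>
  have inner product one, \<open>basis (h t) - w\<close> is orthogonal to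
  \<open>basis (h t) + u\<close> and hence negated. The remaining public basis vectors are included
  so that the other rounds are left alone.\<close>

definition plus_set :: "nat \<Rightarrow> cvec set" where
  "plus_set t = (\<lambda>u i. basis (h t) i + u i) ` Us \<union> basis ` ({L..<d} - {h t})"

end

text \<open>Two queries make one round: \<open>Q\<close> stands between \<open>P\<close> and
  \<open>P'\<close>, and \<open>G t\<close> follows. The final \<open>Hh\<close> sits at
  \<open>2 * K + 2\<close>, so one more pair of queries precedes it; this extra \<open>R\<close>
  acts trivially on public states.\<close>

locale transducer_rounds = transducer +
  fixes Fs :: "cvec set" and W :: "nat \<Rightarrow> cmat" and Q Hh :: cmat and G :: "nat \<Rightarrow> cmat"
  assumes W: "W 0 = Hh" "\<And>t. W (2 * t + 1) = Q" "\<And>t. t < K \<Longrightarrow> W (2 * t + 2) = G t" "W (2 * K + 2) = Hh"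
    and Q: "reflects d (Fs \<union> basis ` {L..<d}) Q"
    and G: "\<And>t. reflects d (plus_set t) (G t)"
    and Hh: "reflects d {\<lambda>i. basis 0 i + public 0 i} Hh"

lemma (in transducer) rounds_exist:
  assumes "finite Us" "finite Fs"
  shows "\<exists>W Q Hh G. transducer_rounds d L K h Us Fs W Q Hh G \<and> (\<forall>t. is_unitary d (W t))"
proof -
  obtain Q where Q: "reflects d (Fs \<union> basis ` {L..<d}) Q"
    using reflection_exists[of "Fs \<union> basis ` {L..<d}" d] assms by auto
  have "finite (plus_set t)" for t using assms by (simp add: plus_set_def)
  then have "\<forall>t. \<exists>G. reflects d (plus_set t) G" by (intro allI reflection_exists)
  then obtain G where G: "\<And>t. reflects d (plus_set t) (G t)" by metis
  obtain Hh where Hh: "reflects d {\<lambda>i. basis 0 i + public 0 i} Hh"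
    using reflection_exists[of "{\<lambda>i. basis 0 i + public 0 i}" d] by auto
  define W where "W t = (if t = 0 \<or> t = 2 * K + 2 then Hh else if odd t then Q else G (t div 2 - 1))" for t
  have "transducer_rounds d L K h Us Fs W Q Hh G"
  proof
    show "W 0 = Hh" "W (2 * K + 2) = Hh" by (simp_all add: W_def)
    show "W (2 * t + 1) = Q" for t
    proof -
      have "2 * t + 1 \<noteq> 2 * K + 2" by presburger
      then show ?thesis by (simp add: W_def)
    qed
    show "W (2 * t + 2) = G t" if "t < K" for t using that by (simp add: W_def)
  qed (rule Q G Hh)+
  moreover have "is_unitary d (W t)" for t
    using reflectsD(1)[OF Q] reflectsD(1)[OF G] reflectsD(1)[OF Hh] by (simp add: W_def)
  ultimately show ?thesis by blast
qed

locale transducer_run = transducer_rounds +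
  fixes P P' :: cmat
  assumes P_unitary: "is_unitary d P" and P': "P' = adjoint P"
    and P_block: "\<And>v i. (\<And>i. i < L \<Longrightarrow> v i = 0) \<Longrightarrow> i < L \<Longrightarrow> mat_vec d P v i = 0"
begin

lemmas Q_unitary = reflectsD(1)[OF Q] and Q_fix = reflectsD(2)[OF Q] and Q_neg = reflectsD(3)[OF Q]
  and G_unitary = reflectsD(1)[OF G] and G_fix = reflectsD(2)[OF G] and G_neg = reflectsD(3)[OF G]
  and Hh_unitary = reflectsD(1)[OF Hh] and Hh_fix = reflectsD(2)[OF Hh singletonI]

lemma P'_unitary: "is_unitary d P'"
  unfolding P' by (rule unitary_adjoint[OF P_unitary])

lemma P'P: "i < d \<Longrightarrow> mat_vec d P' (mat_vec d P v) i = v i"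
  unfolding P' by (rule unitary_left_inverse[OF P_unitary])

lemma PP': "i < d \<Longrightarrow> mat_vec d P (mat_vec d P' v) i = v i"
  unfolding P' by (rule unitary_right_inverse[OF P_unitary])

abbreviation R :: "cvec \<Rightarrow> cvec" where
  "R v \<equiv> mat_vec d P' (mat_vec d Q (mat_vec d P v))"

abbreviation st :: "nat \<Rightarrow> cvec" where
  "st \<equiv> run d W P P'"

lemma R_diff: "R (\<lambda>i. v i - w i) = (\<lambda>i. R v i - R w i)"
  by (simp add: mat_vec_diff)

lemma R_add: "R (\<lambda>i. v i + w i) = (\<lambda>i. R v i + R w i)"
  by (simp add: mat_vec_add)

lemma R_scale: "R (\<lambda>i. c * v i) = (\<lambda>i. c * R v i)"
  by (simp add: mat_vec_scale)

lemma R_nsq: "nsq d (R v) = nsq d v"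
  by (simp add: unitary_nsq P_unitary P'_unitary Q_unitary)

lemma R_fixI:
  assumes "\<And>i. i < d \<Longrightarrow> mat_vec d Q (mat_vec d P v) i = mat_vec d P v i" "i < d"
  shows "R v i = v i"
  using mat_vec_cong[of d "mat_vec d Q (mat_vec d P v)" "mat_vec d P v" P'] assms P'P by simp

text \<open>The oracle does act on public states, but it keeps them out of the private block, where
  \<open>Q\<close> is the identity; \<open>P'\<close> then undoes \<open>P\<close>.\<close>

lemma R_public:
  assumes "\<And>i. i < L \<Longrightarrow> v i = 0" "i < d"
  shows "R v i = v i"
proof (rule R_fixI)
  fix i assume i: "i < d"
  define w where "w = mat_vec d P v"
  have w: "w i = (\<Sum>j\<in>{L..<d}. w j * basis j i)" if "i < d" for i
    using that by (intro basis_expansion) (simp_all add: w_def P_block assms(1))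
  have "mat_vec d Q w i = mat_vec d Q (\<lambda>i. \<Sum>j\<in>{L..<d}. w j * basis j i) i"
    by (rule fun_cong[OF mat_vec_cong]) (rule w)
  also have "\<dots> = (\<Sum>j\<in>{L..<d}. w j * basis j i)"
    by (rule mat_vec_fixed_span) (use i in \<open>auto intro!: Q_fix\<close>)
  also have "\<dots> = w i" by (rule w[OF i, symmetric])
  finally show "mat_vec d Q (mat_vec d P v) i = mat_vec d P v i" by (simp only: w_def)
qed (rule assms)

lemma public_low: "i < L \<Longrightarrow> public s i = 0"
  unfolding public_def using h by (intro sum.neutral) (fastforce simp: basis_def)

lemma R_public_state: "i < d \<Longrightarrow> R (public s) i = public s i"
  by (rule R_public) (simp_all add: public_low)

lemma public_at: "t \<le> K \<Longrightarrow> public s (h t) = of_real (weight s t)"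
proof -
  assume t: "t \<le> K"
  have "public s (h t) = (\<Sum>t'\<in>{..K}. if t' = t then of_real (weight s t') else 0)"
    unfolding public_def using inj t by (intro sum.cong refl) (auto simp: basis_def inj_on_def)
  then show ?thesis using t by simp
qed

lemma ip_public: "ip d (public s) v = (\<Sum>t\<in>{..K}. of_real (weight s t) * v (h t))"
proof -
  have "ip d (public s) v = cnj (ip d v (public s))" by (rule ip_commute)
  also have "\<dots> = (\<Sum>t\<in>{..K}. of_real (weight s t) * cnj (ip d v (basis (h t))))"
    unfolding public_def ip_sum ip_scale by simp
  also have "\<dots> = (\<Sum>t\<in>{..K}. of_real (weight s t) * v (h t))"
    using h by (intro sum.cong refl) (simp add: ip_commute[of d "basis _", symmetric] ip_basis)
  finally show ?thesis .
qed

lemma weight_idle: "weight s K = 1 / sqrt 2"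
  by (simp add: weight_def)

lemma public_norm: "ip d (public 0) (public 0) = 1"
proof -
  have "ip d (public 0) (public 0) = of_real (\<Sum>t\<in>{..K}. (weight 0 t)\<^sup>2)"
    unfolding ip_public by (simp add: public_at power2_eq_square)
  also have "(\<Sum>t\<in>{..K}. (weight 0 t)\<^sup>2) = (\<Sum>t<K. (weight 0 t)\<^sup>2) + 1 / 2"
    by (simp only: lessThan_Suc_atMost[symmetric] sum.lessThan_Suc weight_idle) (simp add: power_divide)
  also have "(\<Sum>t<K. (weight 0 t)\<^sup>2) = (\<Sum>t<K. 1 / (2 * real K))"
    by (intro sum.cong refl) (simp add: weight_def power_divide power_mult_distrib)
  finally show ?thesis using K by simp
qed

lemma public_orthogonal: "ip d (public 0) (public K) = 0"
proof -
  have "ip d (public 0) (public K) = of_real (\<Sum>t\<in>{..K}. weight 0 t * weight K t)"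
    unfolding ip_public by (simp add: public_at)
  also have "(\<Sum>t\<in>{..K}. weight 0 t * weight K t) = (\<Sum>t<K. weight 0 t * weight K t) + 1 / 2"
    by (simp only: lessThan_Suc_atMost[symmetric] sum.lessThan_Suc weight_idle) simp
  also have "(\<Sum>t<K. weight 0 t * weight K t) = (\<Sum>t<K. - (1 / (2 * real K)))"
    by (intro sum.cong refl) (simp add: weight_def power_divide power_mult_distrib flip: power2_eq_square)
  finally show ?thesis using K by simp
qed

text \<open>The reflection about the sum of two orthogonal unit vectors exchanges them: the sum is
  fixed and the difference negated. The same \<open>Hh\<close> therefore prepares the input and
  undoes the preparation before measurement.\<close>

lemma Hh_swap:
  assumes "i < d"
  shows "mat_vec d Hh (basis 0) i = public 0 i" "mat_vec d Hh (public 0) i = basis 0 i"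
proof -
  have d0: "0 < d" using L by simp
  have "ip d (\<lambda>i. basis 0 i + 1 * public 0 i) (\<lambda>i. basis 0 i - public 0 i) = 0"
    unfolding ip_add_left ip_diff public_norm
    using d0 L public_low[of 0 0] by (simp add: ip_basis ip_commute[of d "public 0" "basis 0"]) (simp add: basis_def)
  then have "mat_vec d Hh (\<lambda>i. basis 0 i - public 0 i) i = - (basis 0 i - public 0 i)"
    using assms by (intro reflectsD(3)[OF Hh]) simp_all
  moreover note Hh_fix[OF assms]
  ultimately have "mat_vec d Hh (basis 0) i - mat_vec d Hh (public 0) i = - (basis 0 i - public 0 i)"
    "mat_vec d Hh (basis 0) i + mat_vec d Hh (public 0) i = basis 0 i + public 0 i"
    by (simp_all add: mat_vec_diff mat_vec_add)
  then show "mat_vec d Hh (basis 0) i = public 0 i" "mat_vec d Hh (public 0) i = basis 0 i"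
    by algebra+
qed

lemma st_step: "st (2 * t + 2) = mat_vec d (W (2 * t + 2)) (R (st (2 * t)))"
  using W(2)[of t] by simp

definition amp :: complex where "amp = of_real (1 / (sqrt K * sqrt 2))"

lemma amp_sq: "(cmod amp)\<^sup>2 = 1 / (2 * real K)"
  by (simp add: amp_def norm_divide norm_mult power_divide power_mult_distrib)

text \<open>\<open>public (\<sigma> s) + amp x\<close> is the ideal state after \<open>s\<close> rounds, with catalyst \<open>x\<close>.\<close>

lemma run_close:
  assumes inv: "\<And>s i. s < K \<Longrightarrow> i < d \<Longrightarrow>
      mat_vec d (G s) (R (\<lambda>i. public (\<sigma> s) i + amp * x i)) i = public (\<sigma> (Suc s)) i + amp * x i"
    and \<sigma>0: "\<sigma> 0 = 0" and small: "800 * nsq d x \<le> real K"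
  shows "nsq d (\<lambda>i. st (2 * K + 2) i - mat_vec d Hh (public (\<sigma> K)) i) \<le> 1 / 400"
proof -
  let ?X = "\<lambda>s i. public (\<sigma> s) i + amp * x i"
  \<comment> \<open>The run starts without its catalyst. The missing \<open>amp * x\<close> evolves
    unitarily as an error vector, so the error never grows, however many rounds follow.\<close>
  have "nsq d (\<lambda>i. st (2 * s) i - ?X s i) = nsq d x / (2 * real K)" if "s \<le> K" for s
    using that
  proof (induction s)
    case 0
    have "nsq d (\<lambda>i. st (2 * 0) i - ?X 0 i) = nsq d (\<lambda>i. (- amp) * x i)"
      using Hh_swap(1) by (intro nsq_cong) (simp add: W(1) \<sigma>0)
    then show ?case by (simp only: nsq_scale norm_minus_cancel amp_sq) simp
  next
    case (Suc s)
    have "nsq d (\<lambda>i. st (2 * Suc s) i - ?X (Suc s) i) = nsq d (mat_vec d (G s) (R (\<lambda>i. st (2 * s) i - ?X s i)))"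
    proof (intro nsq_cong)
      fix i assume i: "i < d"
      have "st (2 * Suc s) = mat_vec d (G s) (R (st (2 * s)))"
        using st_step[of s] W(3)[of s] Suc.prems by simp
      then show "st (2 * Suc s) i - ?X (Suc s) i = mat_vec d (G s) (R (\<lambda>i. st (2 * s) i - ?X s i)) i"
        using inv[of s i] i Suc.prems by (simp add: R_diff mat_vec_diff)
    qed
    then show ?case using Suc by (simp add: unitary_nsq[OF G_unitary] R_nsq)
  qed
  from this[of K] have "nsq d (\<lambda>i. st (2 * K) i - ?X K i) = nsq d x / (2 * real K)" by simp
  moreover have "nsq d (\<lambda>i. amp * x i) = nsq d x / (2 * real K)"
    by (simp only: nsq_scale amp_sq) simp
  moreover have "nsq d (\<lambda>i. st (2 * K) i - public (\<sigma> K) i) =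
      nsq d (\<lambda>i. (st (2 * K) i - ?X K i) + amp * x i)"
    by (simp add: algebra_simps)
  ultimately have "nsq d (\<lambda>i. st (2 * K) i - public (\<sigma> K) i) \<le> 4 * (nsq d x / (2 * real K))"
    using nsq_add_le[of d "\<lambda>i. st (2 * K) i - ?X K i" "\<lambda>i. amp * x i"] by linarith
  \<comment> \<open>The catalyst is missing at the start and discarded at the end, which doubles the
    error in norm. The constant \<open>800\<close> is chosen to make the total at most
    \<open>1 / 20\<close>.\<close>
  also have "\<dots> \<le> 1 / 400" using small K by (simp add: field_simps)
  finally have "nsq d (\<lambda>i. st (2 * K) i - public (\<sigma> K) i) \<le> 1 / 400" .
  moreover have "nsq d (\<lambda>i. st (2 * K + 2) i - mat_vec d Hh (public (\<sigma> K)) i)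
      = nsq d (mat_vec d Hh (R (\<lambda>i. st (2 * K) i - public (\<sigma> K) i)))"
  proof (intro nsq_cong)
    fix i assume i: "i < d"
    have "mat_vec d Hh (R (public (\<sigma> K))) = mat_vec d Hh (public (\<sigma> K))"
      by (rule mat_vec_cong) (rule R_public_state)
    then show "st (2 * K + 2) i - mat_vec d Hh (public (\<sigma> K)) i = mat_vec d Hh (R (\<lambda>i. st (2 * K) i - public (\<sigma> K) i)) i"
      unfolding st_step W(4) R_diff mat_vec_diff by simp
  qed
  ultimately show ?thesis by (simp add: unitary_nsq[OF Hh_unitary] R_nsq)
qed

lemma public_split:
  assumes "s < K"
  shows "public s' i = of_real (weight s' s) * basis (h s) i + (\<Sum>t\<in>{..K} - {s}. of_real (weight s' t) * basis (h t) i)"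
  unfolding public_def using assms by (simp add: sum.remove[of _ s])

lemma amp_weight: "s < K \<Longrightarrow> of_real (weight s' s) = (if s < s' then - amp else amp)"
  by (simp add: weight_def amp_def)

lemma G_public_rest:
  assumes "s < K" "i < d"
  shows "mat_vec d (G s) (\<lambda>i. \<Sum>t\<in>{..K} - {s}. c t * basis (h t) i) i = (\<Sum>t\<in>{..K} - {s}. c t * basis (h t) i)"
proof (rule mat_vec_fixed_span)
  fix t i assume t: "t \<in> {..K} - {s}" and i: "i < d"
  have "h t \<noteq> h s" using inj t assms(1) by (auto simp: inj_on_def)
  then have "basis (h t) \<in> plus_set s" using h[of t] t by (auto simp: plus_set_def)
  then show "mat_vec d (G s) (basis (h t)) i = basis (h t) i" using i by (rule G_fix)
qed (rule assms)

text \<open>If \<open>P u\<close> lies in the span of \<open>Fs\<close>, then \<open>R\<close> fixes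
  \<open>u\<close>, and every round fixes \<open>public 0 + amp * u\<close>. The final amplitude at
  \<open>0\<close> is within \<open>1 / 20\<close> of one, and \<open>(19 / 20)\<^sup>2\<close>
  exceeds \<open>9 / 10\<close>.\<close>

theorem accepts:
  assumes u: "u \<in> Us" "800 * nsq d u \<le> real K"
    and Pu: "\<And>i. i < d \<Longrightarrow> mat_vec d P u i = (\<Sum>a\<in>J. c a * f a i)"
    and Fs: "\<And>a. a \<in> J \<Longrightarrow> f a \<in> Fs"
  shows "9 / 10 \<le> (cmod (st (2 * K + 2) 0))\<^sup>2"
proof -
  have Ru: "R u i = u i" if "i < d" for i
  proof (rule R_fixI)
    fix i assume i: "i < d"
    have "mat_vec d Q (mat_vec d P u) i = mat_vec d Q (\<lambda>i. \<Sum>a\<in>J. c a * f a i) i"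
      using mat_vec_cong[of d "mat_vec d P u" "\<lambda>i. \<Sum>a\<in>J. c a * f a i" Q] Pu by simp
    also have "\<dots> = (\<Sum>a\<in>J. c a * f a i)"
      by (rule mat_vec_fixed_span) (use i Q_fix Fs in auto)
    finally show "mat_vec d Q (mat_vec d P u) i = mat_vec d P u i" using Pu[OF i] by simp
  qed (rule that)
  have "nsq d (\<lambda>i. st (2 * K + 2) i - mat_vec d Hh (public 0) i) \<le> 1 / 400"
  proof (rule run_close[of "\<lambda>_. 0" u])
    fix s i assume s: "s < K" and i: "i < d"
    let ?rest = "\<lambda>i. \<Sum>t\<in>{..K} - {s}. of_real (weight 0 t) * basis (h t) i"
    have X: "public 0 i + amp * u i = amp * (basis (h s) i + u i) + ?rest i" for i
      using public_split[OF s, of 0 i] amp_weight[OF s, of 0] by (simp add: algebra_simps)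
    have "mat_vec d (G s) (R (\<lambda>i. public 0 i + amp * u i)) i = mat_vec d (G s) (\<lambda>i. public 0 i + amp * u i) i"
      by (rule fun_cong[OF mat_vec_cong]) (simp only: R_add R_scale, simp only: R_public_state Ru)
    also have "\<dots> = amp * (basis (h s) i + u i) + ?rest i"
    proof -
      have "mat_vec d (G s) (\<lambda>i. basis (h s) i + u i) i = basis (h s) i + u i"
        by (rule G_fix[OF _ i]) (use u(1) in \<open>simp add: plus_set_def\<close>)
      then show ?thesis
        unfolding X mat_vec_add[of d _ "\<lambda>i. amp * (basis (h s) i + u i)"]
        unfolding mat_vec_scale[of d _ amp] G_public_rest[OF s i] by (rule arg_cong)
    qed
    finally show "mat_vec d (G s) (R (\<lambda>i. public 0 i + amp * u i)) i = public 0 i + amp * u i"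
      by (simp only: X)
  qed (use u in auto)
  then have "(cmod (st (2 * K + 2) 0 - mat_vec d Hh (public 0) 0))\<^sup>2 \<le> 1 / 400"
    using nsq_component_le[of 0 d "\<lambda>i. st (2 * K + 2) i - mat_vec d Hh (public 0) i"] L by linarith
  then have "(cmod (st (2 * K + 2) 0 - 1))\<^sup>2 \<le> (1 / 20)\<^sup>2"
    using Hh_swap(2)[of 0] L by (simp add: basis_def power2_eq_square)
  then have "cmod (st (2 * K + 2) 0 - 1) \<le> 1 / 20" by (rule power2_le_imp_le) simp
  moreover have "1 - cmod (st (2 * K + 2) 0) \<le> cmod (st (2 * K + 2) 0 - 1)"
    using norm_triangle_ineq2[of 1 "st (2 * K + 2) 0"] by (simp add: norm_minus_commute)
  ultimately have "19 / 20 \<le> cmod (st (2 * K + 2) 0)" by simp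
  then have "(19 / 20)\<^sup>2 \<le> (cmod (st (2 * K + 2) 0))\<^sup>2" by (intro power_mono) auto
  then show ?thesis by (simp add: power2_eq_square)
qed

text \<open>In round \<open>s\<close> the query reflection turns \<open>w\<close> into
  \<open>- w\<close>, so the active part is \<open>basis (h s) - w\<close> up to \<open>amp\<close>.
  \<open>G s\<close> negates it, which flips the sign of \<open>h s\<close> and restores the
  catalyst. After \<open>K\<close> rounds the public state is \<open>public K\<close>, which
  \<open>Hh\<close> maps to a vector orthogonal to \<open>basis 0\<close>.\<close>

theorem rejects:
  assumes \<eta>: "\<And>i. L \<le> i \<Longrightarrow> i < d \<Longrightarrow> \<eta> i = 0" "\<And>f. f \<in> Fs \<Longrightarrow> ip d f \<eta> = 0" "800 * nsq d \<eta> \<le> real K"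
    and w_supp: "\<And>i. L \<le> i \<Longrightarrow> i < d \<Longrightarrow> mat_vec d P' \<eta> i = 0"
    and uw: "\<And>u. u \<in> Us \<Longrightarrow> ip d u (mat_vec d P' \<eta>) = 1"
  shows "(cmod (st (2 * K + 2) 0))\<^sup>2 \<le> 1 / 10"
proof -
  define w where "w = mat_vec d P' \<eta>"
  have Rw: "R w i = - w i" if "i < d" for i
  proof -
    have "mat_vec d Q (mat_vec d P w) = mat_vec d Q \<eta>"
      unfolding w_def by (rule mat_vec_cong) (rule PP')
    moreover have "mat_vec d Q \<eta> j = - \<eta> j" if "j < d" for j
      by (rule Q_neg) (use \<eta> that in \<open>auto simp: ip_basis\<close>)
    then have "mat_vec d P' (mat_vec d Q \<eta>) = mat_vec d P' (\<lambda>j. - \<eta> j)" by (rule mat_vec_cong)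
    ultimately have "R w = mat_vec d P' (\<lambda>j. - \<eta> j)" by simp
    then show ?thesis by (simp add: mat_vec_uminus w_def)
  qed
  have "nsq d (\<lambda>i. st (2 * K + 2) i - mat_vec d Hh (public K) i) \<le> 1 / 400"
  proof (rule run_close[of "\<lambda>s. s" w])
    fix s i assume s: "s < K" and i: "i < d"
    let ?rest = "\<lambda>i. \<Sum>t\<in>{..K} - {s}. of_real (weight s t) * basis (h t) i"
    have X: "public s i + - amp * w i = amp * (basis (h s) i - w i) + ?rest i" for i
      using public_split[OF s, of s i] amp_weight[OF s, of s] by (simp add: algebra_simps)
    have rest': "?rest i = (\<Sum>t\<in>{..K} - {s}. of_real (weight (Suc s) t) * basis (h t) i)" for i
      by (intro sum.cong refl) (auto simp: weight_def)
    have X': "public (Suc s) i + amp * w i = amp * - (basis (h s) i - w i) + ?rest i" for i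
      unfolding rest' using public_split[OF s, of "Suc s" i] amp_weight[OF s, of "Suc s"] by (simp add: algebra_simps)
    have "mat_vec d (G s) (R (\<lambda>i. public s i + amp * w i)) i = mat_vec d (G s) (\<lambda>i. public s i + - amp * w i) i"
      by (rule fun_cong[OF mat_vec_cong]) (simp only: R_add R_scale, simp add: R_public_state Rw)
    also have "\<dots> = amp * mat_vec d (G s) (\<lambda>i. basis (h s) i - w i) i + ?rest i"
      unfolding X mat_vec_add[of d _ "\<lambda>i. amp * (basis (h s) i - w i)"]
      unfolding mat_vec_scale[of d _ amp] G_public_rest[OF s i] ..
    also have "mat_vec d (G s) (\<lambda>i. basis (h s) i - w i) i = - (basis (h s) i - w i)"
    proof (rule G_neg)
      fix v assume "v \<in> plus_set s"
      then consider u where "u \<in> Us" "v = (\<lambda>i. basis (h s) i + 1 * u i)" | j where "L \<le> j" "j < d" "j \<noteq> h s" "v = basis j"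
        by (auto simp: plus_set_def) blast
      then show "ip d v (\<lambda>i. basis (h s) i - w i) = 0"
      proof cases
        case (1 u)
        have hs: "L \<le> h s" "h s < d" using h[of s] s by auto
        have "ip d u (basis (h s)) = 0"
          using hs supp_Us[OF 1(1)] by (simp add: ip_commute[of d u] ip_basis)
        then show ?thesis
          unfolding 1(2) ip_add_left ip_diff using hs uw[OF 1(1)] w_supp[OF hs]
          by (simp add: ip_basis w_def) (simp add: basis_def)
      next
        case (2 j)
        then show ?thesis using w_supp[of j] by (simp add: ip_basis w_def) (simp add: basis_def)
      qed
    qed (rule i)
    finally show "mat_vec d (G s) (R (\<lambda>i. public s i + amp * w i)) i = public (Suc s) i + amp * w i"
      by (simp only: X')
  qed (use \<eta>(3) unitary_nsq[OF P'_unitary] in \<open>auto simp: w_def\<close>)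
  then have "(cmod (st (2 * K + 2) 0 - mat_vec d Hh (public K) 0))\<^sup>2 \<le> 1 / 400"
    using nsq_component_le[of 0 d "\<lambda>i. st (2 * K + 2) i - mat_vec d Hh (public K) i"] L by linarith
  moreover have "mat_vec d Hh (public K) 0 = 0"
  proof -
    have "mat_vec d Hh (public K) 0 = ip d (basis 0) (mat_vec d Hh (public K))"
      using L by (simp add: ip_basis)
    also have "\<dots> = ip d (mat_vec d Hh (public 0)) (mat_vec d Hh (public K))"
      by (rule ip_cong) (simp_all add: Hh_swap)
    also have "\<dots> = 0" by (simp add: unitary_ip[OF Hh_unitary] public_orthogonal)
    finally show ?thesis .
  qed
  ultimately show ?thesis by simp
qed

end

section \<open>Juntas and their Pauli weights\<close>

lemma set_encode_less: "X \<subseteq> {..<n} \<Longrightarrow> set_encode X < 2 ^ n"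
proof -
  assume X: "X \<subseteq> {..<n}"
  have "set_encode X \<le> (\<Sum>i<n. 2 ^ i)"
    unfolding set_encode_def using X by (intro sum_mono2) auto
  also have "\<dots> < 2 ^ n" by (induction n) auto
  finally show ?thesis .
qed

lemma set_decode_subset: "x < 2 ^ n \<Longrightarrow> set_decode x \<subseteq> {..<n}"
proof
  fix j assume x: "x < 2 ^ n" and "j \<in> set_decode x"
  then have "x div 2 ^ j \<noteq> 0" by (auto simp: set_decode_def intro: ccontr)
  then have "2 ^ j \<le> x" by (simp add: div_eq_0_iff)
  then have "(2::nat) ^ j < 2 ^ n" using x by linarith
  then show "j \<in> {..<n}" by simp
qed

lemma finite_bits: "X \<subseteq> {..<n::nat} \<Longrightarrow> finite X"
  by (rule finite_subset) auto

lemma sum_bits: "(\<Sum>x<2 ^ n. f x) = (\<Sum>X\<in>Pow {..<n}. f (set_encode X))"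
  by (rule sum.reindex_bij_witness[of _ set_encode set_decode])
    (auto simp: set_encode_less finite_bits dest: set_decode_subset)

lemma qbit_decode: "qbit x j \<longleftrightarrow> j \<in> set_decode x"
  by (simp add: qbit_def set_decode_def)

definition set_matrix :: "cmat \<Rightarrow> nat set \<Rightarrow> nat set \<Rightarrow> complex" where
  "set_matrix U X Y = U (set_encode X) (set_encode Y)"

text \<open>Relabels the subsets of the \<open>k\<close>-set \<open>A\<close> by numbers below \<open>2\<^sup>k\<close> as \<^const>\<open>restrict_idx\<close> does.\<close>

definition subset_index :: "nat set \<Rightarrow> nat set \<Rightarrow> nat" where
  "subset_index A R = set_encode {i. i < card A \<and> sorted_list_of_set A ! i \<in> R}"

lemma restrict_idx_eq: "restrict_idx A x = subset_index A (set_decode x \<inter> A)"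
proof (cases "finite A")
  case True
  have "{i. i < card A \<and> sorted_list_of_set A ! i \<in> set_decode x \<inter> A} =
    {i\<in>{..<card A}. qbit x (sorted_list_of_set A ! i)}"
    using nth_mem[of _ "sorted_list_of_set A"] True by (auto simp: qbit_decode)
  then show ?thesis
    unfolding restrict_idx_def subset_index_def set_encode_def by (simp only: sum.inter_filter[OF finite_lessThan])
qed (simp add: restrict_idx_def subset_index_def)

lemma subset_index_bij:
  assumes "finite A"
  shows "bij_betw (subset_index A) (Pow A) {..<2 ^ card A}"
proof -
  let ?l = "sorted_list_of_set A"
  have l: "set ?l = A" "distinct ?l" "length ?l = card A" using assms by auto
  have "bij_betw (\<lambda>R. {i. i < card A \<and> ?l ! i \<in> R}) (Pow A) (Pow {..<card A})"
  proof (rule bij_betw_byWitness[where f' = "\<lambda>S. (!) ?l ` S"])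
    show "\<forall>R\<in>Pow A. (!) ?l ` {i. i < card A \<and> ?l ! i \<in> R} = R"
      using l by (force simp: in_set_conv_nth)
    show "\<forall>S\<in>Pow {..<card A}. {i. i < card A \<and> ?l ! i \<in> (!) ?l ` S} = S"
      using l by (auto simp: nth_eq_iff_index_eq)
    show "(\<lambda>R. {i. i < card A \<and> ?l ! i \<in> R}) ` Pow A \<subseteq> Pow {..<card A}" by auto
    show "(`) ((!) ?l) ` Pow {..<card A} \<subseteq> Pow A"
      using l nth_mem[of _ ?l] by auto
  qed
  moreover have "bij_betw set_encode (Pow {..<card A}) {..<2 ^ card A}"
    by (rule bij_betw_byWitness[where f' = set_decode])
      (auto simp: set_encode_less finite_bits dest: set_decode_subset)
  ultimately show ?thesis
    unfolding subset_index_def[abs_def] using bij_betw_trans by (fastforce simp: comp_def)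
qed

lemma sum_subset_index:
  assumes "finite A"
  shows "(\<Sum>r<2 ^ card A. f r) = (\<Sum>R\<in>Pow A. f (subset_index A R))"
  using sum.reindex_bij_betw[OF subset_index_bij[OF assms], of f] by simp

lemma unitary_frobenius:
  assumes "is_unitary d U"
  shows "(\<Sum>i<d. \<Sum>j<d. (cmod (U i j))\<^sup>2) = real d"
proof -
  have "complex_of_real (\<Sum>i<d. \<Sum>j<d. (cmod (U i j))\<^sup>2) = (\<Sum>j<d. \<Sum>i<d. cnj (U i j) * U i j)"
    unfolding of_real_sum complex_norm_square by (subst sum.swap) (simp add: mult.commute)
  also have "\<dots> = (\<Sum>j<d. 1)"
    using assms by (intro sum.cong refl) (simp add: is_unitary_def)
  also have "\<dots> = complex_of_real (real d)" by simp
  finally show ?thesis unfolding of_real_eq_iff .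
qed

definition pauli_weight :: "nat \<Rightarrow> cmat \<Rightarrow> nat set \<times> nat set \<Rightarrow> real" where
  "pauli_weight n U g = (cmod (pauli_coeff {..<n} (set_matrix U) g))\<^sup>2"

definition pauli_support :: "'a set \<times> 'a set \<Rightarrow> 'a set" where
  "pauli_support g = fst g \<union> snd g"

lemma pauli_weight_total:
  assumes "is_unitary (2 ^ n) U"
  shows "sum (pauli_weight n U) (pairs {..<n}) = 1"
proof -
  have "(\<Sum>x\<in>Pow {..<n}. \<Sum>y\<in>Pow {..<n}. (cmod (set_matrix U x y))\<^sup>2) = 2 ^ n"
    using unitary_frobenius[OF assms] by (simp add: sum_bits set_matrix_def)
  then show ?thesis
    by (simp add: pauli_weight_def pauli_parseval)
qed

lemma pauli_weight_inside:
  assumes "A \<subseteq> {..<n}"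
  shows "sum (pauli_weight n U) (pairs A) =
    (\<Sum>r\<in>Pow A. \<Sum>s\<in>Pow A. (cmod (partial_trace {..<n} A (set_matrix U) r s))\<^sup>2) / 2 ^ card A"
proof -
  have "sum (pauli_weight n U) (pairs A) =
      (\<Sum>g\<in>pairs A. (cmod (pauli_coeff A (partial_trace {..<n} A (set_matrix U)) g))\<^sup>2)"
    unfolding pauli_weight_def
    using pauli_coeff_partial_trace[OF _ assms] by (intro sum.cong refl) simp
  then show ?thesis by (simp only: pauli_parseval[OF finite_bits[OF assms]])
qed

lemma pauli_weight_split:
  assumes "is_unitary (2 ^ n) U" "A \<subseteq> {..<n}"
  shows "(\<Sum>g\<in>{g\<in>pairs {..<n}. pauli_support g \<inter> ({..<n} - A) \<noteq> {}}. pauli_weight n U g)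
    = 1 - sum (pauli_weight n U) (pairs A)"
proof -
  have "{g\<in>pairs {..<n}. pauli_support g \<inter> ({..<n} - A) \<noteq> {}} = pairs {..<n} - pairs A"
    using assms(2) by (auto simp: pauli_support_def)
  moreover have "pairs A \<subseteq> pairs {..<n}" using assms(2) by auto
  ultimately show ?thesis
    using pauli_weight_total[OF assms(1)] by (simp add: sum_diff)
qed

lemma sum_blocks:
  assumes "finite I" "A \<subseteq> I"
  shows "(\<Sum>x\<in>Pow I. \<Sum>y\<in>Pow I. if x - A = y - A then g x y else 0) =
    (\<Sum>r\<in>Pow A. \<Sum>s\<in>Pow A. \<Sum>z\<in>Pow (I - A). g (r \<union> z) (s \<union> z))"
proof -
  have "(\<Sum>x\<in>Pow I. \<Sum>y\<in>Pow I. if x - A = y - A then g x y else 0) =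
    (\<Sum>r\<in>Pow A. \<Sum>z\<in>Pow (I - A). \<Sum>s\<in>Pow A. \<Sum>z'\<in>Pow (I - A). if (r \<union> z) - A = (s \<union> z') - A then g (r \<union> z) (s \<union> z') else 0)"
    by (simp only: sum_Pow_split[OF assms])
  also have "\<dots> = (\<Sum>r\<in>Pow A. \<Sum>z\<in>Pow (I - A). \<Sum>s\<in>Pow A. \<Sum>z'\<in>Pow (I - A). if z' = z then g (r \<union> z) (s \<union> z') else 0)"
  proof (intro sum.cong refl)
    fix r z s z' assume "r \<in> Pow A" "z \<in> Pow (I - A)" "s \<in> Pow A" "z' \<in> Pow (I - A)"
    then have "(r \<union> z) - A = z" "(s \<union> z') - A = z'" by auto
    then show "(if (r \<union> z) - A = (s \<union> z') - A then g (r \<union> z) (s \<union> z') else 0) = (if z' = z then g (r \<union> z) (s \<union> z') else 0)"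
      by auto
  qed
  also have "\<dots> = (\<Sum>r\<in>Pow A. \<Sum>z\<in>Pow (I - A). \<Sum>s\<in>Pow A. g (r \<union> z) (s \<union> z))"
    using assms(1) by (intro sum.cong refl) (simp add: sum.delta)
  also have "\<dots> = (\<Sum>r\<in>Pow A. \<Sum>s\<in>Pow A. \<Sum>z\<in>Pow (I - A). g (r \<union> z) (s \<union> z))"
    by (intro sum.cong refl sum.swap)
  finally show ?thesis .
qed

definition junta_matrix :: "nat set \<Rightarrow> cmat \<Rightarrow> nat set \<Rightarrow> nat set \<Rightarrow> complex" where
  "junta_matrix A V x y = (if x - A = y - A then V (subset_index A (x \<inter> A)) (subset_index A (y \<inter> A)) else 0)"

lemma junta_matrix_blocks: "r \<subseteq> A \<Longrightarrow> s \<subseteq> A \<Longrightarrow> z \<inter> A = {} \<Longrightarrow>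
  junta_matrix A V (r \<union> z) (s \<union> z) = V (subset_index A r) (subset_index A s)"
proof -
  assume "r \<subseteq> A" "s \<subseteq> A" "z \<inter> A = {}"
  then have "(r \<union> z) - A = (s \<union> z) - A" "(r \<union> z) \<inter> A = r" "(s \<union> z) \<inter> A = s" by auto
  then show ?thesis by (simp only: junta_matrix_def refl if_True)
qed

lemma is_qjunta_iff:
  "is_qjunta n k U \<longleftrightarrow> (\<exists>A V. A \<subseteq> {..<n} \<and> card A = k \<and> is_unitary (2 ^ k) V \<and>
     (\<forall>x\<in>Pow {..<n}. \<forall>y\<in>Pow {..<n}. set_matrix U x y = junta_matrix A V x y))"
proof -
  have cond: "(\<forall>j<n. j \<notin> A \<longrightarrow> (qbit x j \<longleftrightarrow> qbit y j)) \<longleftrightarrow> set_decode x - A = set_decode y - A"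
    if "x < 2 ^ n" "y < 2 ^ n" for x y A
    using set_decode_subset[OF that(1)] set_decode_subset[OF that(2)] by (auto simp: qbit_decode)
  have "(\<forall>x<2 ^ n. \<forall>y<2 ^ n. U x y = (if (\<forall>j<n. j \<notin> A \<longrightarrow> (qbit x j \<longleftrightarrow> qbit y j))
           then V (restrict_idx A x) (restrict_idx A y) else 0)) \<longleftrightarrow>
     (\<forall>x\<in>Pow {..<n}. \<forall>y\<in>Pow {..<n}. set_matrix U x y = junta_matrix A V x y)"
    (is "?l \<longleftrightarrow> ?r") for A V
  proof
    assume l: ?l
    show ?r
    proof (intro ballI)
      fix x y assume xy: "x \<in> Pow {..<n}" "y \<in> Pow {..<n}"
      then have e: "set_encode x < 2 ^ n" "set_encode y < 2 ^ n" "finite x" "finite y"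
        by (auto simp: set_encode_less finite_bits)
      show "set_matrix U x y = junta_matrix A V x y"
        using l e by (simp add: cond set_matrix_def junta_matrix_def restrict_idx_eq)
    qed
  next
    assume r: ?r
    show ?l
    proof (intro allI impI)
      fix x y :: nat assume xy: "x < 2 ^ n" "y < 2 ^ n"
      have "set_matrix U (set_decode x) (set_decode y) = junta_matrix A V (set_decode x) (set_decode y)"
        using r xy set_decode_subset by blast
      then show "U x y = (if (\<forall>j<n. j \<notin> A \<longrightarrow> (qbit x j \<longleftrightarrow> qbit y j)) then V (restrict_idx A x) (restrict_idx A y) else 0)"
        unfolding cond[OF xy] by (simp add: set_matrix_def junta_matrix_def restrict_idx_eq)
    qed
  qed
  then show ?thesis unfolding is_qjunta_def by simp
qed

lemma card_Pow_outside: "A \<subseteq> {..<n} \<Longrightarrow> (2::real) ^ card ({..<n} - A) * 2 ^ card A = 2 ^ n"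
  using card_Diff_subset[of A "{..<n}"] card_mono[of "{..<n}" A] finite_bits[of A n]
  by (simp flip: power_add)

text \<open>The normalised partial trace of a junta on \<open>A\<close> is the unitary
  \<open>V\<close> itself, so the weight inside \<open>A\<close> is already \<open>1\<close>. Since
  this is the total weight, nothing is left for Paulis reaching outside \<open>A\<close>.\<close>

lemma junta_pauli_coeff:
  assumes U: "is_unitary (2 ^ n) U" and "is_qjunta n k U"
  shows "\<exists>A\<subseteq>{..<n}. card A = k \<and>
    (\<forall>g\<in>pairs {..<n}. pauli_support g \<inter> ({..<n} - A) \<noteq> {} \<longrightarrow> pauli_coeff {..<n} (set_matrix U) g = 0)"
proof -
  let ?U = "set_matrix U"
  obtain A V where A: "A \<subseteq> {..<n}" "card A = k" and V: "is_unitary (2 ^ k) V"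
    and eq: "\<And>x y. x \<subseteq> {..<n} \<Longrightarrow> y \<subseteq> {..<n} \<Longrightarrow> ?U x y = junta_matrix A V x y"
    using assms(2) unfolding is_qjunta_iff by (auto simp: Ball_def)
  have finA: "finite A" using finite_bits[OF A(1)] .
  have pt: "partial_trace {..<n} A (?U) r s = V (subset_index A r) (subset_index A s)"
    if "r \<subseteq> A" "s \<subseteq> A" for r s
  proof -
    have "(\<Sum>z\<in>Pow ({..<n} - A). ?U (r \<union> z) (s \<union> z)) =
        (\<Sum>z\<in>Pow ({..<n} - A). V (subset_index A r) (subset_index A s))"
    proof (intro sum.cong refl)
      fix z assume z: "z \<in> Pow ({..<n} - A)"
      have "?U (r \<union> z) (s \<union> z) = junta_matrix A V (r \<union> z) (s \<union> z)"
        using that z A by (intro eq) auto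
      also have "\<dots> = V (subset_index A r) (subset_index A s)"
        using that z by (intro junta_matrix_blocks) auto
      finally show "?U (r \<union> z) (s \<union> z) = V (subset_index A r) (subset_index A s)" .
    qed
    then show ?thesis by (simp add: partial_trace_def card_Pow)
  qed
  have "(\<Sum>r\<in>Pow A. \<Sum>s\<in>Pow A. (cmod (partial_trace {..<n} A (?U) r s))\<^sup>2) =
      (\<Sum>r\<in>Pow A. \<Sum>s\<in>Pow A. (cmod (V (subset_index A r) (subset_index A s)))\<^sup>2)"
    by (intro sum.cong refl) (simp add: pt)
  also have "\<dots> = 2 ^ k"
    using unitary_frobenius[OF V] by (simp add: sum_subset_index[OF finA, unfolded A(2)])
  finally have "sum (pauli_weight n U) (pairs A) = 1"
    unfolding pauli_weight_inside[OF A(1)] using A(2) by simp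
  then have "(\<Sum>g\<in>{g\<in>pairs {..<n}. pauli_support g \<inter> ({..<n} - A) \<noteq> {}}. pauli_weight n U g) = 0"
    by (simp add: pauli_weight_split[OF U A(1)])
  then have "pauli_coeff {..<n} (?U) g = 0" if "g \<in> pairs {..<n}" "pauli_support g \<inter> ({..<n} - A) \<noteq> {}" for g
    using that by (subst (asm) sum_nonneg_eq_0_iff) (auto simp: pauli_weight_def)
  then show ?thesis using A by (intro exI[of _ A] conjI ballI impI) blast+
qed

section \<open>Partial traces and nearby juntas\<close>

lemma cmod_sum_square_le:
  assumes "finite Z"
  shows "(cmod (\<Sum>z\<in>Z. f z))\<^sup>2 \<le> real (card Z) * (\<Sum>z\<in>Z. (cmod (f z))\<^sup>2)"
proof -
  have "(cmod (\<Sum>z\<in>Z. f z))\<^sup>2 \<le> (\<Sum>z\<in>Z. cmod (f z))\<^sup>2"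
    by (intro power_mono norm_sum) simp
  also have "\<dots> \<le> (\<Sum>z\<in>Z. (cmod (f z))\<^sup>2) * real (card Z)"
    by (rule sum_squared_le_sum_of_squares)
  finally show ?thesis by (simp add: mult.commute)
qed

text \<open>The partial trace is an average over \<open>z\<close> of diagonal blocks of
  \<open>U\<close>. Each block is a compression of a unitary, hence a contraction, and
  Cauchy-Schwarz passes this on to the average.\<close>

lemma partial_trace_contraction:
  assumes U: "is_unitary (2 ^ n) U" and A: "A \<subseteq> {..<n}"
  shows "(\<Sum>r\<in>Pow A. (cmod (\<Sum>s\<in>Pow A. partial_trace {..<n} A (set_matrix U) r s * w s))\<^sup>2) \<le> (\<Sum>s\<in>Pow A. (cmod (w s))\<^sup>2)"
proof -
  let ?I = "{..<n}" and ?M = "set_matrix U"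
  let ?Z = "Pow (?I - A)"
  define c where "c = (2::real) ^ card (?I - A)"
  have c: "0 < c" "real (card ?Z) = c" by (simp_all add: c_def card_Pow)
  define g where "g z r = (\<Sum>s\<in>Pow A. ?M (r \<union> z) (s \<union> z) * w s)" for z r
  have finA: "finite A" using finite_bits[OF A] .
  have step: "(\<Sum>r\<in>Pow A. (cmod (g z r))\<^sup>2) \<le> (\<Sum>s\<in>Pow A. (cmod (w s))\<^sup>2)" if z: "z \<in> ?Z" for z
  proof -
    define v :: cvec where "v y = (if set_decode y - A = z then w (set_decode y \<inter> A) else 0)" for y
    have v: "v (set_encode (s \<union> z')) = (if z' = z then w s else 0)" if "s \<in> Pow A" "z' \<in> ?Z" for s z'
    proof -
      have "finite (s \<union> z')" using that A by (intro finite_bits[of _ n]) auto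
      moreover have "(s \<union> z') - A = z'" "(s \<union> z') \<inter> A = s" using that by auto
      ultimately show ?thesis by (simp only: v_def set_encode_inverse)
    qed
    have Uv: "mat_vec (2 ^ n) U v (set_encode x) = (\<Sum>s\<in>Pow A. ?M x (s \<union> z) * w s)" for x
    proof -
      have "mat_vec (2 ^ n) U v (set_encode x) = (\<Sum>s\<in>Pow A. \<Sum>z'\<in>?Z. ?M x (s \<union> z') * v (set_encode (s \<union> z')))"
        unfolding mat_vec_def sum_bits set_matrix_def by (rule sum_Pow_split) (use A in auto)
      also have "\<dots> = (\<Sum>s\<in>Pow A. \<Sum>z'\<in>?Z. if z' = z then ?M x (s \<union> z') * w s else 0)"
        by (intro sum.cong refl) (simp add: v)
      also have "\<dots> = (\<Sum>s\<in>Pow A. ?M x (s \<union> z) * w s)"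
        using z by (intro sum.cong refl) (simp add: sum.delta)
      finally show ?thesis .
    qed
    have "(\<Sum>r\<in>Pow A. (cmod (g z r))\<^sup>2) \<le> (\<Sum>r\<in>Pow A. \<Sum>z'\<in>?Z. (cmod (mat_vec (2 ^ n) U v (set_encode (r \<union> z'))))\<^sup>2)"
    proof (intro sum_mono)
      fix r assume "r \<in> Pow A"
      have "(cmod (g z r))\<^sup>2 = (cmod (mat_vec (2 ^ n) U v (set_encode (r \<union> z))))\<^sup>2"
        by (simp add: Uv g_def)
      also have "\<dots> \<le> (\<Sum>z'\<in>?Z. (cmod (mat_vec (2 ^ n) U v (set_encode (r \<union> z'))))\<^sup>2)"
        using z by (intro member_le_sum) auto
      finally show "(cmod (g z r))\<^sup>2 \<le> \<dots>" .
    qed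
    also have "\<dots> = nsq (2 ^ n) (mat_vec (2 ^ n) U v)"
      unfolding nsq_def sum_bits by (rule sum_Pow_split[symmetric]) (use A in auto)
    also have "\<dots> = nsq (2 ^ n) v" by (rule unitary_nsq[OF U])
    also have "\<dots> = (\<Sum>s\<in>Pow A. \<Sum>z'\<in>?Z. (cmod (v (set_encode (s \<union> z'))))\<^sup>2)"
      unfolding nsq_def sum_bits by (rule sum_Pow_split) (use A in auto)
    also have "\<dots> = (\<Sum>s\<in>Pow A. \<Sum>z'\<in>?Z. if z' = z then (cmod (w s))\<^sup>2 else 0)"
      by (intro sum.cong refl) (simp add: v)
    also have "\<dots> = (\<Sum>s\<in>Pow A. (cmod (w s))\<^sup>2)"
      using z by (intro sum.cong refl) (simp add: sum.delta)
    finally show ?thesis .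
  qed
  have "(\<Sum>s\<in>Pow A. partial_trace ?I A ?M r s * w s) = (\<Sum>z\<in>?Z. g z r) / of_real c" for r
  proof -
    have "(\<Sum>s\<in>Pow A. partial_trace ?I A ?M r s * w s) = (\<Sum>s\<in>Pow A. \<Sum>z\<in>?Z. ?M (r \<union> z) (s \<union> z) * w s) / of_real c"
      by (simp add: partial_trace_def c_def sum_distrib_right sum_divide_distrib)
    also have "(\<Sum>s\<in>Pow A. \<Sum>z\<in>?Z. ?M (r \<union> z) (s \<union> z) * w s) = (\<Sum>z\<in>?Z. g z r)"
      unfolding g_def by (rule sum.swap)
    finally show ?thesis .
  qed
  then have "(\<Sum>r\<in>Pow A. (cmod (\<Sum>s\<in>Pow A. partial_trace ?I A ?M r s * w s))\<^sup>2) = (\<Sum>r\<in>Pow A. (cmod (\<Sum>z\<in>?Z. g z r))\<^sup>2 / c\<^sup>2)"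
    using c by (simp add: norm_divide power_divide)
  also have "\<dots> \<le> (\<Sum>r\<in>Pow A. (\<Sum>z\<in>?Z. (cmod (g z r))\<^sup>2) / c)"
  proof (intro sum_mono)
    fix r
    have "(cmod (\<Sum>z\<in>?Z. g z r))\<^sup>2 \<le> c * (\<Sum>z\<in>?Z. (cmod (g z r))\<^sup>2)"
      using cmod_sum_square_le[of ?Z "\<lambda>z. g z r"] c(2) by simp
    then have "(cmod (\<Sum>z\<in>?Z. g z r))\<^sup>2 / c\<^sup>2 \<le> c * (\<Sum>z\<in>?Z. (cmod (g z r))\<^sup>2) / c\<^sup>2"
      by (rule divide_right_mono) simp
    then show "(cmod (\<Sum>z\<in>?Z. g z r))\<^sup>2 / c\<^sup>2 \<le> (\<Sum>z\<in>?Z. (cmod (g z r))\<^sup>2) / c"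
      using c by (simp add: power2_eq_square)
  qed
  also have "\<dots> = (\<Sum>z\<in>?Z. \<Sum>r\<in>Pow A. (cmod (g z r))\<^sup>2) / c"
    by (subst sum.swap) (simp add: sum_divide_distrib)
  also have "\<dots> \<le> (\<Sum>z\<in>?Z. \<Sum>s\<in>Pow A. (cmod (w s))\<^sup>2) / c"
    using c by (intro divide_right_mono sum_mono step) auto
  also have "\<dots> = (\<Sum>s\<in>Pow A. (cmod (w s))\<^sup>2)"
    using c by simp
  finally show ?thesis .
qed

definition far_from_juntas :: "nat \<Rightarrow> nat \<Rightarrow> real \<Rightarrow> cmat \<Rightarrow> bool" where
  "far_from_juntas n k \<epsilon> U \<longleftrightarrow> (\<forall>V. is_qjunta n k V \<longrightarrow> \<epsilon> \<le> qdist n U V)"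

text \<open>A junta is built on \<open>A\<close> from the unitary \<open>V\<close> that
  \<open>contraction_near_unitary\<close> assigns to the partial trace \<open>M\<close>. Expanding
  its squared distance from \<open>U\<close> gives \<open>1\<close> minus the normalised
  \<open>Re (tr (V\<^sup>* M))\<close>, and that trace is at least the squared Frobenius norm of
  \<open>M\<close>, the weight inside \<open>A\<close>.\<close>

lemma far_pauli_weight:
  assumes U: "is_unitary (2 ^ n) U" and A: "A \<subseteq> {..<n}" "card A = k" and \<epsilon>: "0 < \<epsilon>"
    and far: "far_from_juntas n k \<epsilon> U"
  shows "\<epsilon>\<^sup>2 \<le> 1 - sum (pauli_weight n U) (pairs A)"
proof -
  let ?I = "{..<n}"
  define pt where "pt = partial_trace ?I A (set_matrix U)"
  define \<rho> where "\<rho> = the_inv_into (Pow A) (subset_index A)"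
  have finA: "finite A" using finite_bits[OF A(1)] .
  have \<rho>: "\<rho> (subset_index A R) = R" if "R \<subseteq> A" for R
    unfolding \<rho>_def using subset_index_bij[OF finA] that by (intro the_inv_into_f_f) (auto simp: bij_betw_def)
  define M :: cmat where "M i j = pt (\<rho> i) (\<rho> j)" for i j
  note sums = sum_subset_index[OF finA, unfolded A(2)]
  have "nsq (2 ^ k) (mat_vec (2 ^ k) M v) \<le> nsq (2 ^ k) v" for v
  proof -
    have "nsq (2 ^ k) (mat_vec (2 ^ k) M v) = (\<Sum>r\<in>Pow A. (cmod (\<Sum>s\<in>Pow A. pt r s * v (subset_index A s)))\<^sup>2)"
      unfolding nsq_def mat_vec_def sums M_def by (intro sum.cong refl arg_cong[of _ _ "\<lambda>z. (cmod z)\<^sup>2"]) (simp add: \<rho>)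
    also have "\<dots> \<le> (\<Sum>s\<in>Pow A. (cmod (v (subset_index A s)))\<^sup>2)"
      unfolding pt_def by (rule partial_trace_contraction[OF U A(1)])
    finally show ?thesis by (simp add: nsq_def sums)
  qed
  then obtain V where V: "is_unitary (2 ^ k) V"
    and VM: "(\<Sum>i<2 ^ k. \<Sum>j<2 ^ k. (cmod (M i j))\<^sup>2) \<le> Re (\<Sum>i<2 ^ k. \<Sum>j<2 ^ k. cnj (V i j) * M i j)"
    using contraction_near_unitary[of "2 ^ k" M] by blast
  let ?U = "set_matrix U" and ?J = "junta_matrix A V" and ?\<iota> = "subset_index A"
  let ?VM = "\<Sum>i<2 ^ k. \<Sum>j<2 ^ k. cnj (V i j) * M i j"
  let ?dist = "\<Sum>x\<in>Pow ?I. \<Sum>y\<in>Pow ?I. (cmod (?U x y - ?J x y))\<^sup>2"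
  define J :: cmat where "J x y = ?J (set_decode x) (set_decode y)" for x y
  have J: "set_matrix J x y = ?J x y" if "x \<in> Pow ?I" "y \<in> Pow ?I" for x y
    using that by (simp add: set_matrix_def J_def finite_bits)
  then have "is_qjunta n k J" unfolding is_qjunta_iff using A V by blast
  then have "\<epsilon> \<le> qdist n U J" using far by (simp add: far_from_juntas_def)
  \<comment> \<open>No phase needs optimising: \<open>V\<close> was free to absorb it, so
    \<open>\<theta> = 0\<close> gives a sufficient bound on the infimum.\<close>
  also have "\<dots> \<le> frob_norm (2 ^ n) (\<lambda>i j. cis 0 * U i j - J i j) / sqrt (2 * 2 ^ n)"
    unfolding qdist_def
    by (rule cINF_lower) (auto simp: frob_norm_def intro!: bdd_belowI2[where m = 0] divide_nonneg_nonneg sum_nonneg)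
  finally have "\<epsilon> \<le> sqrt (?dist / (2 * 2 ^ n))"
    by (simp add: frob_norm_def sum_bits real_sqrt_divide J flip: set_matrix_def)
  then have "\<epsilon>\<^sup>2 \<le> (sqrt (?dist / (2 * 2 ^ n)))\<^sup>2"
    using \<epsilon> by (intro power_mono) auto
  also have "\<dots> = ?dist / (2 * 2 ^ n)"
    by (intro real_sqrt_pow2 divide_nonneg_nonneg sum_nonneg) auto
  also have "?dist =
      (\<Sum>x\<in>Pow ?I. \<Sum>y\<in>Pow ?I. (cmod (?U x y))\<^sup>2)
      + (\<Sum>x\<in>Pow ?I. \<Sum>y\<in>Pow ?I. (cmod (?J x y))\<^sup>2)
      - 2 * Re (\<Sum>x\<in>Pow ?I. \<Sum>y\<in>Pow ?I. cnj (?J x y) * ?U x y)"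
  proof -
    have "(cmod (a - b))\<^sup>2 = (cmod a)\<^sup>2 + (cmod b)\<^sup>2 - 2 * Re (cnj b * a)" for a b
      unfolding cmod_power2 by (simp add: power2_eq_square algebra_simps)
    then show ?thesis
      by (simp add: sum_subtractf sum.distrib sum_distrib_left)
  qed
  also have "(\<Sum>x\<in>Pow ?I. \<Sum>y\<in>Pow ?I. (cmod (?U x y))\<^sup>2) = 2 ^ n"
    using unitary_frobenius[OF U] by (simp add: sum_bits set_matrix_def)
  also have "(\<Sum>x\<in>Pow ?I. \<Sum>y\<in>Pow ?I. (cmod (?J x y))\<^sup>2) = 2 ^ n"
  proof -
    have "(\<Sum>x\<in>Pow ?I. \<Sum>y\<in>Pow ?I. (cmod (?J x y))\<^sup>2)
        = (\<Sum>x\<in>Pow ?I. \<Sum>y\<in>Pow ?I. if x - A = y - A then (cmod (?J x y))\<^sup>2 else 0)"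
      by (intro sum.cong refl) (simp add: junta_matrix_def)
    also have "\<dots> = (\<Sum>r\<in>Pow A. \<Sum>s\<in>Pow A. \<Sum>z\<in>Pow (?I - A). (cmod (?J (r \<union> z) (s \<union> z)))\<^sup>2)"
      by (rule sum_blocks) (use A in auto)
    also have "\<dots> = (\<Sum>r\<in>Pow A. \<Sum>s\<in>Pow A. \<Sum>z\<in>Pow (?I - A). (cmod (V (?\<iota> r) (?\<iota> s)))\<^sup>2)"
      by (intro sum.cong refl, subst junta_matrix_blocks) auto
    also have "\<dots> = 2 ^ card (?I - A) * (\<Sum>r\<in>Pow A. \<Sum>s\<in>Pow A. (cmod (V (?\<iota> r) (?\<iota> s)))\<^sup>2)"
      by (simp add: card_Pow sum_distrib_left)
    also have "\<dots> = 2 ^ n"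
      using unitary_frobenius[OF V] card_Pow_outside[OF A(1)] by (simp add: sums A(2))
    finally show ?thesis .
  qed
  also have "(\<Sum>x\<in>Pow ?I. \<Sum>y\<in>Pow ?I. cnj (?J x y) * ?U x y)
      = 2 ^ card (?I - A) * ?VM"
  proof -
    have "(\<Sum>x\<in>Pow ?I. \<Sum>y\<in>Pow ?I. cnj (?J x y) * ?U x y)
        = (\<Sum>x\<in>Pow ?I. \<Sum>y\<in>Pow ?I. if x - A = y - A then cnj (?J x y) * ?U x y else 0)"
      by (intro sum.cong refl) (simp add: junta_matrix_def)
    also have "\<dots> = (\<Sum>r\<in>Pow A. \<Sum>s\<in>Pow A. \<Sum>z\<in>Pow (?I - A). cnj (?J (r \<union> z) (s \<union> z)) * ?U (r \<union> z) (s \<union> z))"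
      by (rule sum_blocks) (use A in auto)
    also have "\<dots> = (\<Sum>r\<in>Pow A. \<Sum>s\<in>Pow A. \<Sum>z\<in>Pow (?I - A). cnj (V (?\<iota> r) (?\<iota> s)) * ?U (r \<union> z) (s \<union> z))"
      by (intro sum.cong refl, subst junta_matrix_blocks) auto
    also have "\<dots> = (\<Sum>r\<in>Pow A. \<Sum>s\<in>Pow A. 2 ^ card (?I - A) * (cnj (V (?\<iota> r) (?\<iota> s)) * pt r s))"
      by (intro sum.cong refl) (simp add: pt_def partial_trace_def flip: sum_distrib_left)
    also have "\<dots> = (\<Sum>r\<in>Pow A. \<Sum>s\<in>Pow A. 2 ^ card (?I - A) * (cnj (V (?\<iota> r) (?\<iota> s)) * M (?\<iota> r) (?\<iota> s)))"
      by (intro sum.cong refl) (simp add: M_def \<rho>)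
    finally show ?thesis by (simp add: sums sum_distrib_left)
  qed
  also have "Re (2 ^ card (?I - A) * ?VM)
      = 2 ^ card (?I - A) * Re ?VM"
  proof -
    have "(2::complex) ^ card (?I - A) = of_real (2 ^ card (?I - A))" by simp
    then show ?thesis by (simp only: Re_complex_of_real times_complex.sel Im_complex_of_real mult_zero_left diff_zero)
  qed
  finally have *: "\<epsilon>\<^sup>2 \<le> (2 ^ n + 2 ^ n - 2 * (2 ^ card (?I - A) * Re ?VM)) / (2 * 2 ^ n)" .
  have "sum (pauli_weight n U) (pairs A) = (\<Sum>i<2 ^ k. \<Sum>j<2 ^ k. (cmod (M i j))\<^sup>2) / 2 ^ k"
    unfolding pauli_weight_inside[OF A(1)] sums A(2) M_def pt_def[symmetric]
    by (intro arg_cong[of _ _ "\<lambda>z. z / _"] sum.cong refl) (simp add: \<rho>)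
  then have "2 ^ n * sum (pauli_weight n U) (pairs A) = 2 ^ card (?I - A) * (\<Sum>i<2 ^ k. \<Sum>j<2 ^ k. (cmod (M i j))\<^sup>2)"
    by (simp add: A(2) flip: card_Pow_outside[OF A(1)])
  also have "\<dots> \<le> 2 ^ card (?I - A) * Re ?VM"
    using VM by (intro mult_left_mono) auto
  finally have "(2 ^ n + 2 ^ n - 2 * (2 ^ card (?I - A) * Re ?VM)) / (2 * 2 ^ n)
      \<le> (2 ^ n + 2 ^ n - 2 * (2 ^ n * sum (pauli_weight n U) (pairs A))) / (2 * 2 ^ n)"
    by (intro divide_right_mono) auto
  also have "\<dots> = 1 - sum (pauli_weight n U) (pairs A)" by (simp add: field_simps)
  finally show ?thesis using * by linarith
qed

section \<open>Amplitudes of the witnesses\<close>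

lemma sum_Pow_card:
  fixes \<phi> :: "nat \<Rightarrow> real"
  assumes "finite X"
  shows "(\<Sum>T\<in>Pow X. if T \<noteq> {} \<and> Q T then \<phi> (card T) else 0) =
    (\<Sum>s\<in>{1..card X}. \<phi> s * real (card {T. T \<subseteq> X \<and> card T = s \<and> Q T}))"
proof -
  let ?D = "{T\<in>Pow X. T \<noteq> {} \<and> Q T}"
  have "(\<Sum>T\<in>Pow X. if T \<noteq> {} \<and> Q T then \<phi> (card T) else 0) = (\<Sum>T\<in>?D. \<phi> (card T))"
    by (rule sum.inter_filter[symmetric]) (simp add: assms)
  also have "\<dots> = (\<Sum>s\<in>{1..card X}. \<Sum>T\<in>{T\<in>?D. card T = s}. \<phi> (card T))"
  proof (rule sum.group[symmetric])
    show "card ` ?D \<subseteq> {1..card X}"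
      using assms finite_subset[OF _ assms] by (auto simp: card_mono Suc_le_eq card_gt_0_iff)
  qed (use assms in auto)
  also have "\<dots> = (\<Sum>s\<in>{1..card X}. \<phi> s * real (card {T. T \<subseteq> X \<and> card T = s \<and> Q T}))"
  proof (intro sum.cong refl)
    fix s assume "s \<in> {1..card X}"
    then have "{T\<in>?D. card T = s} = {T. T \<subseteq> X \<and> card T = s \<and> Q T}" by auto
    then have "(\<Sum>T\<in>{T\<in>?D. card T = s}. \<phi> (card T)) = (\<Sum>T\<in>{T. T \<subseteq> X \<and> card T = s \<and> Q T}. \<phi> s)"
      by (intro sum.cong) auto
    then show "(\<Sum>T\<in>{T\<in>?D. card T = s}. \<phi> (card T)) = \<phi> s * real (card {T. T \<subseteq> X \<and> card T = s \<and> Q T})"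
      by simp
  qed
  finally show ?thesis .
qed

lemma sum_level_Pow:
  fixes \<phi> :: "nat \<Rightarrow> real"
  assumes "finite X"
  shows "(\<Sum>T\<in>Pow X. if T \<noteq> {} then \<phi> (card T) / real (card X choose card T) else 0) = (\<Sum>s\<in>{1..card X}. \<phi> s)"
proof -
  have "(\<Sum>T\<in>Pow X. if T \<noteq> {} then \<phi> (card T) / real (card X choose card T) else 0)
      = (\<Sum>s\<in>{1..card X}. \<phi> s / real (card X choose s) * real (card {T. T \<subseteq> X \<and> card T = s}))"
    using sum_Pow_card[OF assms, of "\<lambda>_. True" "\<lambda>s. \<phi> s / real (card X choose s)"] by simp
  also have "\<dots> = (\<Sum>s\<in>{1..card X}. \<phi> s)"
    using assms by (intro sum.cong refl) (simp add: n_subsets)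
  finally show ?thesis .
qed

text \<open>With \<open>B\<close> drawn from \<open>p\<close>: the probability that \<open>T\<close> contains exactly one element of \<open>B\<close> and that this
  element comes last in a random order of \<open>T\<close>.\<close>

definition last_hit :: "nat \<Rightarrow> (nat set \<Rightarrow> real) \<Rightarrow> nat set \<Rightarrow> real" where
  "last_hit n p T = (\<Sum>B\<in>Pow {..<n}. if card (T \<inter> B) = 1 then p B else 0) / real (card T)"

locale hit_distribution =
  fixes n k d :: nat and p :: "nat set \<Rightarrow> real"
  assumes kn: "k < n" and d: "1 \<le> d" "k + d \<le> n"
    and p: "subset_distribution {..<n} (k + d) p"
begin

lemmas p_nonneg = subset_distributionD(1)[OF p] and p_supp = subset_distributionD(2)[OF p]
  and p_sum = subset_distributionD(3)[OF p]

lemma last_hit_nonneg: "0 \<le> last_hit n p T"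
  unfolding last_hit_def by (intro divide_nonneg_nonneg sum_nonneg) (auto simp: p_nonneg)

lemma sum_last_hit:
  "(\<Sum>T\<in>Pow X. \<phi> (card T) * last_hit n p T) =
    (\<Sum>B\<in>Pow {..<n}. p B * (\<Sum>T\<in>Pow X. if T \<noteq> {} \<and> card (T \<inter> B) = 1 then \<phi> (card T) / real (card T) else 0))"
proof -
  let ?h = "\<lambda>T B. if T \<noteq> {} \<and> card (T \<inter> B) = 1 then \<phi> (card T) / real (card T) else 0"
  have "(\<Sum>T\<in>Pow X. \<phi> (card T) * last_hit n p T) =
    (\<Sum>T\<in>Pow X. \<Sum>B\<in>Pow {..<n}. p B * ?h T B)"
    unfolding last_hit_def sum_divide_distrib sum_distrib_left by (intro sum.cong refl) auto
  also have "\<dots> = (\<Sum>B\<in>Pow {..<n}. \<Sum>T\<in>Pow X. p B * ?h T B)"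
    by (rule sum.swap)
  finally show ?thesis by (simp only: sum_distrib_left)
qed

text \<open>In a random order of the complement of \<open>A\<close>, the first \<open>s\<close>
  elements form a given \<open>s\<close>-set with probability \<open>1 / ((n - k) choose s)\<close>.
  The sum is thus the probability of ever hitting \<open>B\<close>, which is one as \<open>B\<close>
  has more elements than \<open>A\<close>.\<close>

lemma last_hit_outside:
  assumes A: "A \<subseteq> {..<n}" "card A = k"
  shows "(\<Sum>T\<in>Pow ({..<n} - A). last_hit n p T / real ((n - k) choose card T)) = 1"
proof -
  let ?X = "{..<n} - A"
  let ?S = "\<lambda>B. \<Sum>T\<in>Pow ?X. if T \<noteq> {} \<and> card (T \<inter> B) = 1 then 1 / real ((n - k) choose card T) / real (card T) else 0"
  let ?C = "\<lambda>s B. {T. T \<subseteq> ?X \<and> card T = s \<and> card (T \<inter> B) = 1}"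
  have cX: "card ?X = n - k" using A by (simp add: card_Diff_subset finite_subset)
  have "(\<Sum>T\<in>Pow ?X. last_hit n p T / real ((n - k) choose card T)) =
     (\<Sum>T\<in>Pow ?X. 1 / real ((n - k) choose card T) * last_hit n p T)" by simp
  also have "\<dots> = (\<Sum>B\<in>Pow {..<n}. p B * ?S B)"
    by (rule sum_last_hit[where \<phi> = "\<lambda>s. 1 / real ((n - k) choose s)"])
  also have "\<dots> = (\<Sum>B\<in>Pow {..<n}. p B * 1)"
  proof (intro sum.cong refl)
    fix B assume "B \<in> Pow {..<n}"
    show "p B * ?S B = p B * 1"
    proof (cases "p B = 0")
      case False
      then have B: "B \<subseteq> {..<n}" "card B = k + d" using p_supp by auto
      have finA: "finite A" "finite B" using A B finite_subset by blast+
      have b: "1 \<le> card (B - A)" "card (B - A) \<le> n - k"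
        using diff_card_le_card_Diff[OF finA(1), of B] d A B card_mono[of ?X "B - A"] cX by auto
      have "?S B
          = (\<Sum>s\<in>{1..n - k}. 1 / real ((n - k) choose s) / real s * real (card (?C s B)))"
        using sum_Pow_card[of ?X "\<lambda>T. card (T \<inter> B) = 1" "\<lambda>s. 1 / real ((n - k) choose s) / real s"] cX by simp
      also have "\<dots> = (\<Sum>s\<in>{1..n - k}. first_hit (n - k) (card (B - A)) s)"
      proof (intro sum.cong refl)
        fix s assume s: "s \<in> {1..n - k}"
        have "T \<inter> B = T \<inter> (B - A)" if "T \<subseteq> ?X" for T using that by auto
        then have "?C s B = ?C s (B - A)"
          by (metis (no_types, lifting))
        then have "card (?C s B) = card (B - A) * ((n - k - card (B - A)) choose (s - 1))"
          using card_one_hit[of ?X "B - A" s] s B cX by auto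
        then show "1 / real ((n - k) choose s) / real s * real (card (?C s B)) = first_hit (n - k) (card (B - A)) s"
          by (simp add: first_hit_def mult.commute)
      qed
      also have "\<dots> = 1" by (rule first_hit_sum[OF b])
      finally show ?thesis by simp
    qed simp
  qed
  finally show ?thesis using p_sum by simp
qed

text \<open>The negative witness cannot know \<open>A\<close>, so \<open>T\<close> ranges over all
  sets and not only those outside \<open>A\<close>. This costs exactly
  \<open>(k + d) / d\<close>.\<close>

lemma last_hit_weighted:
  assumes k: "1 \<le> k" "d \<le> k"
  shows "(\<Sum>T\<in>Pow {..<n}. if card T \<le> n - k then
      last_hit n p T / (real (card T) * level_weight (n - k) k (card T) * real ((n - k) choose card T)) else 0) \<le> 3 * real (k + d) / real d"
proof -
  define \<phi> where "\<phi> s = (if s \<le> n - k then 1 / (real s * level_weight (n - k) k s * real ((n - k) choose s)) else 0)" for s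
  let ?S = "\<lambda>B. \<Sum>T\<in>Pow {..<n}. if T \<noteq> {} \<and> card (T \<inter> B) = 1 then \<phi> (card T) / real (card T) else 0"
  let ?C = "\<lambda>s B. {T. T \<subseteq> {..<n} \<and> card T = s \<and> card (T \<inter> B) = 1}"
  have "(\<Sum>T\<in>Pow {..<n}. if card T \<le> n - k then
      last_hit n p T / (real (card T) * level_weight (n - k) k (card T) * real ((n - k) choose card T)) else 0)
      = (\<Sum>T\<in>Pow {..<n}. \<phi> (card T) * last_hit n p T)"
    by (intro sum.cong refl) (simp add: \<phi>_def)
  also have "\<dots> = (\<Sum>B\<in>Pow {..<n}. p B * ?S B)"
    by (rule sum_last_hit)
  also have "\<dots> \<le> (\<Sum>B\<in>Pow {..<n}. p B * (3 * real (k + d) / real d))"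
  proof (intro sum_mono)
    fix B assume "B \<in> Pow {..<n}"
    show "p B * ?S B \<le> p B * (3 * real (k + d) / real d)"
    proof (cases "p B = 0")
      case False
      then have B: "B \<subseteq> {..<n}" "card B = k + d" using p_supp by auto
      have "?S B
          = (\<Sum>s\<in>{1..n}. \<phi> s / real s * real (card (?C s B)))"
        using sum_Pow_card[of "{..<n}" "\<lambda>T. card (T \<inter> B) = 1" "\<lambda>s. \<phi> s / real s"] by simp
      also have "\<dots> = (\<Sum>s\<in>{1..n - k}. \<phi> s / real s * real (card (?C s B)))"
        by (rule sum.mono_neutral_right) (auto simp: \<phi>_def)
      also have "\<dots> = (\<Sum>s\<in>{1..n - k}. real (k + d) / real d * (first_hit (n - k) d s / (level_weight (n - k) k s * real s)))"
      proof (intro sum.cong refl)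
        fix s assume s: "s \<in> {1..n - k}"
        \<comment> \<open>Because \<open>n - (k + d) = (n - k) - d\<close>, the count is that of a
          ground set of size \<open>n - k\<close> with \<open>d\<close> marked elements, times
          \<open>(k + d) / d\<close>.\<close>
        have "card (?C s B) = (k + d) * ((n - k - d) choose (s - 1))"
          using card_one_hit[of "{..<n}" B s] s B by auto
        then show "\<phi> s / real s * real (card (?C s B))
            = real (k + d) / real d * (first_hit (n - k) d s / (level_weight (n - k) k s * real s))"
          using s d by (simp add: \<phi>_def first_hit_def)
      qed
      also have "\<dots> = real (k + d) / real d * (\<Sum>s\<in>{1..n - k}. first_hit (n - k) d s / (level_weight (n - k) k s * real s))"
        by (rule sum_distrib_left[symmetric])
      also have "\<dots> \<le> real (k + d) / real d * 3"
        using level_weight_hit_sum[of k d "n - k"] k d by (intro mult_left_mono) auto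
      finally show ?thesis using p_nonneg by (intro mult_left_mono) (auto simp: mult.commute)
    qed simp
  qed
  also have "\<dots> = 3 * real (k + d) / real d"
    unfolding sum_distrib_right[symmetric] p_sum by simp
  finally show ?thesis .
qed

end

definition accept_amplitude :: "nat \<Rightarrow> nat \<Rightarrow> real \<Rightarrow> nat set \<Rightarrow> nat set \<Rightarrow> real" where
  "accept_amplitude n k r A T = (if T \<noteq> {} \<and> T \<subseteq> {..<n} - A
    then sqrt (r * level_weight (n - k) k (card T) / real ((n - k) choose card T)) else 0)"

text \<open>Chosen so that the product with the accept amplitude of any \<open>A\<close> is
  \<open>last_hit / ((n - k) choose card T)\<close> on sets outside \<open>A\<close>, free of
  \<open>r\<close> and the level weights. Sets with more than \<open>n - k\<close> elements meet
  every \<open>A\<close> and are dropped.\<close>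

definition reject_amplitude :: "nat \<Rightarrow> nat \<Rightarrow> real \<Rightarrow> (nat set \<Rightarrow> real) \<Rightarrow> nat set \<Rightarrow> real" where
  "reject_amplitude n k r p T = (if T \<noteq> {} \<and> card T \<le> n - k
    then last_hit n p T / sqrt (r * level_weight (n - k) k (card T) * real ((n - k) choose card T)) else 0)"

lemma accept_amplitude_norm:
  assumes A: "A \<subseteq> {..<n}" "card A = k" and k: "1 \<le> k" "k < n" and r: "0 < r"
  shows "(\<Sum>T\<in>Pow {..<n}. (accept_amplitude n k r A T)\<^sup>2) \<le> 8 * r * ln (real k + 1)"
proof -
  let ?X = "{..<n} - A"
  have cX: "card ?X = n - k" using A by (simp add: card_Diff_subset finite_subset)
  have "(\<Sum>T\<in>Pow {..<n}. (accept_amplitude n k r A T)\<^sup>2) = (\<Sum>T\<in>Pow ?X. (accept_amplitude n k r A T)\<^sup>2)"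
    by (rule sum.mono_neutral_right) (auto simp: accept_amplitude_def)
  also have "\<dots> = (\<Sum>T\<in>Pow ?X. if T \<noteq> {} then r * level_weight (n - k) k (card T) / real ((n - k) choose card T) else 0)"
    using r by (intro sum.cong refl) (auto simp: accept_amplitude_def level_weight_def)
  also have "\<dots> = (\<Sum>s\<in>{1..n - k}. r * level_weight (n - k) k s)"
    using sum_level_Pow[of ?X "\<lambda>s. r * level_weight (n - k) k s"] unfolding cX by simp
  also have "\<dots> = r * (\<Sum>s\<in>{1..n - k}. level_weight (n - k) k s)" by (rule sum_distrib_left[symmetric])
  also have "\<dots> \<le> r * (8 * ln (real k + 1))"
    using level_weight_sum[of k "n - k"] k r by (intro mult_left_mono) auto
  finally show ?thesis by simp
qed

lemma (in hit_distribution) amplitude_product: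
  assumes A: "A \<subseteq> {..<n}" "card A = k" and k: "1 \<le> k" and r: "0 < r"
  shows "(\<Sum>T\<in>Pow {..<n}. accept_amplitude n k r A T * reject_amplitude n k r p T) = 1"
proof -
  let ?X = "{..<n} - A"
  have cX: "card ?X = n - k" using A by (simp add: card_Diff_subset finite_subset)
  have "(\<Sum>T\<in>Pow {..<n}. accept_amplitude n k r A T * reject_amplitude n k r p T) =
      (\<Sum>T\<in>Pow ?X. accept_amplitude n k r A T * reject_amplitude n k r p T)"
    by (rule sum.mono_neutral_right) (auto simp: accept_amplitude_def)
  also have "\<dots> = (\<Sum>T\<in>Pow ?X. last_hit n p T / real ((n - k) choose card T))"
  proof (intro sum.cong refl)
    fix T assume T: "T \<in> Pow ?X"
    show "accept_amplitude n k r A T * reject_amplitude n k r p T = last_hit n p T / real ((n - k) choose card T)"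
    proof (cases "T = {}")
      case False
      have "finite T" using T finite_subset by blast
      then have c: "1 \<le> card T" "card T \<le> n - k"
        using False T card_mono[of ?X T] cX by (auto simp: Suc_le_eq card_gt_0_iff)
      define x where "x = r * level_weight (n - k) k (card T)"
      define y where "y = real ((n - k) choose card T)"
      have xy: "0 < x" "0 < y"
        using c r k level_weight_pos[of k "card T" "n - k"] by (auto simp: x_def y_def zero_less_binomial_iff)
      have "sqrt (x / y) * (last_hit n p T / sqrt (x * y)) = last_hit n p T / y"
        using xy by (simp add: real_sqrt_divide real_sqrt_mult)
      then show ?thesis
        using False T c by (simp add: accept_amplitude_def reject_amplitude_def x_def y_def)
    qed (simp add: accept_amplitude_def last_hit_def)
  qed
  also have "\<dots> = 1" by (rule last_hit_outside[OF A])
  finally show ?thesis .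
qed

text \<open>A last hit is a hit, and by symmetry each of the \<open>card T\<close> elements is
  equally likely to come last, so \<open>\<tau> * card T * last_hit\<close> is at most
  \<open>C T\<close>. This cancels one of the two factors \<open>last_hit\<close> and leaves the
  linear sum of \<open>last_hit_weighted\<close>.\<close>

lemma (in hit_distribution) reject_amplitude_norm:
  assumes k: "1 \<le> k" "d \<le> k" and r: "0 < r" and \<tau>: "0 < \<tau>"
    and cov: "\<And>T. T \<subseteq> {..<n} \<Longrightarrow> \<tau> * hit_prob {..<n} p T \<le> C T"
  shows "(\<Sum>T\<in>Pow {..<n}. (reject_amplitude n k r p T)\<^sup>2 / C T) \<le> 3 * real (k + d) / (real d * \<tau> * r)"
    and "T \<subseteq> {..<n} \<Longrightarrow> C T = 0 \<Longrightarrow> reject_amplitude n k r p T = 0"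
proof -
  let ?g = "\<lambda>T. if card T \<le> n - k then
      last_hit n p T / (real (card T) * level_weight (n - k) k (card T) * real ((n - k) choose card T)) else 0"
  have hit: "\<tau> * (real (card T) * last_hit n p T) \<le> C T" if "T \<subseteq> {..<n}" for T
  proof -
    have "real (card T) * last_hit n p T \<le> (\<Sum>B\<in>Pow {..<n}. if card (T \<inter> B) = 1 then p B else 0)"
      using p_nonneg by (cases "card T = 0") (auto simp: last_hit_def intro!: sum_nonneg)
    also have "\<dots> \<le> (\<Sum>B\<in>Pow {..<n}. if B \<inter> T \<noteq> {} then p B else 0)"
      using p_nonneg by (intro sum_mono) (auto simp: Int_commute)
    also have "\<dots> = hit_prob {..<n} p T"
      unfolding hit_prob_def by (rule sum.inter_filter[symmetric]) simp
    finally show ?thesis using cov[OF that] \<tau> by (meson mult_left_mono less_imp_le order_trans)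
  qed
  show "reject_amplitude n k r p T = 0" if "T \<subseteq> {..<n}" "C T = 0" for T
  proof (cases "T = {}")
    case False
    then have "0 < card T" using that(1) finite_subset by (auto simp: card_gt_0_iff)
    moreover have "\<tau> * (real (card T) * last_hit n p T) \<le> 0" using hit[OF that(1)] that(2) by simp
    ultimately have "last_hit n p T \<le> 0" using \<tau> by (simp add: mult_le_0_iff)
    then show ?thesis using last_hit_nonneg[of T] by (simp add: reject_amplitude_def)
  qed (simp add: reject_amplitude_def)
  have "(reject_amplitude n k r p T)\<^sup>2 / C T \<le> 1 / (\<tau> * r) * ?g T"
    if T: "T \<subseteq> {..<n}" for T
  proof (cases "T \<noteq> {} \<and> card T \<le> n - k")
    case True
    have "finite T" using T finite_subset by blast
    then have c: "0 < card T" using True by (simp add: card_gt_0_iff)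
    define x where "x = level_weight (n - k) k (card T) * real ((n - k) choose card T)"
    have x: "0 < x" using True c k level_weight_pos[of k "card T" "n - k"] by (simp add: x_def zero_less_binomial_iff)
    define l where "l = last_hit n p T"
    have l: "0 \<le> l" by (simp add: l_def last_hit_nonneg)
    have "l\<^sup>2 / C T \<le> l / (\<tau> * real (card T))"
    proof (cases "l = 0")
      case False
      then have l0: "0 < l" using l by simp
      have le: "\<tau> * (real (card T) * l) \<le> C T" using hit[OF T] by (simp add: l_def)
      have pos: "0 < \<tau> * (real (card T) * l)" using \<tau> c l0 by simp
      have "l\<^sup>2 / C T \<le> l\<^sup>2 / (\<tau> * (real (card T) * l))"
        by (rule divide_left_mono[OF le]) (use pos le in \<open>auto intro!: mult_pos_pos\<close>)
      also have "\<dots> = l / (\<tau> * real (card T))" using l0 by (simp add: power2_eq_square)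
      finally show ?thesis .
    qed simp
    then have "l\<^sup>2 / C T / (r * x) \<le> l / (\<tau> * real (card T)) / (r * x)"
      using r x by (intro divide_right_mono) auto
    moreover have "(reject_amplitude n k r p T)\<^sup>2 = l\<^sup>2 / (r * x)"
      using True r x by (simp add: reject_amplitude_def l_def x_def power_divide mult_ac)
    ultimately show ?thesis using True by (simp add: l_def x_def mult_ac)
  next
    case False
    then show ?thesis by (auto simp: reject_amplitude_def last_hit_def)
  qed
  then have "(\<Sum>T\<in>Pow {..<n}. (reject_amplitude n k r p T)\<^sup>2 / C T) \<le> 1 / (\<tau> * r) * (\<Sum>T\<in>Pow {..<n}. ?g T)"
    unfolding sum_distrib_left by (intro sum_mono) simp
  also have "\<dots> \<le> 1 / (\<tau> * r) * (3 * real (k + d) / real d)"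
    using last_hit_weighted[OF k] \<tau> r by (intro mult_left_mono) auto
  finally show "(\<Sum>T\<in>Pow {..<n}. (reject_amplitude n k r p T)\<^sup>2 / C T) \<le> 3 * real (k + d) / (real d * \<tau> * r)"
    by (simp add: mult_ac)
qed

section \<open>Workspace and oracle\<close>

lemma sum_nat_product:
  fixes f :: "nat \<Rightarrow> 'a::comm_monoid_add"
  shows "(\<Sum>z<N * M. f z) = (\<Sum>a<M. \<Sum>x<N. f (x + N * a))"
  unfolding sum.cartesian_product
proof (rule sum.reindex_bij_witness[of _ "\<lambda>(a, x). x + N * a" "\<lambda>z. (z div N, z mod N)"])
  fix z assume "z \<in> {..<N * M}"
  then have "z < M * N" by (simp add: mult.commute)
  moreover have "0 < N" using \<open>z < M * N\<close> by (cases N) auto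
  ultimately show "(z div N, z mod N) \<in> {..<M} \<times> {..<N}" by (simp add: less_mult_imp_div_less)
next
  fix p assume "p \<in> {..<M} \<times> {..<N}"
  then obtain a x where p: "p = (a, x)" "a < M" "x < N" by auto
  then show "((case p of (a, x) \<Rightarrow> x + N * a) div N, (case p of (a, x) \<Rightarrow> x + N * a) mod N) = p" by simp
  have "x + N * a < N * Suc a" using p by simp
  also have "\<dots> \<le> N * M" using p by (intro mult_le_mono2) simp
  finally show "(case p of (a, x) \<Rightarrow> x + N * a) \<in> {..<N * M}" using p by simp
qed auto

lemma oracle_apply:
  assumes "z < 2 ^ n * 2 ^ m"
  shows "mat_vec (2 ^ n * 2 ^ m) (extend_oracle n U) v z = (\<Sum>x<2 ^ n. U (z mod 2 ^ n) x * v (x + 2 ^ n * (z div 2 ^ n)))"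
proof -
  have q: "z div 2 ^ n < 2 ^ m" using assms by (simp add: less_mult_imp_div_less mult.commute)
  have "mat_vec (2 ^ n * 2 ^ m) (extend_oracle n U) v z =
    (\<Sum>a<2 ^ m. \<Sum>x<2 ^ n. if a = z div 2 ^ n then U (z mod 2 ^ n) x * v (x + 2 ^ n * a) else 0)"
    unfolding mat_vec_def sum_nat_product by (intro sum.cong refl) (auto simp: extend_oracle_def)
  also have "\<dots> = (\<Sum>a<2 ^ m. if a = z div 2 ^ n then \<Sum>x<2 ^ n. U (z mod 2 ^ n) x * v (x + 2 ^ n * a) else 0)"
    by (intro sum.cong refl) auto
  finally show ?thesis using q by simp
qed

lemma oracle_unitary:
  assumes "is_unitary (2 ^ n) U"
  shows "is_unitary (2 ^ n * 2 ^ m) (extend_oracle n U)"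
  unfolding is_unitary_def
proof (intro allI impI)
  fix i j :: nat assume ij: "i < 2 ^ n * 2 ^ m" "j < 2 ^ n * 2 ^ m"
  have q: "i div 2 ^ n < 2 ^ m" using ij by (simp add: less_mult_imp_div_less mult.commute)
  have "(\<Sum>l<2 ^ n * 2 ^ m. cnj (extend_oracle n U l i) * extend_oracle n U l j) =
     (\<Sum>a<2 ^ m. \<Sum>x<2 ^ n. if a = i div 2 ^ n then (if i div 2 ^ n = j div 2 ^ n then cnj (U x (i mod 2 ^ n)) * U x (j mod 2 ^ n) else 0) else 0)"
    unfolding sum_nat_product by (intro sum.cong refl) (auto simp: extend_oracle_def)
  also have "\<dots> = (\<Sum>a<2 ^ m. if a = i div 2 ^ n then (if i div 2 ^ n = j div 2 ^ n then \<Sum>x<2 ^ n. cnj (U x (i mod 2 ^ n)) * U x (j mod 2 ^ n) else 0) else 0)"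
    by (intro sum.cong refl) auto
  also have "\<dots> = (if i div 2 ^ n = j div 2 ^ n then if i mod 2 ^ n = j mod 2 ^ n then 1 else 0 else 0)"
    using q assms by (simp add: is_unitary_def)
  also have "\<dots> = (if i = j then 1 else 0)"
    by (metis div_mult_mod_eq)
  finally show "(\<Sum>l<2 ^ n * 2 ^ m. cnj (extend_oracle n U l i) * extend_oracle n U l j) = (if i = j then 1 else 0)" .
qed

lemma adjoint_oracle: "adjoint (extend_oracle n U) = extend_oracle n (adjoint U)"
  by (intro ext) (auto simp: adjoint_def extend_oracle_def)

text \<open>The oracle acts within blocks of \<open>2 ^ n\<close> consecutive indices, and
  \<open>(2 ^ n) ^ 3\<close> is a block boundary; private and public indices are never
  mixed.\<close>

lemma oracle_low:
  assumes "\<And>i. i < (2 ^ n) ^ 3 \<Longrightarrow> v i = 0" "i < (2 ^ n) ^ 3" "(2 ^ n) ^ 3 \<le> (2::nat) ^ n * 2 ^ m"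
  shows "mat_vec (2 ^ n * 2 ^ m) (extend_oracle n U) v i = 0"
proof -
  have "x + 2 ^ n * (i div 2 ^ n) < (2 ^ n) ^ 3" if "x < 2 ^ n" for x
  proof -
    have "i div 2 ^ n < 2 ^ n * 2 ^ n"
      using assms(2) by (simp add: less_mult_imp_div_less power3_eq_cube)
    then have "2 ^ n * Suc (i div 2 ^ n) \<le> 2 ^ n * (2 ^ n * 2 ^ n)" by (intro mult_le_mono2) simp
    then show ?thesis using that by (simp add: power3_eq_cube)
  qed
  then show ?thesis using assms by (simp add: oracle_apply)
qed

lemma oracle_high:
  assumes "\<And>i. (2 ^ n) ^ 3 \<le> i \<Longrightarrow> v i = 0" "(2 ^ n) ^ 3 \<le> i" "i < 2 ^ n * 2 ^ m"
  shows "mat_vec (2 ^ n * 2 ^ m) (extend_oracle n U) v i = 0"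
proof -
  have "(2 ^ n * 2 ^ n) * 2 ^ n div 2 ^ n \<le> i div 2 ^ n"
    using assms(2) by (intro div_le_mono) (simp add: power3_eq_cube)
  then have le: "2 ^ n * (2 ^ n * 2 ^ n) \<le> 2 ^ n * (i div 2 ^ n)" by (intro mult_le_mono2) simp
  have cube: "(2 ^ n) ^ 3 = 2 ^ n * (2 ^ n * 2 ^ n :: nat)" by (simp add: power3_eq_cube)
  have "v (x + 2 ^ n * (i div 2 ^ n)) = 0" for x
    by (rule assms(1), unfold cube, rule trans_le_add2, rule le)
  then show ?thesis using assms by (simp add: oracle_apply)
qed

text \<open>The private space: a set \<open>T\<close> of qubits, the system register \<open>x\<close> and a reference register \<open>y\<close>, all three encoded
  as subsets of \<open>{..<n}\<close>.\<close>

definition private_index :: "nat \<Rightarrow> nat set \<Rightarrow> nat set \<Rightarrow> nat set \<Rightarrow> nat" where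
  "private_index n T x y = set_encode x + 2 ^ n * (set_encode y + 2 ^ n * set_encode T)"

definition lift :: "nat \<Rightarrow> (nat set \<Rightarrow> nat set \<times> nat set \<Rightarrow> complex) \<Rightarrow> cvec" where
  "lift n \<zeta> z = (if z < (2 ^ n) ^ 3
     then \<zeta> (set_decode (z div 2 ^ n div 2 ^ n)) (set_decode (z mod 2 ^ n), set_decode (z div 2 ^ n mod 2 ^ n)) else 0)"

lemma sum_private:
  "(\<Sum>z<(2 ^ n) ^ 3. f z) = (\<Sum>T\<in>Pow {..<n}. \<Sum>p\<in>pairs {..<n}. f (private_index n T (fst p) (snd p)))"
proof -
  have "(\<Sum>z<(2 ^ n) ^ 3. f z) = (\<Sum>z<2 ^ n * (2 ^ n * 2 ^ n). f z)"
    by (simp only: power3_eq_cube mult.assoc)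
  also have "\<dots> = (\<Sum>T<2 ^ n. \<Sum>y<2 ^ n. \<Sum>x<2 ^ n. f (x + 2 ^ n * (y + 2 ^ n * T)))"
    by (simp only: sum_nat_product)
  also have "\<dots> = (\<Sum>T\<in>Pow {..<n}. \<Sum>y\<in>Pow {..<n}. \<Sum>x\<in>Pow {..<n}. f (private_index n T x y))"
    by (simp only: sum_bits private_index_def)
  finally show ?thesis by (simp add: sum_pairs_swap)
qed

lemma lift_private_index:
  assumes "T \<subseteq> {..<n}" "x \<subseteq> {..<n}" "y \<subseteq> {..<n}"
  shows "lift n \<zeta> (private_index n T x y) = \<zeta> T (x, y)"
proof -
  have less: "set_encode T < 2 ^ n" "set_encode x < 2 ^ n" "set_encode y < 2 ^ n"
    using assms by (auto simp: set_encode_less)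
  have "2 ^ n * Suc (set_encode y + 2 ^ n * set_encode T) \<le> 2 ^ n * (2 ^ n * Suc (set_encode T))"
    using less by (intro mult_le_mono2) simp
  also have "\<dots> \<le> 2 ^ n * (2 ^ n * 2 ^ n)" using less by (intro mult_le_mono2) simp
  finally have "private_index n T x y < (2 ^ n) ^ 3" using less by (simp add: private_index_def power3_eq_cube)
  then show ?thesis using less assms by (simp add: lift_def private_index_def finite_bits)
qed

lemma lift_cong:
  assumes "\<And>T x y. T \<subseteq> {..<n} \<Longrightarrow> x \<subseteq> {..<n} \<Longrightarrow> y \<subseteq> {..<n} \<Longrightarrow> \<zeta> T (x, y) = \<xi> T (x, y)"
  shows "lift n \<zeta> = lift n \<xi>"
proof
  fix z
  show "lift n \<zeta> z = lift n \<xi> z"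
  proof (cases "z < (2 ^ n) ^ 3")
    case True
    then have "z div 2 ^ n div 2 ^ n < 2 ^ n"
      by (simp add: less_mult_imp_div_less power3_eq_cube)
    then show ?thesis
      using True by (simp add: lift_def assms set_decode_subset)
  qed (simp add: lift_def)
qed

lemma lift_sum: "lift n (\<lambda>T p. \<Sum>a\<in>J. c a * \<zeta> a T p) i = (\<Sum>a\<in>J. c a * lift n (\<zeta> a) i)"
  by (simp add: lift_def)

lemma ip_lift:
  assumes "(2 ^ n) ^ 3 \<le> d"
  shows "ip d (lift n \<zeta>) (lift n \<xi>) = (\<Sum>T\<in>Pow {..<n}. \<Sum>p\<in>pairs {..<n}. cnj (\<zeta> T p) * \<xi> T p)"
proof -
  have "ip d (lift n \<zeta>) (lift n \<xi>) = (\<Sum>z<(2 ^ n) ^ 3. cnj (lift n \<zeta> z) * lift n \<xi> z)"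
    unfolding ip_def using assms by (intro sum.mono_neutral_right) (auto simp: lift_def)
  also have "\<dots> = (\<Sum>T\<in>Pow {..<n}. \<Sum>p\<in>pairs {..<n}. cnj (\<zeta> T p) * \<xi> T p)"
    unfolding sum_private by (intro sum.cong refl) (auto simp: lift_private_index)
  finally show ?thesis .
qed

lemma oracle_lift:
  assumes "z < 2 ^ n * 2 ^ m"
  shows "mat_vec (2 ^ n * 2 ^ m) (extend_oracle n U) (lift n \<zeta>) z =
    lift n (\<lambda>T (x, y). \<Sum>x'\<in>Pow {..<n}. set_matrix U x x' * \<zeta> T (x', y)) z"
proof (cases "z < (2 ^ n) ^ 3")
  case True
  have q: "z div 2 ^ n < 2 ^ n * 2 ^ n"
    using True by (simp add: less_mult_imp_div_less power3_eq_cube)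
  have low: "x + 2 ^ n * (z div 2 ^ n) < (2 ^ n) ^ 3" if "x < 2 ^ n" for x
  proof -
    have "2 ^ n * Suc (z div 2 ^ n) \<le> 2 ^ n * (2 ^ n * 2 ^ n)" using q by (intro mult_le_mono2) simp
    then show ?thesis using that by (simp add: power3_eq_cube)
  qed
  have "mat_vec (2 ^ n * 2 ^ m) (extend_oracle n U) (lift n \<zeta>) z =
     (\<Sum>x'\<in>Pow {..<n}. U (z mod 2 ^ n) (set_encode x') * lift n \<zeta> (set_encode x' + 2 ^ n * (z div 2 ^ n)))"
    unfolding oracle_apply[OF assms] sum_bits ..
  also have "\<dots> = (\<Sum>x'\<in>Pow {..<n}. U (z mod 2 ^ n) (set_encode x') *
      \<zeta> (set_decode (z div 2 ^ n div 2 ^ n)) (x', set_decode (z div 2 ^ n mod 2 ^ n)))"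
    by (intro sum.cong refl) (simp add: lift_def low set_encode_less finite_bits)
  finally show ?thesis using True by (simp add: lift_def set_matrix_def)
next
  case False
  then show ?thesis using oracle_high[of n "lift n \<zeta>" z m U] assms by (simp add: lift_def)
qed

section \<open>Bell coordinates and the Choi state of the oracle\<close>

definition bell_vec :: "nat \<Rightarrow> (nat set \<Rightarrow> nat set \<times> nat set \<Rightarrow> complex) \<Rightarrow> cvec" where
  "bell_vec n c = lift n (\<lambda>T p. \<Sum>g\<in>pairs {..<n}. c T g * bell {..<n} g p)"

lemma ip_bell_vec:
  assumes "(2 ^ n) ^ 3 \<le> d"
  shows "ip d (bell_vec n c) (bell_vec n e) = (\<Sum>T\<in>Pow {..<n}. \<Sum>g\<in>pairs {..<n}. cnj (c T g) * e T g)"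
  unfolding bell_vec_def ip_lift[OF assms]
  by (intro sum.cong refl bell_expansion_ip) auto

lemma nsq_bell_vec:
  assumes "(2 ^ n) ^ 3 \<le> d"
  shows "nsq d (bell_vec n c) = (\<Sum>T\<in>Pow {..<n}. \<Sum>g\<in>pairs {..<n}. (cmod (c T g))\<^sup>2)"
proof -
  have "complex_of_real (nsq d (bell_vec n c)) = of_real (\<Sum>T\<in>Pow {..<n}. \<Sum>g\<in>pairs {..<n}. (cmod (c T g))\<^sup>2)"
    unfolding ip_self[symmetric] ip_bell_vec[OF assms] of_real_sum complex_norm_square by (simp add: mult.commute)
  then show ?thesis unfolding of_real_eq_iff .
qed

definition bell_unit :: "nat \<Rightarrow> nat set \<Rightarrow> nat set \<times> nat set \<Rightarrow> cvec" where
  "bell_unit n T g = bell_vec n (\<lambda>T' g'. if T' = T \<and> g' = g then 1 else 0)"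

lemma bell_vec_expansion:
  "bell_vec n c i = (\<Sum>(T, g)\<in>Pow {..<n} \<times> pairs {..<n}. c T g * bell_unit n T g i)"
proof -
  let ?b = "\<lambda>T a p. \<Sum>g\<in>pairs {..<n}. (if T = fst a \<and> g = snd a then 1 else 0) * bell {..<n} g p"
  have "bell_vec n c = lift n (\<lambda>T p. \<Sum>a\<in>Pow {..<n} \<times> pairs {..<n}. c (fst a) (snd a) *
     ?b T a p)"
    unfolding bell_vec_def
  proof (rule lift_cong)
    fix T x y assume T: "T \<subseteq> {..<n}"
    have "(\<Sum>a\<in>Pow {..<n} \<times> pairs {..<n}. c (fst a) (snd a) *
        ?b T a (x, y))
      = (\<Sum>T'\<in>Pow {..<n}. \<Sum>g'\<in>pairs {..<n}. if T' = T then c T' g' * bell {..<n} g' (x, y) else 0)"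
      unfolding sum.cartesian_product
    proof (intro sum.cong refl)
      fix a assume "a \<in> Pow {..<n} \<times> pairs {..<n}"
      then obtain T' g' where a: "a = (T', g')" "g' \<in> pairs {..<n}" by auto
      have "(\<Sum>g\<in>pairs {..<n}. (if T = T' \<and> g = g' then 1 else 0) * bell {..<n} g (x, y))
        = (\<Sum>g\<in>pairs {..<n}. if g = g' then (if T = T' then bell {..<n} g (x, y) else 0) else 0)"
        by (intro sum.cong refl) auto
      also have "\<dots> = (if T = T' then bell {..<n} g' (x, y) else 0)"
        using a(2) by (subst sum.delta) auto
      finally show "c (fst a) (snd a) * ?b T a (x, y)
        = (case a of (T', g') \<Rightarrow> if T' = T then c T' g' * bell {..<n} g' (x, y) else 0)"
        by (simp add: a(1))
    qed
    also have "\<dots> = (\<Sum>g'\<in>pairs {..<n}. \<Sum>T'\<in>Pow {..<n}. if T' = T then c T' g' * bell {..<n} g' (x, y) else 0)"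
      by (rule sum.swap)
    also have "\<dots> = (\<Sum>g'\<in>pairs {..<n}. c T g' * bell {..<n} g' (x, y))"
      using T by (intro sum.cong refl) (subst sum.delta, auto)
    finally show "(\<Sum>g\<in>pairs {..<n}. c T g * bell {..<n} g (x, y)) = (\<Sum>a\<in>Pow {..<n} \<times> pairs {..<n}. c (fst a) (snd a) *
        ?b T a (x, y))" by simp
  qed
  then show ?thesis
    by (simp add: lift_sum bell_unit_def bell_vec_def case_prod_unfold)
qed

text \<open>The positive witness: the maximally entangled state of system and reference, with \<open>T\<close> in
  superposition over the sets disjoint from \<open>A\<close>.\<close>

definition accept_vec :: "nat \<Rightarrow> nat \<Rightarrow> real \<Rightarrow> nat set \<Rightarrow> cvec" where
  "accept_vec n k r A = lift n (\<lambda>T (x, y). if x = y then of_real (accept_amplitude n k r A T) / of_real (sqrt (2 ^ n)) else 0)"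

lemma accept_vec_norm:
  assumes "(2 ^ n) ^ 3 \<le> d" "A \<subseteq> {..<n}" "card A = k" "1 \<le> k" "k < n" "0 < r"
  shows "nsq d (accept_vec n k r A) \<le> 8 * r * ln (real k + 1)"
proof -
  let ?a = "accept_amplitude n k r A"
  let ?f = "\<lambda>T p. case p of (x, y) \<Rightarrow> if x = y then complex_of_real (?a T) / of_real (sqrt (2 ^ n)) else 0"
  have "complex_of_real (nsq d (accept_vec n k r A)) = of_real (\<Sum>T\<in>Pow {..<n}. (?a T)\<^sup>2)"
    unfolding ip_self[symmetric] accept_vec_def ip_lift[OF assms(1)] of_real_sum
  proof (intro sum.cong refl)
    fix T
    have "(\<Sum>p\<in>pairs {..<n}. cnj (?f T p) *
        ?f T p)
      = (\<Sum>y\<in>Pow {..<n}. \<Sum>x\<in>Pow {..<n}. if x = y then of_real ((?a T)\<^sup>2) / 2 ^ n else 0)"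
      unfolding sum_pairs_swap
      using sqrt_power2_square[of n] by (intro sum.cong refl) (simp add: power2_eq_square)
    also have "\<dots> = of_real ((?a T)\<^sup>2)" by (simp add: card_Pow)
    finally show "(\<Sum>p\<in>pairs {..<n}. cnj (?f T p) *
        ?f T p) = of_real ((?a T)\<^sup>2)" .
  qed
  then have "nsq d (accept_vec n k r A) = (\<Sum>T\<in>Pow {..<n}. (?a T)\<^sup>2)" unfolding of_real_eq_iff .
  then show ?thesis using accept_amplitude_norm[OF assms(2-6)] by simp
qed

text \<open>A unitary applied to half of a maximally entangled state yields its vectorisation, whose
  Bell coordinates are the Pauli coefficients. The register holding \<open>T\<close> is
  untouched.\<close>

lemma oracle_accept_vec:
  assumes "i < 2 ^ n * 2 ^ m"
  shows "mat_vec (2 ^ n * 2 ^ m) (extend_oracle n U) (accept_vec n k r A) i =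
    bell_vec n (\<lambda>T g. of_real (accept_amplitude n k r A T) * pauli_coeff {..<n} (set_matrix U) g) i"
  unfolding accept_vec_def oracle_lift[OF assms] bell_vec_def
proof (rule fun_cong[OF lift_cong])
  fix T x y assume xy: "x \<subseteq> {..<n}" "y \<subseteq> {..<n}"
  let ?a = "complex_of_real (accept_amplitude n k r A T)"
  have "(\<Sum>x'\<in>Pow {..<n}. set_matrix U x x' * (if x' = y then ?a / of_real (sqrt (2 ^ n)) else 0))
      = (\<Sum>x'\<in>Pow {..<n}. if x' = y then set_matrix U x x' * (?a / of_real (sqrt (2 ^ n))) else 0)"
    by (intro sum.cong refl) auto
  also have "\<dots> = ?a * (set_matrix U x y / of_real (sqrt (2 ^ n)))" using xy by (subst sum.delta) auto
  also have "\<dots> = ?a * (\<Sum>g\<in>pairs {..<n}. pauli_coeff {..<n} (set_matrix U) g * bell {..<n} g (x, y))"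
    using pauli_expansion[of "{..<n}" x y "set_matrix U"] xy by simp
  finally show "(case (x, y) of (x, y) \<Rightarrow> \<Sum>x'\<in>Pow {..<n}. set_matrix U x x' * (case (x', y) of (x, y) \<Rightarrow> if x = y then ?a / of_real (sqrt (2 ^ n)) else 0))
      = (\<Sum>g\<in>pairs {..<n}. ?a * pauli_coeff {..<n} (set_matrix U) g * bell {..<n} g (x, y))"
    by (simp add: sum_distrib_left mult.assoc)
qed

section \<open>The tester\<close>

lemma alg_state_run:
  "alg_state n m W odd U t = run (2 ^ n * 2 ^ m) W (extend_oracle n U) (extend_oracle n (adjoint U)) t"
  by (induction t) (simp_all add: basis_def)

text \<open>All possible positive catalysts at once: the rounds are built from the whole family, as
  \<open>A\<close> is unknown.\<close>

definition testers :: "nat \<Rightarrow> nat \<Rightarrow> real \<Rightarrow> cvec set" where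
  "testers n k r = accept_vec n k r ` {A. A \<subseteq> {..<n} \<and> card A = k}"

text \<open>The Bell states of Paulis acting as the identity on \<open>T\<close>. For a junta on
  \<open>A\<close> and \<open>T\<close> disjoint from \<open>A\<close>, only these occur in the
  image of the catalyst.\<close>

definition trivial_vecs :: "nat \<Rightarrow> cvec set" where
  "trivial_vecs n = (\<lambda>(T, g). bell_unit n T g) ` {(T, g) \<in> Pow {..<n} \<times> pairs {..<n}. pauli_support g \<inter> T = {}}"

text \<open>The negative witness.  Where the coverage of \<open>T\<close> vanishes so does the reject amplitude, and
  the quotient is \<open>0 / 0 = 0\<close>.\<close>

lemma far_witness:
  assumes U: "is_unitary (2 ^ n) U" and k: "1 \<le> k" "k < n" and r: "0 < r" and \<epsilon>: "0 < \<epsilon>"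
    and D: "(2 ^ n) ^ 3 \<le> (2::nat) ^ n * 2 ^ m"
    and far: "far_from_juntas n k \<epsilon> U"
  shows "\<exists>c. (\<forall>f\<in>trivial_vecs n. ip (2 ^ n * 2 ^ m) f (bell_vec n c) = 0) \<and>
    nsq (2 ^ n * 2 ^ m) (bell_vec n c) \<le> 24 * real k * harm k / (\<epsilon>\<^sup>2 * r) \<and>
    (\<forall>u\<in>testers n k r. ip (2 ^ n * 2 ^ m) u (mat_vec (2 ^ n * 2 ^ m) (extend_oracle n (adjoint U)) (bell_vec n c)) = 1)"
proof -
  let ?D = "2 ^ n * 2 ^ m :: nat"
  let ?w = "\<lambda>T g. if pauli_support g \<inter> T \<noteq> {} then pauli_weight n U g else 0"
  define q where "q = pauli_coeff {..<n} (set_matrix U)"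
  define C where "C = coverage (pairs {..<n}) (pauli_weight n U) pauli_support"
  have w0: "0 \<le> pauli_weight n U g" for g by (simp add: pauli_weight_def)
  have "\<epsilon>\<^sup>2 \<le> coverage (pairs {..<n}) (pauli_weight n U) pauli_support ({..<n} - A)" if "A \<subseteq> {..<n}" "card A = k" for A
    unfolding coverage_def pauli_weight_split[OF U that(1)] by (rule far_pauli_weight[OF U that \<epsilon> far])
  then obtain \<tau> e p where \<tau>: "0 < \<tau>" and e: "1 \<le> e" "e \<le> k" "k + e \<le> n" and e\<tau>: "\<epsilon>\<^sup>2 / (4 * harm k) \<le> real e * \<tau>"
    and p: "subset_distribution {..<n} (k + e) p"
    and cov: "\<And>T. T \<subseteq> {..<n} \<Longrightarrow> \<tau> * hit_prob {..<n} p T \<le> C T"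
    using coverage_witness[of "pairs {..<n}" "pauli_weight n U" k n "\<epsilon>\<^sup>2" pauli_support] w0 k \<epsilon> unfolding C_def
    by auto
  interpret hit_distribution n k e p by standard (use k e p in auto)
  let ?r = "reject_amplitude n k r p"
  note norm = reject_amplitude_norm[OF k(1) e(2) r \<tau> cov]
  \<comment> \<open>The Choi state cut down to the Paulis that act on \<open>T\<close>. Their weight
    is \<open>C T\<close>; dividing by it makes the overlap for each \<open>T\<close> equal to the
    product of the two amplitudes and the squared norm equal to
    \<open>(?r T)\<^sup>2 / C T\<close>.\<close>
  define c where "c T g = (if pauli_support g \<inter> T \<noteq> {} then complex_of_real (?r T / C T) * q g else 0)" for T g
  have C_sum: "(\<Sum>g\<in>pairs {..<n}. ?w T g) = C T" for T
    unfolding C_def coverage_def by (rule sum.inter_filter[symmetric]) simp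
  have "ip ?D f (bell_vec n c) = 0" if f_in: "f \<in> trivial_vecs n" for f
  proof -
    obtain T0 g0 where f: "f = bell_unit n T0 g0" "pauli_support g0 \<inter> T0 = {}"
      using f_in by (auto simp: trivial_vecs_def)
    show ?thesis
      unfolding f(1) bell_unit_def ip_bell_vec[OF D]
      by (intro sum.neutral ballI) (use f(2) in \<open>auto simp: c_def\<close>)
  qed
  moreover have "nsq ?D (bell_vec n c) \<le> 24 * real k * harm k / (\<epsilon>\<^sup>2 * r)"
  proof -
    have "nsq ?D (bell_vec n c) = (\<Sum>T\<in>Pow {..<n}. (?r T)\<^sup>2 / C T)"
      unfolding nsq_bell_vec[OF D]
    proof (intro sum.cong refl)
      fix T
      have "(\<Sum>g\<in>pairs {..<n}. (cmod (c T g))\<^sup>2) =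
          (\<Sum>g\<in>pairs {..<n}. (?r T / C T)\<^sup>2 * ?w T g)"
        by (intro sum.cong refl) (simp add: c_def q_def pauli_weight_def norm_mult power_mult_distrib norm_divide power_divide)
      also have "\<dots> = (?r T / C T)\<^sup>2 * C T" unfolding sum_distrib_left[symmetric] C_sum ..
      also have "\<dots> = (?r T)\<^sup>2 / C T" by (simp add: power2_eq_square)
      finally show "(\<Sum>g\<in>pairs {..<n}. (cmod (c T g))\<^sup>2) = (?r T)\<^sup>2 / C T" .
    qed
    also have "\<dots> \<le> 3 * real (k + e) / (real e * \<tau> * r)" by (rule norm(1))
    also have "\<dots> \<le> 3 * (2 * real k) / (\<epsilon>\<^sup>2 / (4 * harm k) * r)"
    proof (rule frac_le)
      have h: "0 < (harm k :: real)" using k by (intro harm_pos) auto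
      show "0 < \<epsilon>\<^sup>2 / (4 * harm k) * r" using h \<epsilon> r by simp
      show "\<epsilon>\<^sup>2 / (4 * harm k) * r \<le> real e * \<tau> * r" using e\<tau> r by (intro mult_right_mono) auto
    qed (use e in auto)
    also have "\<dots> = 24 * real k * harm k / (\<epsilon>\<^sup>2 * r)" by simp
    finally show ?thesis .
  qed
  moreover have "ip ?D u (mat_vec ?D (extend_oracle n (adjoint U)) (bell_vec n c)) = 1" if u_in: "u \<in> testers n k r" for u
  proof -
    obtain A where u: "u = accept_vec n k r A" and A: "A \<subseteq> {..<n}" "card A = k"
      using u_in by (auto simp: testers_def)
    let ?a = "accept_amplitude n k r A"
    have "ip ?D u (mat_vec ?D (extend_oracle n (adjoint U)) (bell_vec n c)) = ip ?D (mat_vec ?D (extend_oracle n U) u) (bell_vec n c)"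
      by (simp add: ip_mat_vec_adjoint adjoint_oracle)
    also have "\<dots> = ip ?D (bell_vec n (\<lambda>T g. of_real (?a T) * q g)) (bell_vec n c)"
      by (rule ip_cong) (simp_all add: u oracle_accept_vec q_def)
    also have "\<dots> = (\<Sum>T\<in>Pow {..<n}. of_real (?a T * ?r T))"
      unfolding ip_bell_vec[OF D]
    proof (intro sum.cong refl)
      fix T assume T: "T \<in> Pow {..<n}"
      have "(\<Sum>g\<in>pairs {..<n}. cnj (of_real (?a T) * q g) * c T g) =
          (\<Sum>g\<in>pairs {..<n}. of_real (?a T * (?r T / C T) * ?w T g))"
      proof (intro sum.cong refl)
        fix g
        have "cnj (q g) * q g = of_real (pauli_weight n U g)"
          unfolding pauli_weight_def q_def complex_norm_square by (rule mult.commute)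
        then show "cnj (of_real (?a T) * q g) * c T g =
            of_real (?a T * (?r T / C T) * ?w T g)"
          by (simp add: c_def mult_ac)
      qed
      also have "\<dots> = of_real (?a T * (?r T / C T) * C T)"
        unfolding of_real_sum[symmetric] sum_distrib_left[symmetric] C_sum ..
      also have "?a T * (?r T / C T) * C T = ?a T * ?r T"
        using norm(2)[of T] T by (cases "C T = 0") auto
      finally show "(\<Sum>g\<in>pairs {..<n}. cnj (of_real (?a T) * q g) * c T g) = of_real (?a T * ?r T)" .
    qed
    also have "\<dots> = 1"
      unfolding of_real_sum[symmetric] amplitude_product[OF A k(1) r] by simp
    finally show ?thesis .
  qed
  ultimately show ?thesis by blast
qed

definition separates :: "nat \<Rightarrow> nat \<Rightarrow> real \<Rightarrow> (cmat \<Rightarrow> real) \<Rightarrow> bool" where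
  "separates n k \<epsilon> acc \<longleftrightarrow> (\<forall>U. is_unitary (2 ^ n) U \<longrightarrow>
     (is_qjunta n k U \<longrightarrow> acc U \<ge> 9/10) \<and> (far_from_juntas n k \<epsilon> U \<longrightarrow> 1 - acc U \<ge> 9/10))"

lemma tester:
  assumes k: "1 \<le> k" "k < n" and r: "0 < r" and \<epsilon>: "0 < \<epsilon>" and K: "1 \<le> K"
    and small: "800 * (8 * r * ln (real k + 1)) \<le> real K" "800 * (24 * real k * harm k / (\<epsilon>\<^sup>2 * r)) \<le> real K"
  shows "\<exists>m W. (\<forall>t. is_unitary (2 ^ n * 2 ^ m) (W t)) \<and> separates n k \<epsilon> (accept_prob n m (2 * K + 2) W odd {0})"
proof -
  \<comment> \<open>With the system register, \<open>2 * n\<close> ancillas hold the private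
    registers; \<open>K + 1\<close> further ones leave ample room for the public states.\<close>
  define m where "m = n + n + (K + 1)"
  define N where "N = (2::nat) ^ n"
  define D where "D = 2 ^ n * (2::nat) ^ m"
  \<comment> \<open>System register \<open>0\<close> and ancilla value \<open>N * N + t\<close>,
    just beyond the private block.\<close>
  define h where "h t = N ^ 3 + N * t" for t
  have N1: "1 \<le> N" by (simp add: N_def)
  have "N * N + K < 2 ^ m"
  proof -
    have "K + 1 < 2 ^ (K + 1)" by (rule less_exp)
    then obtain b where b: "2 ^ (K + 1) = K + 1 + b" by (metis less_imp_add_positive)
    have "2 ^ m = N * N * 2 ^ (K + 1)" by (simp only: m_def N_def power_add)
    also have "\<dots> = N * N + N * N * (K + b)" unfolding b by (simp add: algebra_simps)
    also have "\<dots> \<ge> N * N + 1 * (K + b)" using N1 by (intro add_left_mono mult_le_mono1) simp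
    finally have "N * N + (K + b) \<le> 2 ^ m" by simp
    moreover have "1 \<le> b" using b \<open>K + 1 < 2 ^ (K + 1)\<close> by linarith
    ultimately show ?thesis by linarith
  qed
  then have "N * (N * N + K) < N * 2 ^ m" using N1 by simp
  then have DK: "N ^ 3 + N * K < D" by (simp add: D_def N_def power3_eq_cube algebra_simps)
  then have D: "(2 ^ n) ^ 3 \<le> D" by (simp add: N_def)
  have finT: "finite (testers n k r)" by (simp add: testers_def)
  have finF: "finite (trivial_vecs n)"
    unfolding trivial_vecs_def by (rule finite_imageI, rule finite_subset[of _ "Pow {..<n} \<times> pairs {..<n}"]) auto
  interpret transducer D "N ^ 3" K h "testers n k r"
  proof
    show "0 < N ^ 3" "N ^ 3 \<le> D" using N1 D by (simp_all add: N_def)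
    show "inj_on h {..K}" using N1 by (auto simp: inj_on_def h_def)
    show "N ^ 3 \<le> h t \<and> h t < D" if "t \<le> K" for t
    proof -
      have "N * t \<le> N * K" using that by simp
      then have "h t < D" using DK unfolding h_def by linarith
      then show ?thesis by (simp add: h_def)
    qed
    show "u i = 0" if "u \<in> testers n k r" "N ^ 3 \<le> i" for u i
      using that by (auto simp: testers_def accept_vec_def lift_def N_def)
  qed (rule K)
  obtain W Q Hh G where rounds: "transducer_rounds D (N ^ 3) K h (testers n k r) (trivial_vecs n) W Q Hh G"
    and W_unitary: "\<forall>t. is_unitary D (W t)"
    using rounds_exist[OF finT finF] by (elim exE conjE) (rule that)
  interpret transducer_rounds D "N ^ 3" K h "testers n k r" "trivial_vecs n" W Q Hh G by (rule rounds)
  have "(is_qjunta n k U \<longrightarrow> 9 / 10 \<le> accept_prob n m (2 * K + 2) W odd {0} U) \<and>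
    (far_from_juntas n k \<epsilon> U \<longrightarrow> accept_prob n m (2 * K + 2) W odd {0} U \<le> 1 / 10)"
    if U: "is_unitary (2 ^ n) U" for U
  proof -
    let ?P = "extend_oracle n U" and ?P' = "extend_oracle n (adjoint U)"
    interpret transducer_run D "N ^ 3" K h "testers n k r" "trivial_vecs n" W Q Hh G ?P ?P'
    proof
      show "is_unitary D ?P" unfolding D_def by (rule oracle_unitary[OF U])
      show "?P' = adjoint ?P" by (simp add: adjoint_oracle)
      show "mat_vec D ?P v i = 0" if "\<And>i. i < N ^ 3 \<Longrightarrow> v i = 0" "i < N ^ 3" for v i
        using oracle_low[of n v i m U] that D unfolding D_def N_def by blast
    qed
    have prob: "accept_prob n m (2 * K + 2) W odd {0} U = (cmod (run D W ?P ?P' (2 * K + 2) 0))\<^sup>2"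
      by (simp only: accept_prob_def alg_state_run D_def) simp
    show ?thesis
    proof (intro conjI impI)
      assume "is_qjunta n k U"
      then obtain A where A: "A \<subseteq> {..<n}" "card A = k"
        and zero: "\<And>g. g \<in> pairs {..<n} \<Longrightarrow> pauli_support g \<inter> ({..<n} - A) \<noteq> {} \<Longrightarrow> pauli_coeff {..<n} (set_matrix U) g = 0"
        using junta_pauli_coeff[OF U] by blast
      let ?J = "{(T, g) \<in> Pow {..<n} \<times> pairs {..<n}. pauli_support g \<inter> T = {}}"
      let ?c = "\<lambda>T g. of_real (accept_amplitude n k r A T) * pauli_coeff {..<n} (set_matrix U) g"
      have "9 / 10 \<le> (cmod (run D W ?P ?P' (2 * K + 2) 0))\<^sup>2"
      proof (rule accepts[of "accept_vec n k r A" "\<lambda>(T, g). ?c T g" "\<lambda>(T, g). bell_unit n T g" ?J])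
        show "accept_vec n k r A \<in> testers n k r" using A by (auto simp: testers_def)
        show "800 * nsq D (accept_vec n k r A) \<le> real K"
          using accept_vec_norm[OF D A k r] small(1) by linarith
        show "(case a of (T, g) \<Rightarrow> bell_unit n T g) \<in> trivial_vecs n" if "a \<in> ?J" for a
          using that unfolding trivial_vecs_def by (rule imageI)
        fix i assume "i < D"
        then have "mat_vec D ?P (accept_vec n k r A) i = bell_vec n ?c i"
          unfolding D_def by (rule oracle_accept_vec)
        also have "\<dots> = (\<Sum>(T, g)\<in>Pow {..<n} \<times> pairs {..<n}. ?c T g * bell_unit n T g i)"
          by (rule bell_vec_expansion)
        also have "\<dots> = (\<Sum>(T, g)\<in>?J. ?c T g * bell_unit n T g i)"
        proof (rule sum.mono_neutral_right)
          show "\<forall>a\<in>Pow {..<n} \<times> pairs {..<n} - ?J. (case a of (T, g) \<Rightarrow> ?c T g * bell_unit n T g i) = 0"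
          proof
            fix a assume a: "a \<in> Pow {..<n} \<times> pairs {..<n} - ?J"
            obtain T g where Tg: "a = (T, g)" by (rule prod.exhaust)
            have "?c T g = 0"
            proof (cases "T \<subseteq> {..<n} - A")
              case True
              then have "pauli_support g \<inter> ({..<n} - A) \<noteq> {}" using a Tg by auto
              then show ?thesis using zero[of g] a Tg by simp
            next
              case False
              then show ?thesis by (simp add: accept_amplitude_def)
            qed
            then show "(case a of (T, g) \<Rightarrow> ?c T g * bell_unit n T g i) = 0" by (simp add: Tg)
          qed
        qed auto
        finally show "mat_vec D ?P (accept_vec n k r A) i = (\<Sum>a\<in>?J. (case a of (T, g) \<Rightarrow> ?c T g) * (case a of (T, g) \<Rightarrow> bell_unit n T g) i)"
          by (simp add: case_prod_unfold)
      qed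
      then show "9 / 10 \<le> accept_prob n m (2 * K + 2) W odd {0} U" by (simp only: prob)
    next
      assume far: "far_from_juntas n k \<epsilon> U"
      obtain c where orth: "\<forall>f\<in>trivial_vecs n. ip D f (bell_vec n c) = 0"
        and norm: "nsq D (bell_vec n c) \<le> 24 * real k * harm k / (\<epsilon>\<^sup>2 * r)"
        and uw: "\<forall>u\<in>testers n k r. ip D u (mat_vec D ?P' (bell_vec n c)) = 1"
        using far_witness[OF U k r \<epsilon> D[unfolded D_def] far] unfolding D_def by blast
      have high: "bell_vec n c i = 0" if "(2 ^ n) ^ 3 \<le> i" for i
        using that by (simp add: bell_vec_def lift_def)
      have "(cmod (run D W ?P ?P' (2 * K + 2) 0))\<^sup>2 \<le> 1 / 10"
      proof (rule rejects)
        show "bell_vec n c i = 0" if "N ^ 3 \<le> i" for i using high that by (simp add: N_def)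
        show "ip D f (bell_vec n c) = 0" if "f \<in> trivial_vecs n" for f using orth that by blast
        show "800 * nsq D (bell_vec n c) \<le> real K" using norm small(2) by linarith
        show "mat_vec D ?P' (bell_vec n c) i = 0" if "N ^ 3 \<le> i" "i < D" for i
          unfolding D_def by (rule oracle_high[OF high]) (use that in \<open>simp_all add: N_def D_def\<close>)
        show "ip D u (mat_vec D ?P' (bell_vec n c)) = 1" if "u \<in> testers n k r" for u using uw that by blast
      qed
      then show "accept_prob n m (2 * K + 2) W odd {0} U \<le> 1 / 10" by (simp only: prob)
    qed
  qed
  then show ?thesis using W_unitary unfolding D_def separates_def by (intro exI[of _ m] exI[of _ W]) auto
qed

text \<open>If one of the two promises is empty, a constant answer suffices.\<close>

lemma no_query_algorithm:
  assumes "(\<forall>U. is_unitary (2 ^ n) U \<longrightarrow> is_qjunta n k U \<longrightarrow> False) \<or>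
    (\<forall>U. is_unitary (2 ^ n) U \<longrightarrow> far_from_juntas n k \<epsilon> U \<longrightarrow> False)"
  shows "\<exists>W Acc. valid_alg n 0 0 W Acc \<and> separates n k \<epsilon> (accept_prob n 0 0 W odd Acc)"
proof -
  define W :: "nat \<Rightarrow> cmat" where "W t i j = (if i = j then 1 else 0)" for t i j
  have W: "is_unitary d (W t)" for d t unfolding W_def by (rule unitary_id)
  have W0: "mat_vec (2 ^ n * 2 ^ 0) (W 0) (\<lambda>z. if z = 0 then 1 else 0) 0 = 1"
    using sum_delta_lt[of 0 "2 ^ n" "\<lambda>z. if z = 0 then 1 else 0"] by (simp add: mat_vec_def W_def)
  show ?thesis
    using assms
  proof
    assume "\<forall>U. is_unitary (2 ^ n) U \<longrightarrow> is_qjunta n k U \<longrightarrow> False"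
    then show ?thesis
      by (intro exI[of _ W] exI[of _ "{}"]) (auto simp: valid_alg_def W accept_prob_def separates_def)
  next
    assume "\<forall>U. is_unitary (2 ^ n) U \<longrightarrow> far_from_juntas n k \<epsilon> U \<longrightarrow> False"
    moreover have "accept_prob n 0 0 W odd {0} U = 1" for U
      using W0 by (simp add: accept_prob_def)
    ultimately show ?thesis
      by (intro exI[of _ W] exI[of _ "{0}"]) (auto simp: valid_alg_def W separates_def)
  qed
qed

text \<open>The weight outside a set never exceeds \<open>1\<close>, and it vanishes when the set
  contains all qubits.\<close>

lemma far_impossible:
  assumes U: "is_unitary (2 ^ n) U" and "k \<le> n" "0 < \<epsilon>" "k = n \<or> 1 < \<epsilon>"
    and far: "far_from_juntas n k \<epsilon> U"
  shows False
proof -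
  have A: "{..<k} \<subseteq> {..<n}" "card {..<k} = k" using assms(2) by auto
  have *: "\<epsilon>\<^sup>2 \<le> 1 - sum (pauli_weight n U) (pairs {..<k})"
    by (rule far_pauli_weight[OF U A \<open>0 < \<epsilon>\<close> far])
  have "0 \<le> sum (pauli_weight n U) (pairs {..<k})" by (intro sum_nonneg) (simp add: pauli_weight_def)
  then have "\<epsilon>\<^sup>2 \<le> 1" using * by linarith
  then have "\<epsilon> \<le> 1" using assms(3) by (simp add: power_le_one_iff)
  then have "k = n" using assms(4) by auto
  then have "\<epsilon>\<^sup>2 \<le> 0" using * pauli_weight_total[OF U] by simp
  then show False using assms(3) by simp
qed

theorem mainTheorem1:
  shows "\<exists>C::real. C > 0 \<and>
    (\<forall>(k::nat) (\<epsilon>::real) (n::nat). k \<ge> 1 \<longrightarrow> \<epsilon> > 0 \<longrightarrow>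
      (\<exists>m T W qinv Acc.
         valid_alg n m T W Acc \<and>
         real T \<le> C * sqrt (real k * ln (real k + 1)) / \<epsilon> * ln (real k + 1) \<and>
         (\<forall>U. is_unitary (2^n) U \<longrightarrow>
            (is_qjunta n k U \<longrightarrow> accept_prob n m T W qinv Acc U \<ge> 9/10) \<and>
            ((\<forall>V. is_qjunta n k V \<longrightarrow> qdist n U V \<ge> \<epsilon>) \<longrightarrow>
               1 - accept_prob n m T W qinv Acc U \<ge> 9/10))))"
proof (intro exI[of _ "80000 :: real"] conjI allI impI)
  fix k n :: nat and \<epsilon> :: real
  assume k: "k \<ge> 1" and \<epsilon>: "\<epsilon> > 0"
  define l where "l = ln (real k + 1)"
  have "ln 2 \<le> l" using k by (simp add: l_def)
  then have l: "1 / 2 \<le> l" using ln_le_minus_one[of "1 / 2 :: real"] by (simp add: ln_div)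
  show "\<exists>m T W qinv Acc. valid_alg n m T W Acc \<and>
         real T \<le> 80000 * sqrt (real k * ln (real k + 1)) / \<epsilon> * ln (real k + 1) \<and>
         (\<forall>U. is_unitary (2^n) U \<longrightarrow>
            (is_qjunta n k U \<longrightarrow> accept_prob n m T W qinv Acc U \<ge> 9/10) \<and>
            ((\<forall>V. is_qjunta n k V \<longrightarrow> qdist n U V \<ge> \<epsilon>) \<longrightarrow>
               1 - accept_prob n m T W qinv Acc U \<ge> 9/10))"
  proof (cases "k < n \<and> \<epsilon> \<le> 1")
    case False
    have "(\<forall>U. is_unitary (2 ^ n) U \<longrightarrow> is_qjunta n k U \<longrightarrow> False) \<or>
      (\<forall>U. is_unitary (2 ^ n) U \<longrightarrow> far_from_juntas n k \<epsilon> U \<longrightarrow> False)"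
    proof (cases "k \<le> n")
      case True
      then show ?thesis using far_impossible[of n _ k \<epsilon>] \<epsilon> False by fastforce
    next
      case False
      then have "\<not> is_qjunta n k U" for U
        using card_mono[of "{..<n}"] by (fastforce simp: is_qjunta_def)
      then show ?thesis by blast
    qed
    from no_query_algorithm[OF this] obtain W Acc
      where "valid_alg n 0 0 W Acc" "separates n k \<epsilon> (accept_prob n 0 0 W odd Acc)" by blast
    moreover have "real 0 \<le> 80000 * sqrt (real k * ln (real k + 1)) / \<epsilon> * ln (real k + 1)"
      using \<epsilon> l by (simp add: l_def)
    ultimately show ?thesis unfolding separates_def far_from_juntas_def by blast
  next
    case True
    define x where "x = sqrt (real k) * l / \<epsilon>"
    \<comment> \<open>This balances the witnesses: with \<open>harm k \<le> 3 * l\<close>, both norm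
      bounds become \<open>24 * x\<close>, and \<open>K\<close> follows from
      \<open>800 * 24 = 19200\<close>.\<close>
    define r where "r = 3 * sqrt (real k) / \<epsilon>"
    define K where "K = nat \<lceil>19200 * x\<rceil>"
    have sk: "1 \<le> sqrt (real k)" using k by simp
    have r0: "0 < r" using sk \<epsilon> by (simp add: r_def)
    have x: "1 / 2 \<le> x"
    proof -
      have "1 * (1 / 2) \<le> sqrt (real k) * l" using sk l by (intro mult_mono) auto
      also have "\<dots> \<le> x" using True \<epsilon> sk l by (simp add: x_def le_divide_eq mult_left_le)
      finally show ?thesis by simp
    qed
    have K: "19200 * x \<le> real K" "real K \<le> 19200 * x + 1" using x by (simp_all add: K_def)
    then have K1: "1 \<le> K" using x by linarith
    have s1: "800 * (8 * r * ln (real k + 1)) \<le> real K"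
      using K(1) by (simp add: r_def x_def l_def)
    have h: "harm k \<le> 3 * l"
    proof -
      have "harm k \<le> 1 + ln (real k)" by (rule harm_le_ln[OF k])
      also have "ln (real k) \<le> l" using k by (simp add: l_def)
      finally show ?thesis using l by linarith
    qed
    have s2: "800 * (24 * real k * harm k / (\<epsilon>\<^sup>2 * r)) \<le> real K"
    proof -
      have "24 * real k * harm k / (\<epsilon>\<^sup>2 * r) \<le> 24 * real k * (3 * l) / (\<epsilon>\<^sup>2 * r)"
        using h r0 \<epsilon> by (intro divide_right_mono mult_left_mono) auto
      also have "\<dots> = 24 * x"
      proof -
        have "real k = sqrt (real k) * sqrt (real k)" by simp
        then have eq: "24 * real k * (3 * l) = 24 * x * (\<epsilon>\<^sup>2 * r)"
          using \<epsilon> by (simp add: x_def r_def power2_eq_square)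
        show ?thesis unfolding eq using r0 \<epsilon> by simp
      qed
      finally show ?thesis using K(1) by linarith
    qed
    obtain m W where W: "\<forall>t. is_unitary (2 ^ n * 2 ^ m) (W t)"
      and "separates n k \<epsilon> (accept_prob n m (2 * K + 2) W odd {0})"
      using tester[of k n r \<epsilon> K] True k r0 \<epsilon> K1 s1 s2 by auto
    moreover from W have "valid_alg n m (2 * K + 2) W {0}" by (simp add: valid_alg_def)
    \<comment> \<open>The construction needs only \<open>O(x)\<close> queries, with \<open>x\<close>
      of order \<open>sqrt k * ln (k + 1) / \<epsilon>\<close>. The additional factor
      \<open>sqrt l\<close> is at least \<open>1 / 2\<close>, whence the doubled constant.\<close>
    moreover have "real (2 * K + 2) \<le> 80000 * sqrt (real k * ln (real k + 1)) / \<epsilon> * ln (real k + 1)"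
    proof -
      have "real (2 * K + 2) \<le> 40000 * x" using K(2) x by simp
      also have "1 / 2 \<le> sqrt l" using l by (intro real_le_rsqrt) (simp add: power2_eq_square)
      then have "40000 * x \<le> 80000 * (x * sqrt l)" using x by (simp add: mult_left_mono)
      also have "\<dots> = 80000 * sqrt (real k * l) / \<epsilon> * l" by (simp add: x_def real_sqrt_mult)
      finally show ?thesis by (simp add: l_def)
    qed
    ultimately show ?thesis unfolding separates_def far_from_juntas_def by blast
  qed
qed simp

end
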